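(* Let $\Omega\Subset\mathbb{R}^n$ be open. Let $T$ be a positive closed current of bidimension $(p,p)$ on $\mathbb{R}^n\times\mathbb{R}^n$, let $T_j=T*\chi_j$, and let $v_0,\dots,v_q$ be convex functions on $\Omega$, where $1\le q\le p$. Let $(v_0^j)_j,\dots,(v_q^j)_j$ be sequences of convex functions on $\Omega$ converging locally uniformly to $v_0,\dots,v_q$ respectively, such that $v_i^j\ge v_i$ for all $i=1,\dots,q$ (and all $j$). Then, as $j\to+\infty$: (1) $T_j\wedge dd^{\#}v_1^j\wedge\dots\wedge dd^{\#}v_q^j\longrightarrow T\wedge dd^{\#}v_1\wedge\dots\wedge dd^{\#}v_q$ weakly on $\Omega$; (2) $v_0^jT_j\wedge dd^{\#}v_1^j\wedge\dots\wedge dd^{\#}v_q^j\longrightarrow v_0T\wedge dd^{\#}v_1\wedge\dots\wedge dd^{\#}v_q$ weakly on $\Omega$.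
   Context: Superforms and supercurrents (called forms and currents). On $\mathbb{R}^n\times\mathbb{R}^n$ with coordinates $(x,\xi)$, a form of bidegree $(p,q)$ is $\sum_{|K|=p,|L|=q}\alpha_{KL}(x)\,dx_K\wedge d\xi_L$, coefficients depending only on $x$; for $p=q$ it is symmetric if $\alpha_{KL}=\alpha_{LK}$. $J(\sum\alpha_K dx_K)=\sum\alpha_K d\xi_K$ on $(p,0)$-forms; $d=\sum_i\partial_{x_i}dx_i\wedge\cdot$, $d^{\#}=\sum_j\partial_{x_j}d\xi_j\wedge\cdot$; $\sigma_k=(-1)^{k(k-1)/2}$. $\int f\,dx_1\wedge d\xi_1\wedge\dots\wedge dx_n\wedge d\xi_n:=\int f\,dx$. A current of bidimension $(p,p)$ is a form of bidegree $(n-p,n-p)$ with distribution coefficients in $x$, acting on compactly supported (in $x$) smooth $(p,p)$-forms; a symmetric one is positive if $\langle T,\sigma_p\alpha\wedge J(\alpha)\rangle\ge0$ for all compactly supported smooth $(p,0)$-forms $\alpha$ (then its coefficients are measures); closed if $dT=0$. Weak convergence is convergence against test forms. Convolution $T*\chi_j$ is coefficientwise; $\chi\ge0$ is a radial smooth function supported in the unit ball with $\int\chi=1$, and $\chi_j(x)=j^n\chi(jx)$. For $T$ positive closed and $v_1,\dots,v_q$ convex, $T\wedge dd^{\#}v_1\wedge\dots\wedge dd^{\#}v_q$ is the positive closed current defined inductively by $T\wedge dd^{\#}v_1\wedge\dots\wedge dd^{\#}v_q=dd^{\#}(v_1T\wedge dd^{\#}v_2\wedge\dots\wedge dd^{\#}v_q)$.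 *)

theory Defs
  imports "HOL-Analysis.Analysis"
begin

section \<open>Test functions and distributions\<close>

definition partial_x :: "'n::finite \<Rightarrow> (real^'n \<Rightarrow> real) \<Rightarrow> real^'n \<Rightarrow> real" where
  "partial_x i f x = frechet_derivative f (at x) (axis i 1)"

definition smooth :: "(real^'n::finite \<Rightarrow> real) \<Rightarrow> bool" where
  "smooth f \<longleftrightarrow> (\<forall>is. fold partial_x is f differentiable_on UNIV)"

definition test_functions :: "(real^'n::finite) set \<Rightarrow> (real^'n \<Rightarrow> real) set" where
  "test_functions U =
     {f. smooth f \<and> compact (closure {x. f x \<noteq> 0}) \<and> closure {x. f x \<noteq> 0} \<subseteq> U}"

text \<open>
  A distribution is a functional on all functions of which only the values on test functions
  are meaningful. Continuity is the usual seminorm estimate on each compact subset of \<open>U\<close>,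
  where \<open>M\<close> bounds all partial derivatives up to order \<open>N\<close>.
\<close>

type_synonym 'n distr = "(real^'n \<Rightarrow> real) \<Rightarrow> real"

definition distribution :: "(real^'n::finite) set \<Rightarrow> 'n distr \<Rightarrow> bool" where
  "distribution U D \<longleftrightarrow>
     (\<forall>f\<in>test_functions U. \<forall>g\<in>test_functions U. D (\<lambda>x. f x + g x) = D f + D g) \<and>
     (\<forall>f\<in>test_functions U. \<forall>c. D (\<lambda>x. c * f x) = c * D f) \<and>
     (\<forall>K. compact K \<and> K \<subseteq> U \<longrightarrow>
        (\<exists>C N. \<forall>f\<in>test_functions U. \<forall>M.
           closure {x. f x \<noteq> 0} \<subseteq> K \<and>
           (\<forall>is x. length is \<le> N \<longrightarrow> \<bar>fold partial_x is f x\<bar> \<le> M) \<longrightarrow>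
           \<bar>D f\<bar> \<le> C * M))"

definition distr_partial :: "'n::finite \<Rightarrow> 'n distr \<Rightarrow> 'n distr" where
  "distr_partial i D = (\<lambda>f. - D (partial_x i f))"

definition distr_of_fun :: "(real^'n::finite \<Rightarrow> real) \<Rightarrow> 'n distr" where
  "distr_of_fun g = (\<lambda>f. \<integral>x. g x * f x \<partial>lborel)"

definition distr_conv :: "'n::finite distr \<Rightarrow> (real^'n \<Rightarrow> real) \<Rightarrow> real^'n \<Rightarrow> real" where
  "distr_conv D \<rho> x = D (\<lambda>y. \<rho> (x - y))"

text \<open>
  \<open>D\<close> is a measure on \<open>U\<close>: the difference \<open>\<mu> - \<nu>\<close> of two positive Radon measures. A pair is used
  because both may have infinite total mass. Their parts outside \<open>U\<close> play no role.
\<close>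

definition represents_measure ::
    "(real^'n::finite) set \<Rightarrow> 'n distr \<Rightarrow> (real^'n) measure \<times> (real^'n) measure \<Rightarrow> bool" where
  "represents_measure U D = (\<lambda>(\<mu>, \<nu>).
     sets \<mu> = sets borel \<and> sets \<nu> = sets borel \<and>
     (\<forall>K. compact K \<and> K \<subseteq> U \<longrightarrow> emeasure \<mu> K < \<infinity> \<and> emeasure \<nu> K < \<infinity>) \<and>
     (\<forall>f\<in>test_functions U. D f = (\<integral>x. f x \<partial>\<mu>) - (\<integral>x. f x \<partial>\<nu>)))"

text \<open>
  Product of a function \<open>u\<close>, continuous on \<open>U\<close>, with a measure \<open>D\<close> on \<open>U\<close>. On test functions the
  result does not depend on the chosen pair, since \<open>\<mu> - \<nu>\<close> is determined on \<open>U\<close> by \<open>D\<close>.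
\<close>

definition distr_mult ::
    "(real^'n::finite) set \<Rightarrow> (real^'n \<Rightarrow> real) \<Rightarrow> 'n distr \<Rightarrow> 'n distr" where
  "distr_mult U u D = (\<lambda>f. case (SOME m. represents_measure U D m) of
     (\<mu>, \<nu>) \<Rightarrow> (\<integral>x. u x * f x \<partial>\<mu>) - (\<integral>x. u x * f x \<partial>\<nu>))"


section \<open>Forms\<close>

text \<open>
  A form \<open>\<Sum> \<alpha>\<^sub>K\<^sub>L dx\<^sub>K \<and> d\<xi>\<^sub>L\<close> is given by its coefficients \<open>\<alpha> K L\<close>; the monomials \<open>dx\<^sub>K\<close> and \<open>d\<xi>\<^sub>L\<close>
  are taken with increasing indices, whence the linear order on the index type.
  \<open>shuffle_sign A B\<close> is the sign with \<open>dx\<^sub>A \<and> dx\<^sub>B = shuffle_sign A B dx\<^sub>A\<^sub>\<union>\<^sub>B\<close> for disjoint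
  \<open>A\<close>, \<open>B\<close>, and \<open>wedge_sign K L K' L'\<close> the one with
  \<open>(dx\<^sub>K \<and> d\<xi>\<^sub>L) \<and> (dx\<^sub>K\<^sub>' \<and> d\<xi>\<^sub>L\<^sub>') = wedge_sign K L K' L' dx\<^sub>K\<^sub>\<union>\<^sub>K\<^sub>' \<and> d\<xi>\<^sub>L\<^sub>\<union>\<^sub>L\<^sub>'\<close>
  for \<open>K\<close>, \<open>K'\<close> disjoint and \<open>L\<close>, \<open>L'\<close> disjoint.
\<close>

type_synonym 'n form = "'n set \<Rightarrow> 'n set \<Rightarrow> real^'n \<Rightarrow> real"

definition shuffle_sign :: "'n::{finite,linorder} set \<Rightarrow> 'n set \<Rightarrow> real" where
  "shuffle_sign A B = (-1) ^ card {(a, b). a \<in> A \<and> b \<in> B \<and> b < a}"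

definition wedge_sign ::
    "'n::{finite,linorder} set \<Rightarrow> 'n set \<Rightarrow> 'n set \<Rightarrow> 'n set \<Rightarrow> real" where
  "wedge_sign K L K' L' = (-1) ^ (card L * card K') * shuffle_sign K K' * shuffle_sign L L'"

definition wedge :: "'n::{finite,linorder} form \<Rightarrow> 'n form \<Rightarrow> 'n form" where
  "wedge \<alpha> \<beta> K L = (\<lambda>x. \<Sum>K'\<in>Pow K. \<Sum>L'\<in>Pow L.
     wedge_sign K' L' (K - K') (L - L') * \<alpha> K' L' x * \<beta> (K - K') (L - L') x)"

definition test_forms :: "(real^'n::{finite,linorder}) set \<Rightarrow> nat \<Rightarrow> nat \<Rightarrow> 'n form set" where
  "test_forms U p q = {\<alpha>. \<forall>K L. \<alpha> K L \<in> test_functions U \<and>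
     (card K \<noteq> p \<or> card L \<noteq> q \<longrightarrow> \<alpha> K L = (\<lambda>x. 0))}"

text \<open>The map \<open>J\<close>, meaningful on forms of bidegree \<open>(p,0)\<close>.\<close>

definition J_form :: "'n::{finite,linorder} form \<Rightarrow> 'n form" where
  "J_form \<alpha> K L = (if K = {} then \<alpha> L {} else (\<lambda>x. 0))"

definition sigma_sign :: "nat \<Rightarrow> real" where
  "sigma_sign k = (-1) ^ (k * (k - 1) div 2)"


section \<open>Currents\<close>

type_synonym 'n current = "'n set \<Rightarrow> 'n set \<Rightarrow> 'n distr"

definition current :: "(real^'n::{finite,linorder}) set \<Rightarrow> nat \<Rightarrow> 'n current \<Rightarrow> bool" where
  "current U p T \<longleftrightarrow> p \<le> CARD('n) \<and>
     (\<forall>K L. distribution U (T K L) \<and>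
        (card K \<noteq> CARD('n) - p \<or> card L \<noteq> CARD('n) - p \<longrightarrow>
           (\<forall>f\<in>test_functions U. T K L f = 0)))"

text \<open>
  The pairing is \<open>\<integral> T \<and> \<alpha>\<close>. The factor \<open>\<sigma>\<^sub>n\<close> comes from
  \<open>dx\<^sub>1 \<and> \<dots> \<and> dx\<^sub>n \<and> d\<xi>\<^sub>1 \<and> \<dots> \<and> d\<xi>\<^sub>n = \<sigma>\<^sub>n dx\<^sub>1 \<and> d\<xi>\<^sub>1 \<and> \<dots> \<and> dx\<^sub>n \<and> d\<xi>\<^sub>n\<close>.
\<close>

definition pairing :: "'n::{finite,linorder} current \<Rightarrow> 'n form \<Rightarrow> real" where
  "pairing T \<alpha> = sigma_sign CARD('n) *
     (\<Sum>K\<in>UNIV. \<Sum>L\<in>UNIV. wedge_sign K L (- K) (- L) * T K L (\<alpha> (- K) (- L)))"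

definition symmetric_current ::
    "(real^'n::{finite,linorder}) set \<Rightarrow> 'n current \<Rightarrow> bool" where
  "symmetric_current U T \<longleftrightarrow> (\<forall>K L. \<forall>f\<in>test_functions U. T K L f = T L K f)"

definition positive_current ::
    "(real^'n::{finite,linorder}) set \<Rightarrow> nat \<Rightarrow> 'n current \<Rightarrow> bool" where
  "positive_current U p T \<longleftrightarrow> symmetric_current U T \<and>
     (\<forall>\<alpha>\<in>test_forms U p 0.
        pairing T (\<lambda>K L x. sigma_sign p * wedge \<alpha> (J_form \<alpha>) K L x) \<ge> 0)"

definition d_current :: "'n::{finite,linorder} current \<Rightarrow> 'n current" where
  "d_current T K L = (\<lambda>f. \<Sum>i\<in>K.
     wedge_sign {i} {} (K - {i}) L * distr_partial i (T (K - {i}) L) f)"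

definition dsharp_current :: "'n::{finite,linorder} current \<Rightarrow> 'n current" where
  "dsharp_current T K L = (\<lambda>f. \<Sum>j\<in>L.
     wedge_sign {} {j} K (L - {j}) * distr_partial j (T K (L - {j})) f)"

definition closed_current ::
    "(real^'n::{finite,linorder}) set \<Rightarrow> 'n current \<Rightarrow> bool" where
  "closed_current U T \<longleftrightarrow> (\<forall>K L. \<forall>f\<in>test_functions U. d_current T K L f = 0)"

definition weakly_converges ::
    "(real^'n::{finite,linorder}) set \<Rightarrow> nat \<Rightarrow> (nat \<Rightarrow> 'n current) \<Rightarrow> 'n current \<Rightarrow> bool" where
  "weakly_converges U p S T \<longleftrightarrow>
     (\<forall>\<alpha>\<in>test_forms U p p. (\<lambda>j. pairing (S j) \<alpha>) \<longlonglongrightarrow> pairing T \<alpha>)"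

definition mult_current :: "(real^'n::{finite,linorder}) set \<Rightarrow>
    (real^'n::{finite,linorder} \<Rightarrow> real) \<Rightarrow> 'n current \<Rightarrow> 'n current" where
  "mult_current U u T K L = distr_mult U u (T K L)"

text \<open>\<open>wedge_ddsharp U T [v\<^sub>1, \<dots>, v\<^sub>q]\<close> is \<open>T \<and> dd\<^sup># v\<^sub>1 \<and> \<dots> \<and> dd\<^sup># v\<^sub>q\<close> on \<open>U\<close>.\<close>

primrec wedge_ddsharp :: "(real^'n::{finite,linorder}) set \<Rightarrow> 'n current \<Rightarrow>
    (real^'n::{finite,linorder} \<Rightarrow> real) list \<Rightarrow> 'n current" where
  "wedge_ddsharp U T [] = T"
| "wedge_ddsharp U T (v # vs) =
     d_current (dsharp_current (mult_current U v (wedge_ddsharp U T vs)))"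


section \<open>Regularization and convex functions\<close>

definition radial_mollifier :: "(real^'n::finite \<Rightarrow> real) \<Rightarrow> bool" where
  "radial_mollifier \<eta> \<longleftrightarrow> smooth \<eta> \<and> (\<forall>x. \<eta> x \<ge> 0) \<and>
     (\<forall>x y. norm x = norm y \<longrightarrow> \<eta> x = \<eta> y) \<and>
     (\<forall>x. \<eta> x \<noteq> 0 \<longrightarrow> x \<in> cball 0 1) \<and> (\<integral>x. \<eta> x \<partial>lborel) = 1"

definition scaled_mollifier :: "(real^'n::finite \<Rightarrow> real) \<Rightarrow> nat \<Rightarrow> real^'n \<Rightarrow> real" where
  "scaled_mollifier \<eta> j x = real j ^ CARD('n) * \<eta> (real j *\<^sub>R x)"

definition regularized_current ::
    "'n::{finite,linorder} current \<Rightarrow> (real^'n::{finite,linorder} \<Rightarrow> real) \<Rightarrow> nat \<Rightarrow> 'n current" where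
  "regularized_current T \<eta> j K L = distr_of_fun (distr_conv (T K L) (scaled_mollifier \<eta> j))"

text \<open>
  The library's \<open>convex_on U f\<close> forces the set \<open>U\<close> to be convex. On an arbitrary open set,
  convexity is required on every convex subset; for convex \<open>U\<close> this is \<open>convex_on U f\<close>.
\<close>

definition convex_function_on :: "(real^'n::finite) set \<Rightarrow> (real^'n \<Rightarrow> real) \<Rightarrow> bool" where
  "convex_function_on U f \<longleftrightarrow> (\<forall>S. S \<subseteq> U \<and> convex S \<longrightarrow> convex_on S f)"

definition locally_uniform_limit ::
    "(real^'n::finite) set \<Rightarrow> (nat \<Rightarrow> real^'n \<Rightarrow> real) \<Rightarrow> (real^'n \<Rightarrow> real) \<Rightarrow> bool" where
  "locally_uniform_limit U f g \<longleftrightarrow>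
     (\<forall>K. compact K \<and> K \<subseteq> U \<longrightarrow> uniform_limit K f g sequentially)"

end

theory Submission
  imports Defs
begin

text \<open>
  A positive current has measure coefficients (a nonnegative functional on test functions is a Radon
  measure, by Riesz), so weak convergence of positive currents bounds their masses locally and
  \<open>u\<^sub>j S\<^sub>j \<rightarrow> u S\<close> weakly whenever \<open>S\<^sub>j \<rightarrow> S\<close> weakly and \<open>u\<^sub>j \<rightarrow> u\<close> locally uniformly. Applying the weakly
  continuous operator \<open>dd\<^sup>#\<close> preserves the convergence, and induction on the number of factors gives
  both claims as soon as every \<open>S \<and> dd\<^sup># v\<close> is again positive and closed.

  For the latter, \<open>v\<close> is approximated by smooth \<open>w\<close> with positive semidefinite Hessian. Since \<open>S\<close> is
  closed, integration by parts gives \<open>dd\<^sup>#(w S) = \<Sum> \<partial>\<^sub>i\<partial>\<^sub>jw dx\<^sub>i \<and> d\<xi>\<^sub>j \<and> S\<close>, and a smooth Cholesky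
  factorisation writes the (perturbed) Hessian as \<open>\<Sum>\<^sub>k c\<^sub>k\<^sub>i c\<^sub>k\<^sub>j\<close>, so that positivity of \<open>S\<close> applies
  to each \<open>k\<close> separately.
\<close>

section \<open>Smooth functions\<close>

text \<open>Two features of the definitions shape the proof. First, \<open>distr_mult\<close>
  multiplies by way of an arbitrarily chosen pair of measures representing a coefficient. Writing a
  coefficient as a difference R - Q of positive functionals shows that a pair exists, but the chosen
  pair may have much larger mass than R and Q; estimates are therefore made on test functions, where
  only R and Q enter, and reach the product by a limit. Second, measures are only locally finite on
  the open set and convex functions only continuous inside it, so mass is measured by the value of a
  positive functional on one smooth cutoff \<phi> equal to 1 near the supports involved; along a
  convergent sequence of functionals these values are automatically bounded.

  Positivity of a current only tests products of test functions. Two square roots are taken to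
  exploit it, and both are smooth only under strict positivity: (f + \<epsilon>)^(1/2) for a scalar
  function f, and the Cholesky factor of a matrix. Hence the perturbations by \<epsilon>, which are
  then sent to 0.\<close>

lemma partial_x_eq:
  assumes "(f has_derivative D) (at x)"
  shows "partial_x i f x = D (axis i 1)"
  using frechet_derivative_at[OF assms] by (simp add: partial_x_def)

text \<open>\<open>smooth\<close> quantifies over lists of directions. Recursion on the order
  instead lets closure under sums, products and substitutions be proved by induction with the
  function generalised, as differentiating replaces \<open>f\<close> by
  \<open>partial_x i f\<close>.\<close>

primrec smooth_upto :: "nat \<Rightarrow> (real^'n::finite \<Rightarrow> real) \<Rightarrow> bool" where
  "smooth_upto 0 f \<longleftrightarrow> f differentiable_on UNIV"
| "smooth_upto (Suc k) f \<longleftrightarrow> f differentiable_on UNIV \<and> (\<forall>i. smooth_upto k (partial_x i f))"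

lemma smooth_upto_differentiable: "smooth_upto k f \<Longrightarrow> f differentiable_on UNIV"
  by (cases k) auto

lemma smooth_upto_Suc_imp: "smooth_upto (Suc k) f \<Longrightarrow> smooth_upto k f"
  by (induction k arbitrary: f) (auto simp: smooth_upto_differentiable)

lemma smooth_upto_iff:
  "smooth_upto k f \<longleftrightarrow> (\<forall>is. length is \<le> k \<longrightarrow> fold partial_x is f differentiable_on UNIV)"
proof (induction k arbitrary: f)
  case (Suc k)
  have "(\<forall>is. length is \<le> Suc k \<longrightarrow> fold partial_x is f differentiable_on UNIV) \<longleftrightarrow>
     f differentiable_on UNIV \<and>
     (\<forall>i is. length is \<le> k \<longrightarrow> fold partial_x is (partial_x i f) differentiable_on UNIV)"
    (is "?L \<longleftrightarrow> ?R")
  proof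
    assume L: ?L
    have "fold partial_x is (partial_x i f) differentiable_on UNIV" if "length is \<le> k" for i "is"
      using L[rule_format, of "i # is"] that by simp
    with L[rule_format, of "[]"] show ?R by simp
  next
    assume R: ?R
    have "fold partial_x is f differentiable_on UNIV" if "length is \<le> Suc k" for "is"
      using R that by (cases "is") auto
    then show ?L by blast
  qed
  then show ?case using Suc by simp
qed simp

lemma smooth_iff: "smooth f \<longleftrightarrow> (\<forall>k. smooth_upto k f)"
  unfolding smooth_def smooth_upto_iff by blast

lemma smooth_partial: "smooth f \<Longrightarrow> smooth (partial_x i f)"
  unfolding smooth_iff by (metis smooth_upto.simps(2))

lemma smooth_differentiable: "smooth f \<Longrightarrow> f differentiable (at x)"
  unfolding smooth_iff using smooth_upto_differentiable[of 0 f]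
  by (auto simp: differentiable_on_def)

lemma smooth_has_derivative:
  assumes "smooth f"
  shows "(f has_derivative (\<lambda>h. \<Sum>i\<in>UNIV. h $ i * partial_x i f x)) (at x)"
proof -
  obtain D where D: "(f has_derivative D) (at x)"
    using smooth_differentiable[OF assms] differentiable_def by blast
  interpret linear D using D by (rule has_derivative_linear)
  have "D h = (\<Sum>i\<in>UNIV. h $ i * partial_x i f x)" for h
  proof -
    have "D h = D (\<Sum>i\<in>UNIV. (h $ i) *\<^sub>R axis i 1)"
      using basis_expansion[of h] by (simp add: scalar_mult_eq_scaleR)
    also have "\<dots> = (\<Sum>i\<in>UNIV. h $ i * D (axis i 1))"
      by (simp add: sum scale)
    finally show ?thesis using partial_x_eq[OF D] by simp
  qed
  then have "D = (\<lambda>h. \<Sum>i\<in>UNIV. h $ i * partial_x i f x)" by auto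
  with D show ?thesis by simp
qed

lemma smooth_continuous: "smooth f \<Longrightarrow> continuous_on S f"
  using smooth_differentiable
  by (metis continuous_at_imp_continuous_on differentiable_imp_continuous_within)

lemma smooth_measurable [measurable_dest]: "smooth f \<Longrightarrow> f \<in> borel_measurable borel"
  using smooth_continuous borel_measurable_continuous_onI by blast

lemma smooth_along_line:
  assumes "smooth f"
  shows "((\<lambda>t. f (x + t *\<^sub>R y)) has_real_derivative
    (\<Sum>i\<in>UNIV. y $ i * partial_x i f (x + t *\<^sub>R y))) (at t within S)"
proof -
  have "((\<lambda>t. f (x + t *\<^sub>R y)) has_derivative
     (\<lambda>h. \<Sum>i\<in>UNIV. (h *\<^sub>R y) $ i * partial_x i f (x + t *\<^sub>R y))) (at t within S)"
    by (rule has_derivative_compose[OF _ smooth_has_derivative[OF assms]])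
       (auto intro!: derivative_eq_intros)
  moreover have "(\<lambda>h. \<Sum>i\<in>UNIV. (h *\<^sub>R y) $ i * partial_x i f (x + t *\<^sub>R y)) =
     (*) (\<Sum>i\<in>UNIV. y $ i * partial_x i f (x + t *\<^sub>R y))"
    by (auto simp: sum_distrib_left sum_distrib_right mult_ac)
  ultimately show ?thesis by (simp add: has_field_derivative_def)
qed

lemma sum_axis: "(\<Sum>j\<in>UNIV. axis i 1 $ j * g j) = (g i :: real)"
  by (subst sum.remove[of _ i]) (auto simp: axis_def intro!: sum.neutral)

lemma smooth_along_axis:
  assumes "smooth f"
  shows "((\<lambda>t. f (x + t *\<^sub>R axis i 1)) has_real_derivative
    partial_x i f (x + t *\<^sub>R axis i 1)) (at t within S)"
proof -
  show ?thesis using smooth_along_line[OF assms, of x "axis i 1" t S] by (simp add: sum_axis)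
qed

lemma partial_x_const [simp]: "partial_x i (\<lambda>x. c) = (\<lambda>x. 0)"
  by (auto simp: partial_x_eq[OF has_derivative_const])

lemma smooth_upto_const: "smooth_upto k (\<lambda>x. c)"
  by (induction k arbitrary: c) auto

lemma smooth_const [simp, intro]: "smooth (\<lambda>x. c)"
  using smooth_upto_const smooth_iff by blast

lemma partial_x_add:
  assumes "f differentiable (at x)" "g differentiable (at x)"
  shows "partial_x i (\<lambda>x. f x + g x) x = partial_x i f x + partial_x i g x"
proof -
  obtain D E where D: "(f has_derivative D) (at x)" and E: "(g has_derivative E) (at x)"
    using assms unfolding differentiable_def by blast
  show ?thesis
    using partial_x_eq[OF has_derivative_add[OF D E]] partial_x_eq[OF D] partial_x_eq[OF E] by simp
qed

lemma partial_x_mult: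
  assumes "f differentiable (at x)" "g differentiable (at x)"
  shows "partial_x i (\<lambda>x. f x * g x) x = f x * partial_x i g x + partial_x i f x * g x"
proof -
  obtain D E where D: "(f has_derivative D) (at x)" and E: "(g has_derivative E) (at x)"
    using assms unfolding differentiable_def by blast
  show ?thesis
    using partial_x_eq[OF has_derivative_mult[OF D E]] partial_x_eq[OF D] partial_x_eq[OF E] by simp
qed

lemma smooth_upto_add:
  "smooth_upto k f \<Longrightarrow> smooth_upto k g \<Longrightarrow> smooth_upto k (\<lambda>x. f x + g x)"
proof (induction k arbitrary: f g)
  case (Suc k)
  have "partial_x i (\<lambda>x. f x + g x) = (\<lambda>x. partial_x i f x + partial_x i g x)" for i
    using Suc.prems by (auto intro!: ext partial_x_add simp: differentiable_on_def)
  with Suc show ?case by auto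
qed auto

lemma smooth_upto_mult:
  "smooth_upto k f \<Longrightarrow> smooth_upto k g \<Longrightarrow> smooth_upto k (\<lambda>x. f x * g x)"
proof (induction k arbitrary: f g)
  case (Suc k)
  have "partial_x i (\<lambda>x. f x * g x) = (\<lambda>x. f x * partial_x i g x + partial_x i f x * g x)" for i
    using Suc.prems by (auto intro!: ext partial_x_mult simp: differentiable_on_def)
  moreover have "smooth_upto k (\<lambda>x. f x * partial_x i g x + partial_x i f x * g x)" for i
    using Suc.prems Suc.prems[THEN smooth_upto_Suc_imp] by (intro smooth_upto_add Suc.IH) auto
  ultimately show ?case using Suc.prems by auto
qed auto

lemma smooth_add [intro]: "smooth f \<Longrightarrow> smooth g \<Longrightarrow> smooth (\<lambda>x. f x + g x)"
  by (auto simp: smooth_iff smooth_upto_add)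

lemma smooth_mult [intro]: "smooth f \<Longrightarrow> smooth g \<Longrightarrow> smooth (\<lambda>x. f x * g x)"
  by (auto simp: smooth_iff smooth_upto_mult)

lemma smooth_cmult [intro]: "smooth f \<Longrightarrow> smooth (\<lambda>x. c * f x)"
  by auto

lemma smooth_diff [intro]: "smooth f \<Longrightarrow> smooth g \<Longrightarrow> smooth (\<lambda>x. f x - g x)"
  using smooth_add[OF _ smooth_cmult[of g "-1"]] by simp

lemma smooth_sum: "(\<And>i. i \<in> I \<Longrightarrow> smooth (f i)) \<Longrightarrow> smooth (\<lambda>x. \<Sum>i\<in>I. f i x)"
  by (induction I rule: infinite_finite_induct) auto

lemma partial_x_add_smooth:
  "smooth f \<Longrightarrow> smooth g \<Longrightarrow> partial_x i (\<lambda>x. f x + g x) = (\<lambda>x. partial_x i f x + partial_x i g x)"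
  by (intro ext partial_x_add smooth_differentiable)

lemma partial_x_mult_smooth:
  "smooth f \<Longrightarrow> smooth g \<Longrightarrow>
    partial_x i (\<lambda>x. f x * g x) = (\<lambda>x. f x * partial_x i g x + partial_x i f x * g x)"
  by (intro ext partial_x_mult smooth_differentiable)

lemma partial_x_cmult_smooth:
  "smooth f \<Longrightarrow> partial_x i (\<lambda>x. c * f x) = (\<lambda>x. c * partial_x i f x)"
  by (simp add: partial_x_mult_smooth)

lemma has_derivative_affine:
  assumes "smooth f"
  shows "((\<lambda>x. f (a + c *\<^sub>R x)) has_derivative
     (\<lambda>h. \<Sum>i\<in>UNIV. (c *\<^sub>R h) $ i * partial_x i f (a + c *\<^sub>R x))) (at x)"
  by (rule has_derivative_compose[OF _ smooth_has_derivative[OF assms]])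
     (auto intro!: derivative_eq_intros)

lemma partial_x_affine:
  assumes "smooth f"
  shows "partial_x i (\<lambda>x. f (a + c *\<^sub>R x)) = (\<lambda>x. c * partial_x i f (a + c *\<^sub>R x))"
proof
  fix x
  have "partial_x i (\<lambda>x. f (a + c *\<^sub>R x)) x =
     (\<Sum>j\<in>UNIV. axis i 1 $ j * (c * partial_x j f (a + c *\<^sub>R x)))"
    unfolding partial_x_eq[OF has_derivative_affine[OF assms]]
    by (intro sum.cong) auto
  then show "partial_x i (\<lambda>x. f (a + c *\<^sub>R x)) x = c * partial_x i f (a + c *\<^sub>R x)"
    by (simp only: sum_axis)
qed

lemma smooth_affine:
  assumes "smooth f"
  shows "smooth (\<lambda>x. f (a + c *\<^sub>R x))"
proof -
  have diff: "(\<lambda>x. f (a + c *\<^sub>R x)) differentiable_on UNIV" if "smooth f" for f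
    using has_derivative_affine[OF that] unfolding differentiable_on_def differentiable_def by blast
  have "smooth_upto k (\<lambda>x. f (a + c *\<^sub>R x))" if "smooth f" for k f
    using that
  proof (induction k arbitrary: f)
    case 0
    then show ?case using diff by simp
  next
    case (Suc k)
    have "smooth_upto k (\<lambda>x. c * partial_x i f (a + c *\<^sub>R x))" for i
      by (intro smooth_upto_mult smooth_upto_const Suc.IH smooth_partial Suc.prems)
    then show ?case
      using diff[OF Suc.prems] by (simp add: partial_x_affine[OF Suc.prems])
  qed
  then show ?thesis using assms smooth_iff by blast
qed

lemma smooth_translate: "smooth f \<Longrightarrow> smooth (\<lambda>x. f (x + a))"
  using smooth_affine[of f a 1] by (simp add: add.commute)

lemma partial_x_translate:
  "smooth f \<Longrightarrow> partial_x i (\<lambda>x. f (x + a)) = (\<lambda>x. partial_x i f (x + a))"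
  using partial_x_affine[of f i a 1] by (simp add: add.commute)

lemma smooth_reflect: "smooth f \<Longrightarrow> smooth (\<lambda>x. f (a - x))"
  using smooth_affine[of f a "-1"] by simp

text \<open>Differentiating lowers the exponent and produces factors in front, so the induction runs
  over all functions \<open>h x * g x powr a\<close> with \<open>h\<close> smooth and
  \<open>a\<close> arbitrary; the claim is the case \<open>h = 1\<close>. It is needed for square
  roots and inverse square roots.\<close>

lemma smooth_powr:
  assumes "smooth g" "\<And>x. g x > 0"
  shows "smooth (\<lambda>x. g x powr a)"
proof -
  have der: "((\<lambda>x. h x * g x powr a) has_derivative
     (\<lambda>y. h x * (g x powr (a - 1) * a * (\<Sum>i\<in>UNIV. y $ i * partial_x i g x)) +
        (\<Sum>i\<in>UNIV. y $ i * partial_x i h x) * g x powr a)) (at x)" if "smooth h" for h a x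
  proof -
    have "((\<lambda>x. g x powr a) has_derivative
       (\<lambda>y. g x powr a * (0 * ln (g x) + (\<Sum>i\<in>UNIV. y $ i * partial_x i g x) * a / g x))) (at x)"
      by (rule has_derivative_powr[OF smooth_has_derivative[OF assms(1)] has_derivative_const])
         (use assms(2) in auto)
    moreover have "g x powr a * (0 * ln (g x) + s * a / g x) = g x powr (a - 1) * a * s" for s
      using assms(2)[of x] by (simp add: powr_diff)
    ultimately show ?thesis
      using has_derivative_mult[OF smooth_has_derivative[OF that]] by (simp only:)
  qed
  have diff: "(\<lambda>x. h x * g x powr a) differentiable_on UNIV" if "smooth h" for h a
    unfolding differentiable_on_def differentiable_def using der[OF that] by auto
  have "smooth_upto k (\<lambda>x. h x * g x powr a)" if "smooth h" for k h a
    using that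
  proof (induction k arbitrary: h a)
    case 0
    then show ?case using der diff by simp
  next
    case (Suc k)
    have "partial_x i (\<lambda>x. h x * g x powr a) =
      (\<lambda>x. (a * h x * partial_x i g x + partial_x i h x * g x) * g x powr (a - 1))" for i
    proof
      fix x
      show "partial_x i (\<lambda>x. h x * g x powr a) x =
         (a * h x * partial_x i g x + partial_x i h x * g x) * g x powr (a - 1)"
        unfolding partial_x_eq[OF der[OF Suc.prems]] sum_axis
        using assms(2)[of x] by (simp add: powr_diff field_simps)
    qed
    moreover have "smooth_upto k (\<lambda>x. (a * h x * partial_x i g x + partial_x i h x * g x) * g x powr (a - 1))" for i
      using Suc.prems assms(1) by (intro Suc.IH) (auto intro!: smooth_add smooth_mult smooth_partial)
    ultimately show ?case using diff[OF Suc.prems] by simp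
  qed
  from this[OF smooth_const[of 1]] show ?thesis by (simp add: smooth_iff)
qed

section \<open>Symmetry of second derivatives\<close>

lemma second_difference_partial:
  assumes "smooth f" "h > 0"
  shows "\<exists>z. dist z x \<le> 2 * h \<and>
    f (x + h *\<^sub>R axis i 1 + h *\<^sub>R axis j 1) - f (x + h *\<^sub>R axis i 1)
      - f (x + h *\<^sub>R axis j 1) + f x
    = h\<^sup>2 * partial_x j (partial_x i f) z"
proof -
  \<comment> \<open>The mean value theorem is used in direction i on the increment in direction j,
    and then in direction j on the result.\<close>
  let ?g = "\<lambda>s. f ((x + h *\<^sub>R axis j 1) + s *\<^sub>R axis i 1) - f (x + s *\<^sub>R axis i 1)"
  have "\<exists>s>0. s < h \<and> ?g h - ?g 0 = (h - 0) *
     (partial_x i f ((x + h *\<^sub>R axis j 1) + s *\<^sub>R axis i 1) - partial_x i f (x + s *\<^sub>R axis i 1))"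
    by (rule MVT2) (use assms in \<open>auto intro!: DERIV_diff smooth_along_axis\<close>)
  then obtain s where s: "0 < s" "s < h" and eq1: "?g h - ?g 0 = h *
     (partial_x i f ((x + h *\<^sub>R axis j 1) + s *\<^sub>R axis i 1) - partial_x i f (x + s *\<^sub>R axis i 1))"
    by auto
  let ?k = "\<lambda>t. partial_x i f ((x + s *\<^sub>R axis i 1) + t *\<^sub>R axis j 1)"
  have "\<exists>t>0. t < h \<and> ?k h - ?k 0 = (h - 0) *
     partial_x j (partial_x i f) ((x + s *\<^sub>R axis i 1) + t *\<^sub>R axis j 1)"
    by (rule MVT2) (use assms in \<open>auto intro!: smooth_along_axis smooth_partial\<close>)
  then obtain t where t: "0 < t" "t < h" and eq2: "?k h - ?k 0 = h *
     partial_x j (partial_x i f) (x + s *\<^sub>R axis i 1 + t *\<^sub>R axis j 1)" by auto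
  let ?z = "x + s *\<^sub>R axis i 1 + t *\<^sub>R axis j 1"
  have "?g h - ?g 0 = h * (?k h - ?k 0)" using eq1 by (simp add: algebra_simps)
  also have "\<dots> = h\<^sup>2 * partial_x j (partial_x i f) ?z"
    using eq2 by (simp add: power2_eq_square)
  finally have "?g h - ?g 0 = h\<^sup>2 * partial_x j (partial_x i f) ?z" .
  moreover have "dist ?z x \<le> 2 * h"
    using norm_triangle_ineq[of "s *\<^sub>R (axis i 1 :: real^'a)" "t *\<^sub>R axis j 1"] s t
    by (simp add: dist_norm norm_axis_1)
  ultimately show ?thesis by (intro exI[of _ ?z]) (simp add: algebra_simps)
qed

text \<open>The second difference quotient \<Delta> is symmetric in i and j, and it equals a value
  of either mixed derivative at distance at most 2 h from x; by continuity it converges to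
  both.\<close>

lemma partial_x_commute:
  assumes "smooth f"
  shows "partial_x i (partial_x j f) = partial_x j (partial_x i f)"
proof
  fix x
  define h where "h = (\<lambda>n::nat. inverse (real (Suc n)))"
  have h0: "h n > 0" for n by (simp add: h_def)
  have h_lim: "(\<lambda>n. 2 * h n) \<longlonglongrightarrow> 0"
    unfolding h_def using tendsto_mult_right[OF LIMSEQ_inverse_real_of_nat, of 2] by simp
  define \<Delta> where "\<Delta> = (\<lambda>n. (f (x + h n *\<^sub>R axis i 1 + h n *\<^sub>R axis j 1) - f (x + h n *\<^sub>R axis i 1)
      - f (x + h n *\<^sub>R axis j 1) + f x) / (h n)\<^sup>2)"
  have lim: "\<Delta> \<longlonglongrightarrow> F x"
    if F: "smooth F" and z: "\<And>n. \<exists>z. dist z x \<le> 2 * h n \<and> \<Delta> n = F z" for F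
  proof -
    obtain z where z: "\<And>n. dist (z n) x \<le> 2 * h n" "\<And>n. \<Delta> n = F (z n)"
      using z by metis
    have "z \<longlonglongrightarrow> x"
      using z(1) by (intro metric_tendsto_imp_tendsto[OF h_lim] always_eventually)
        (simp add: h0 less_imp_le)
    moreover have "isCont F x"
      using smooth_continuous[OF F, of UNIV] by (simp add: continuous_on_eq_continuous_at)
    ultimately show ?thesis using isCont_tendsto_compose z(2) by (metis (no_types, lifting) ext)
  qed
  have 1: "\<exists>z. dist z x \<le> 2 * h n \<and> \<Delta> n = partial_x j (partial_x i f) z" for n
    using second_difference_partial[OF assms h0, of x n i j] h0[of n] unfolding \<Delta>_def by auto
  have 2: "\<exists>z. dist z x \<le> 2 * h n \<and> \<Delta> n = partial_x i (partial_x j f) z" for n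
  proof -
    have "\<Delta> n = (f (x + h n *\<^sub>R axis j 1 + h n *\<^sub>R axis i 1) - f (x + h n *\<^sub>R axis j 1)
      - f (x + h n *\<^sub>R axis i 1) + f x) / (h n)\<^sup>2"
      by (simp add: \<Delta>_def algebra_simps)
    then show ?thesis
      using second_difference_partial[OF assms h0, of x n j i] h0[of n] by auto
  qed
  show "partial_x i (partial_x j f) x = partial_x j (partial_x i f) x"
    by (intro LIMSEQ_unique[OF lim[OF _ 2] lim[OF _ 1]] smooth_partial assms)
qed

section \<open>Ingredients of smooth bump functions\<close>

lemma smooth_coordinate:
  fixes i :: "'n::finite"
  shows "smooth (\<lambda>x. x $ i)"
proof -
  have der: "((\<lambda>x. x $ i) has_derivative (\<lambda>h. h $ i)) (at x)" for x :: "real^'n"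
    by (rule bounded_linear_imp_has_derivative) (rule bounded_linear_vec_nth)
  have part: "partial_x j (\<lambda>x::real^'n. x $ i) = (\<lambda>x. axis j 1 $ i)" for j
    by (auto simp: partial_x_eq[OF der])
  have "(\<lambda>x::real^'n. x $ i) differentiable_on UNIV"
    using der by (auto simp: differentiable_on_def differentiable_def)
  then have "smooth_upto k (\<lambda>x::real^'n. x $ i)" for k
    by (cases k) (simp_all add: part smooth_upto_const)
  then show ?thesis by (simp add: smooth_iff)
qed

text \<open>The function exp (-1/t), extended by 0, divided by powers of t. The powers are included
  because differentiation stays within linear combinations of this family, which turns smoothness
  into an induction.\<close>

definition flat :: "nat \<Rightarrow> real \<Rightarrow> real" where
  "flat k t = (if t > 0 then exp (- inverse t) / t ^ k else 0)"

lemma flat_nonneg: "flat k t \<ge> 0"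
  by (simp add: flat_def)

lemma flat_tendsto_0: "(flat k \<longlongrightarrow> 0) (at 0)"
proof -
  have "((\<lambda>s. s ^ k / exp s) \<longlongrightarrow> (0::real)) at_top"
    by (rule tendsto_power_div_exp_0)
  then have "((\<lambda>t. inverse t ^ k / exp (inverse t)) \<longlongrightarrow> (0::real)) (at_right 0)"
    by (rule filterlim_compose) (rule filterlim_inverse_at_top_right)
  moreover have "\<forall>\<^sub>F t in at_right 0. inverse t ^ k / exp (inverse t) = flat k t"
    unfolding eventually_at_right_field
    by (auto simp: flat_def exp_minus field_simps intro!: exI[of _ 1])
  ultimately have "(flat k \<longlongrightarrow> 0) (at_right 0)"
    using tendsto_cong by fast
  moreover have "(flat k \<longlongrightarrow> 0) (at_left 0)"
  proof (rule tendsto_eventually)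
    show "\<forall>\<^sub>F x in at_left 0. flat k x = 0"
      unfolding eventually_at_left_field by (auto simp: flat_def intro!: exI[of _ "-1"])
  qed
  ultimately show ?thesis using filterlim_split_at by blast
qed

lemma flat_deriv: "(flat k has_real_derivative flat (k + 2) t - k * flat (k + 1) t) (at t)"
proof (cases t "0::real" rule: linorder_cases)
  case less
  have "(flat k has_real_derivative 0) (at t)"
    by (rule has_field_derivative_transform_within_open[of "\<lambda>_. 0" 0 t "{..<0}"])
       (use less in \<open>auto simp: flat_def\<close>)
  then show ?thesis using less by (simp add: flat_def)
next
  case equal
  \<comment> \<open>Dividing by h raises the index by one, so the difference quotient at 0 is
    \<open>flat (Suc k)\<close> itself, which tends to 0.\<close>
  have "((\<lambda>h. (flat k (0 + h) - flat k 0) / h) \<longlongrightarrow> 0) (at 0)"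
  proof (rule Lim_transform_eventually[OF flat_tendsto_0[of "Suc k"]])
    show "\<forall>\<^sub>F h in at 0. flat (Suc k) h = (flat k (0 + h) - flat k 0) / h"
      by (rule always_eventually) (auto simp: flat_def)
  qed
  then show ?thesis using equal by (simp add: DERIV_def flat_def)
next
  case greater
  have "((\<lambda>t. exp (- inverse t) / t ^ k) has_real_derivative flat (k + 2) t - k * flat (k + 1) t) (at t)"
  proof -
    have "((\<lambda>t. exp (- inverse t) / t ^ k) has_real_derivative
       (exp (- inverse t) * (inverse t * inverse t) * t ^ k - exp (- inverse t) * (k * t ^ (k - 1))) / (t ^ k * t ^ k)) (at t)"
      using greater by (auto intro!: derivative_eq_intros)
    moreover have "t ^ k = t * t ^ (k - 1)" if "k > 0"
      using that by (simp add: power_eq_if)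
    then have "(exp (- inverse t) * (inverse t * inverse t) * t ^ k - exp (- inverse t) * (k * t ^ (k - 1))) / (t ^ k * t ^ k)
       = flat (k + 2) t - k * flat (k + 1) t"
      using greater by (cases "k = 0") (simp_all add: flat_def field_simps power2_eq_square)
    ultimately show ?thesis by simp
  qed
  then show ?thesis
    by (rule has_field_derivative_transform_within_open[of _ _ t "{0<..}"])
       (use greater in \<open>auto simp: flat_def\<close>)
qed

text \<open>As for \<open>smooth_powr\<close>, the induction runs over
  \<open>h x * flat k (g x)\<close> with arbitrary smooth \<open>h\<close> and arbitrary
  \<open>k\<close>; a partial derivative is a sum of three such functions.\<close>

lemma smooth_flat:
  assumes "smooth g"
  shows "smooth (\<lambda>x. flat k (g x))"
proof -
  have der: "((\<lambda>x. h x * flat k (g x)) has_derivative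
     (\<lambda>y. h x * ((\<Sum>i\<in>UNIV. y $ i * partial_x i g x) * (flat (k + 2) (g x) - k * flat (k + 1) (g x))) +
        (\<Sum>i\<in>UNIV. y $ i * partial_x i h x) * flat k (g x))) (at x)" if "smooth h" for h k x
    by (intro has_derivative_mult smooth_has_derivative that assms
         DERIV_compose_FDERIV[OF flat_deriv])
  have part: "partial_x i (\<lambda>x. h x * flat k (g x)) =
     (\<lambda>x. (h x * partial_x i g x) * flat (k + 2) (g x) +
       (((- real k) * h x * partial_x i g x) * flat (k + 1) (g x) + partial_x i h x * flat k (g x)))"
    if "smooth h" for h k i
    unfolding fun_eq_iff partial_x_eq[OF der[OF that]] sum_axis by (simp add: algebra_simps)
  have diff: "(\<lambda>x. h x * flat k (g x)) differentiable_on UNIV" if "smooth h" for h k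
    unfolding differentiable_on_def differentiable_def using der[OF that] by auto
  have "smooth_upto m (\<lambda>x. h x * flat k (g x))" if "smooth h" for m h k
    using that
  proof (induction m arbitrary: h k)
    case 0
    then show ?case using diff by simp
  next
    case (Suc m)
    have "smooth_upto m (partial_x i (\<lambda>x. h x * flat k (g x)))" for i
      unfolding part[OF Suc.prems]
      by (intro smooth_upto_add Suc.IH smooth_mult smooth_const smooth_partial assms Suc.prems)
    then show ?case using diff[OF Suc.prems] by simp
  qed
  from this[OF smooth_const[of 1]] show ?thesis by (simp add: smooth_iff)
qed


section \<open>Continuous functions with compact support\<close>

text \<open>Naming a compact set off which the function vanishes, instead of the closure of its
  support, lets sums and limits be handled by enlarging that set.\<close>

definition compactly_supported :: "(real^'n::finite) set \<Rightarrow> (real^'n \<Rightarrow> real) set" where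
  "compactly_supported U =
     {f. continuous_on UNIV f \<and> (\<exists>K. compact K \<and> K \<subseteq> U \<and> (\<forall>x. x \<notin> K \<longrightarrow> f x = 0))}"

lemma compactly_supportedI:
  "continuous_on UNIV f \<Longrightarrow> compact K \<Longrightarrow> K \<subseteq> U \<Longrightarrow> (\<And>x. x \<notin> K \<Longrightarrow> f x = 0) \<Longrightarrow>
    f \<in> compactly_supported U"
  by (auto simp: compactly_supported_def)

lemma compactly_supportedE:
  assumes "f \<in> compactly_supported U"
  obtains K where "compact K" "K \<subseteq> U" "\<And>x. x \<notin> K \<Longrightarrow> f x = 0"
  using assms by (auto simp: compactly_supported_def)

lemma compactly_supported_continuous:
  "f \<in> compactly_supported U \<Longrightarrow> continuous_on S f"
  by (auto simp: compactly_supported_def intro: continuous_on_subset)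

lemma compactly_supported_measurable [measurable_dest]:
  "f \<in> compactly_supported U \<Longrightarrow> f \<in> borel_measurable borel"
  by (intro borel_measurable_continuous_onI compactly_supported_continuous)

lemma test_functions_iff: "f \<in> test_functions U \<longleftrightarrow> smooth f \<and> f \<in> compactly_supported U"
proof (intro iffI conjI; (elim conjE)?)
  assume "f \<in> test_functions U"
  then show "smooth f" "f \<in> compactly_supported U"
    using closure_subset[of "{x. f x \<noteq> 0}"]
    by (auto simp: test_functions_def intro!: compactly_supportedI[of _ "closure {x. f x \<noteq> 0}"] smooth_continuous)
next
  assume f: "smooth f" "f \<in> compactly_supported U"
  from f(2) obtain K where K: "compact K" "K \<subseteq> U" "\<And>x. x \<notin> K \<Longrightarrow> f x = 0"
    by (rule compactly_supportedE) blast
  have "closure {x. f x \<noteq> 0} \<subseteq> K"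
    using K by (intro closure_minimal compact_imp_closed) auto
  moreover from this have "compact (closure {x. f x \<noteq> 0})"
    using K(1) by (metis closed_closure compact_Int_closed inf.absorb2)
  ultimately show "f \<in> test_functions U"
    using f K(2) by (auto simp: test_functions_def)
qed

lemma test_functions_smooth: "f \<in> test_functions U \<Longrightarrow> smooth f"
  and test_functions_compactly_supported: "f \<in> test_functions U \<Longrightarrow> f \<in> compactly_supported U"
  by (simp_all add: test_functions_iff)

lemma test_functionsI:
  "smooth f \<Longrightarrow> compact K \<Longrightarrow> K \<subseteq> U \<Longrightarrow> (\<And>x. x \<notin> K \<Longrightarrow> f x = 0) \<Longrightarrow> f \<in> test_functions U"
  by (auto simp: test_functions_iff smooth_continuous intro: compactly_supportedI)

lemma compactly_supported_mono: "U \<subseteq> V \<Longrightarrow> compactly_supported U \<subseteq> compactly_supported V"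
  by (auto simp: compactly_supported_def)

lemma test_functions_mono: "U \<subseteq> V \<Longrightarrow> test_functions U \<subseteq> test_functions V"
  by (auto simp: test_functions_iff dest: subsetD[OF compactly_supported_mono])

lemma compactly_supported_add:
  assumes "f \<in> compactly_supported U" "g \<in> compactly_supported U"
  shows "(\<lambda>x. f x + g x) \<in> compactly_supported U"
proof -
  obtain K where K: "compact K" "K \<subseteq> U" "\<And>x. x \<notin> K \<Longrightarrow> f x = 0"
    using assms(1) by (rule compactly_supportedE) blast
  obtain L where L: "compact L" "L \<subseteq> U" "\<And>x. x \<notin> L \<Longrightarrow> g x = 0"
    using assms(2) by (rule compactly_supportedE) blast
  show ?thesis
    by (rule compactly_supportedI[of _ "K \<union> L"])
       (use K L assms[THEN compactly_supported_continuous, of UNIV] in \<open>auto intro!: continuous_intros\<close>)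
qed

lemma compactly_supported_mult:
  assumes "f \<in> compactly_supported U" "continuous_on UNIV g"
  shows "(\<lambda>x. g x * f x) \<in> compactly_supported U"
proof -
  obtain K where K: "compact K" "K \<subseteq> U" "\<And>x. x \<notin> K \<Longrightarrow> f x = 0"
    using assms(1) by (rule compactly_supportedE) blast
  show ?thesis
    by (rule compactly_supportedI[of _ K])
       (use K assms(1)[THEN compactly_supported_continuous, of UNIV] assms(2) in \<open>auto intro!: continuous_intros\<close>)
qed

lemma compactly_supported_cmult:
  "f \<in> compactly_supported U \<Longrightarrow> (\<lambda>x. c * f x) \<in> compactly_supported U"
  by (rule compactly_supported_mult) auto

lemma compactly_supported_diff:
  assumes "f \<in> compactly_supported U" "g \<in> compactly_supported U"
  shows "(\<lambda>x. f x - g x) \<in> compactly_supported U"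
  using compactly_supported_add[OF assms(1) compactly_supported_cmult[OF assms(2), of "-1"]] by simp

lemma compactly_supported_0 [simp]: "(\<lambda>x. 0) \<in> compactly_supported U"
  by (rule compactly_supportedI[of _ "{}"]) auto

lemma test_functions_0 [simp]: "(\<lambda>x. 0) \<in> test_functions U"
  by (simp add: test_functions_iff)

lemma test_functions_add:
  "f \<in> test_functions U \<Longrightarrow> g \<in> test_functions U \<Longrightarrow> (\<lambda>x. f x + g x) \<in> test_functions U"
  by (auto simp: test_functions_iff compactly_supported_add)

lemma test_functions_diff:
  "f \<in> test_functions U \<Longrightarrow> g \<in> test_functions U \<Longrightarrow> (\<lambda>x. f x - g x) \<in> test_functions U"
  by (auto simp: test_functions_iff compactly_supported_diff)

lemma test_functions_mult:
  "f \<in> test_functions U \<Longrightarrow> smooth g \<Longrightarrow> (\<lambda>x. g x * f x) \<in> test_functions U"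
  by (auto simp: test_functions_iff compactly_supported_mult smooth_continuous)

lemma test_functions_cmult:
  "f \<in> test_functions U \<Longrightarrow> (\<lambda>x. c * f x) \<in> test_functions U"
  by (rule test_functions_mult) auto

lemma test_functions_sum:
  "(\<And>i. i \<in> I \<Longrightarrow> f i \<in> test_functions U) \<Longrightarrow> (\<lambda>x. \<Sum>i\<in>I. f i x) \<in> test_functions U"
  by (induction I rule: infinite_finite_induct) (auto intro: test_functions_add)

lemma partial_x_zero_outside:
  assumes "closed K" "\<And>x. x \<notin> K \<Longrightarrow> f x = 0" "x \<notin> K"
  shows "partial_x i f x = 0"
proof -
  have "(f has_derivative (\<lambda>h. 0)) (at x)"
    by (rule has_derivative_transform_within_open[of "\<lambda>_. 0" _ _ _ "- K"])
       (use assms in \<open>auto simp: open_Compl\<close>)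
  then show ?thesis by (rule partial_x_eq)
qed

lemma test_functions_partial:
  assumes "f \<in> test_functions U"
  shows "partial_x i f \<in> test_functions U"
proof -
  from test_functions_compactly_supported[OF assms]
  obtain K where K: "compact K" "K \<subseteq> U" "\<And>x. x \<notin> K \<Longrightarrow> f x = 0"
    by (rule compactly_supportedE) blast
  show ?thesis
    by (rule test_functionsI[of _ K])
       (use K partial_x_zero_outside[OF compact_imp_closed, of K f] assms in
         \<open>auto intro: smooth_partial test_functions_smooth\<close>)
qed

lemma compactly_supported_bounded:
  assumes "f \<in> compactly_supported U"
  obtains B where "B > 0" "\<And>x. \<bar>f x\<bar> \<le> B"
proof -
  obtain K where K: "compact K" "K \<subseteq> U" "\<And>x. x \<notin> K \<Longrightarrow> f x = 0"
    using assms by (rule compactly_supportedE) blast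
  have "bounded (f ` K)"
    using K(1) assms by (intro compact_imp_bounded compact_continuous_image compactly_supported_continuous)
  then obtain B where "B > 0" "\<forall>x\<in>K. norm (f x) \<le> B" unfolding bounded_pos by auto
  then have "\<bar>f x\<bar> \<le> B" for x using K(3)[of x] by (cases "x \<in> K") auto
  with \<open>B > 0\<close> that show ?thesis by blast
qed

section \<open>Locally finite measures and uniform limits of integrals\<close>

definition locally_finite_measure :: "(real^'n::finite) set \<Rightarrow> (real^'n) measure \<Rightarrow> bool" where
  "locally_finite_measure U \<mu> \<longleftrightarrow> sets \<mu> = sets borel \<and>
     (\<forall>K. compact K \<and> K \<subseteq> U \<longrightarrow> emeasure \<mu> K < \<infinity>)"

lemma represents_measure_iff:
  "represents_measure U D (\<mu>, \<nu>) \<longleftrightarrow> locally_finite_measure U \<mu> \<and> locally_finite_measure U \<nu> \<and>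
     (\<forall>f\<in>test_functions U. D f = (\<integral>x. f x \<partial>\<mu>) - (\<integral>x. f x \<partial>\<nu>))"
  by (auto simp: represents_measure_def locally_finite_measure_def)

lemma locally_finite_lborel: "locally_finite_measure U lborel"
  using emeasure_bounded_finite[OF compact_imp_bounded] by (auto simp: locally_finite_measure_def)

lemma integrable_locally_finite:
  assumes "locally_finite_measure U \<mu>" "compact K" "K \<subseteq> U" "f \<in> borel_measurable borel"
    and "\<And>x. x \<notin> K \<Longrightarrow> f x = 0" "\<And>x. \<bar>f x\<bar> \<le> (B::real)"
  shows "integrable \<mu> f"
proof (rule integrableI_bounded_set[of K])
  have s: "sets \<mu> = sets borel" using assms(1) by (simp add: locally_finite_measure_def)
  show "K \<in> sets \<mu>" using s assms(2) by (simp add: borel_compact)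
  show "f \<in> borel_measurable \<mu>" using assms(4) measurable_cong_sets[OF s refl] by blast
  show "emeasure \<mu> K < \<infinity>" using assms by (auto simp: locally_finite_measure_def)
qed (use assms in auto)

lemma integrable_compactly_supported:
  assumes "locally_finite_measure U \<mu>" "f \<in> compactly_supported U"
  shows "integrable \<mu> f"
proof -
  obtain K where K: "compact K" "K \<subseteq> U" "\<And>x. x \<notin> K \<Longrightarrow> f x = 0"
    using assms(2) by (rule compactly_supportedE) blast
  obtain B where "\<And>x. \<bar>f x\<bar> \<le> B" using assms(2) by (rule compactly_supported_bounded) blast
  with K assms show ?thesis
    by (intro integrable_locally_finite[of U \<mu> K f B] compactly_supported_measurable)
qed

text \<open>The total mass of \<mu> may be infinite, but one compact set K carries all
  \<open>f n\<close>, so the integrals differ by at most the uniform distance times the mass of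
  K.\<close>

lemma uniform_limit_integral:
  assumes \<mu>: "locally_finite_measure U \<mu>" and K: "compact K" "K \<subseteq> U"
    and f: "\<And>n. f n \<in> compactly_supported U" "\<And>n x. x \<notin> K \<Longrightarrow> f n x = 0"
    and lim: "uniform_limit UNIV f g sequentially"
  shows "(\<lambda>n. \<integral>x. f n x \<partial>\<mu>) \<longlonglongrightarrow> (\<integral>x. g x \<partial>\<mu>)"
proof -
  have cg: "continuous_on UNIV g"
    using compactly_supported_continuous[OF f(1)] by (intro uniform_limit_theorem[OF _ lim]) auto
  have g0: "g x = 0" if "x \<notin> K" for x
    using tendsto_uniform_limitI[OF lim UNIV_I, of x] f(2)[OF that] by (simp add: LIMSEQ_const_iff)
  have gs: "g \<in> compactly_supported U" using cg K g0 by (rule compactly_supportedI)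
  have Ks: "K \<in> sets \<mu>" "emeasure \<mu> K < \<infinity>"
    using \<mu> K by (auto simp: locally_finite_measure_def borel_compact)
  show ?thesis
  proof (rule LIMSEQ_I)
    fix e :: real assume "e > 0"
    define d where "d = e / (measure \<mu> K + 1)"
    have "d > 0" using \<open>e > 0\<close> by (simp add: d_def add_nonneg_pos)
    then obtain N where N: "\<And>n x. n \<ge> N \<Longrightarrow> dist (f n x) (g x) < d"
      using uniform_limitD[OF lim] unfolding eventually_sequentially by (metis UNIV_I)
    have "norm ((\<integral>x. f n x \<partial>\<mu>) - (\<integral>x. g x \<partial>\<mu>)) < e" if "n \<ge> N" for n
    proof -
      have "\<bar>\<integral>x. f n x - g x \<partial>\<mu>\<bar> \<le> (\<integral>x. d * indicator K x \<partial>\<mu>)"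
      proof (rule integral_abs_bound_integral)
        show "integrable \<mu> (\<lambda>x. f n x - g x)"
          by (intro Bochner_Integration.integrable_diff integrable_compactly_supported[OF \<mu>] f gs)
        show "integrable \<mu> (\<lambda>x. d * indicator K x)" using Ks by simp
        show "\<bar>f n x - g x\<bar> \<le> d * indicator K x" for x
          using N[OF that, of x] f(2)[of x n] g0[of x] by (cases "x \<in> K") (auto simp: dist_real_def)
      qed
      also have "\<dots> = d * measure \<mu> K" using Ks by simp
      also have "\<dots> < e"
      proof -
        have "measure \<mu> K + 1 > 0" by (simp add: add_nonneg_pos)
        then show ?thesis using \<open>e > 0\<close> by (simp add: d_def pos_divide_less_eq algebra_simps)
      qed
      finally show ?thesis
        using integrable_compactly_supported[OF \<mu> f(1)] integrable_compactly_supported[OF \<mu> gs]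
        by simp
    qed
    then show "\<exists>N. \<forall>n\<ge>N. norm ((\<integral>x. f n x \<partial>\<mu>) - (\<integral>x. g x \<partial>\<mu>)) < e" by blast
  qed
qed

section \<open>Mollification\<close>

text \<open>The constant does not depend on x, so the estimate can be integrated in order to
  differentiate a convolution. It is the sum of bounds for the second derivatives and comes from two
  uses of the mean value theorem.\<close>

lemma smooth_taylor_bound:
  fixes \<psi> :: "real^'n::finite \<Rightarrow> real"
  assumes "\<psi> \<in> test_functions UNIV"
  obtains C where "C \<ge> 0"
    "\<And>x k. \<bar>\<psi> (x + k) - \<psi> x - (\<Sum>i\<in>UNIV. k $ i * partial_x i \<psi> x)\<bar> \<le> C * (norm k)\<^sup>2"
proof -
  have tf2: "partial_x j (partial_x i \<psi>) \<in> test_functions UNIV" for i j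
    by (intro test_functions_partial assms)
  have sm: "smooth \<psi>" "smooth (partial_x i \<psi>)" for i
    using assms test_functions_smooth smooth_partial by blast+
  have "\<forall>i j. \<exists>B>0. \<forall>x. \<bar>partial_x j (partial_x i \<psi>) x\<bar> \<le> B"
    using compactly_supported_bounded[OF test_functions_compactly_supported[OF tf2]] by metis
  then obtain B where "\<forall>i j. B i j > 0 \<and> (\<forall>x. \<bar>partial_x j (partial_x i \<psi>) x\<bar> \<le> B i j)"
    unfolding choice_iff by blast
  then have B: "\<And>i j. B i j > 0" "\<And>i j x. \<bar>partial_x j (partial_x i \<psi>) x\<bar> \<le> B i j"
    by auto
  define C where "C = (\<Sum>i\<in>UNIV. \<Sum>j\<in>UNIV. B i j)"
  have "C \<ge> 0" unfolding C_def using B(1) by (intro sum_nonneg) (auto simp: less_imp_le)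
  moreover have "\<bar>\<psi> (x + k) - \<psi> x - (\<Sum>i\<in>UNIV. k $ i * partial_x i \<psi> x)\<bar> \<le> C * (norm k)\<^sup>2" for x k
  proof -
    have "\<exists>t>0. t < 1 \<and> \<psi> (x + 1 *\<^sub>R k) - \<psi> (x + 0 *\<^sub>R k) =
       (1 - 0) * (\<Sum>i\<in>UNIV. k $ i * partial_x i \<psi> (x + t *\<^sub>R k))"
      by (rule MVT2) (auto intro!: smooth_along_line sm)
    then obtain t where t: "0 < t" "t < 1"
      "\<psi> (x + k) - \<psi> x = (\<Sum>i\<in>UNIV. k $ i * partial_x i \<psi> (x + t *\<^sub>R k))" by auto
    have *: "\<bar>partial_x i \<psi> (x + t *\<^sub>R k) - partial_x i \<psi> x\<bar> \<le> norm k * (\<Sum>j\<in>UNIV. B i j)" for i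
    proof -
      have "\<exists>s>0. s < t \<and> partial_x i \<psi> (x + t *\<^sub>R k) - partial_x i \<psi> (x + 0 *\<^sub>R k) =
         (t - 0) * (\<Sum>j\<in>UNIV. k $ j * partial_x j (partial_x i \<psi>) (x + s *\<^sub>R k))"
        by (rule MVT2) (use t in \<open>auto intro!: smooth_along_line sm\<close>)
      then obtain s where s: "partial_x i \<psi> (x + t *\<^sub>R k) - partial_x i \<psi> x =
         t * (\<Sum>j\<in>UNIV. k $ j * partial_x j (partial_x i \<psi>) (x + s *\<^sub>R k))" by auto
      have "\<bar>\<Sum>j\<in>UNIV. k $ j * partial_x j (partial_x i \<psi>) (x + s *\<^sub>R k)\<bar> \<le>
         (\<Sum>j\<in>UNIV. norm k * B i j)"
        by (rule order_trans[OF sum_abs sum_mono])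
           (auto simp: abs_mult intro!: mult_mono component_le_norm_cart B(2))
      then have "t * \<bar>\<Sum>j\<in>UNIV. k $ j * partial_x j (partial_x i \<psi>) (x + s *\<^sub>R k)\<bar> \<le>
         1 * (\<Sum>j\<in>UNIV. norm k * B i j)"
        using t by (intro mult_mono) auto
      then show ?thesis using t by (simp add: s abs_mult flip: sum_distrib_left)
    qed
    have "\<bar>\<psi> (x + k) - \<psi> x - (\<Sum>i\<in>UNIV. k $ i * partial_x i \<psi> x)\<bar> =
       \<bar>\<Sum>i\<in>UNIV. k $ i * (partial_x i \<psi> (x + t *\<^sub>R k) - partial_x i \<psi> x)\<bar>"
      unfolding t(3) by (simp add: right_diff_distrib sum_subtractf)
    also have "\<dots> \<le> (\<Sum>i\<in>UNIV. norm k * (norm k * (\<Sum>j\<in>UNIV. B i j)))"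
      by (rule order_trans[OF sum_abs sum_mono])
         (auto simp: abs_mult intro!: mult_mono component_le_norm_cart *)
    also have "\<dots> = C * (norm k)\<^sup>2"
      by (simp add: C_def power2_eq_square sum_distrib_left mult_ac)
    finally show ?thesis .
  qed
  ultimately show ?thesis using that by blast
qed

definition convolution ::
    "(real^'n::finite \<Rightarrow> real) \<Rightarrow> (real^'n \<Rightarrow> real) \<Rightarrow> real^'n \<Rightarrow> real" where
  "convolution h \<psi> x = (\<integral>y. h y * \<psi> (x - y) \<partial>lborel)"

lemma convolution_integrable:
  assumes "h \<in> compactly_supported U" "continuous_on UNIV \<psi>"
  shows "integrable lborel (\<lambda>y. h y * \<psi> (x - y))"
proof -
  have "(\<lambda>y. \<psi> (x - y) * h y) \<in> compactly_supported U"
    by (intro compactly_supported_mult assms continuous_on_compose2[OF assms(2)])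
       (auto intro!: continuous_intros)
  then show ?thesis
    using integrable_compactly_supported[OF locally_finite_lborel] by (simp add: mult.commute)
qed

text \<open>Since \<open>h\<close> is only continuous, the derivatives fall on
  \<open>\<psi>\<close>; integrating the uniform Taylor bound against \<open>\<bar>h y\<bar>\<close>
  leaves a quadratic remainder.\<close>

lemma convolution_has_derivative:
  assumes h: "h \<in> compactly_supported U" and \<psi>: "\<psi> \<in> test_functions UNIV"
  shows "(convolution h \<psi> has_derivative
    (\<lambda>k. \<Sum>i\<in>UNIV. k $ i * convolution h (partial_x i \<psi>) x)) (at x)"
proof -
  obtain C where C: "C \<ge> 0"
    "\<And>x k. \<bar>\<psi> (x + k) - \<psi> x - (\<Sum>i\<in>UNIV. k $ i * partial_x i \<psi> x)\<bar> \<le> C * (norm k)\<^sup>2"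
    using smooth_taylor_bound[OF \<psi>] by blast
  have cont: "continuous_on UNIV \<psi>" "continuous_on UNIV (partial_x i \<psi>)" for i
    using \<psi> test_functions_smooth smooth_partial smooth_continuous by blast+
  note int = convolution_integrable[OF h]
  have intabs: "integrable lborel (\<lambda>y. \<bar>h y\<bar>)"
    using integrable_compactly_supported[OF locally_finite_lborel h] by simp
  define I where "I = (\<integral>y. \<bar>h y\<bar> \<partial>lborel)"
  have bound: "\<bar>convolution h \<psi> (x + k) - convolution h \<psi> x -
     (\<Sum>i\<in>UNIV. k $ i * convolution h (partial_x i \<psi>) x)\<bar> \<le> I * C * (norm k)\<^sup>2" for k
  proof -
    have "convolution h \<psi> (x + k) - convolution h \<psi> x -
       (\<Sum>i\<in>UNIV. k $ i * convolution h (partial_x i \<psi>) x) =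
       (\<integral>y. h y * \<psi> (x + k - y) - h y * \<psi> (x - y) -
         (\<Sum>i\<in>UNIV. k $ i * (h y * partial_x i \<psi> (x - y))) \<partial>lborel)"
      by (simp add: convolution_def int cont)
    also have "\<bar>\<dots>\<bar> \<le> (\<integral>y. \<bar>h y\<bar> * (C * (norm k)\<^sup>2) \<partial>lborel)"
    proof (rule integral_abs_bound_integral)
      show "integrable lborel (\<lambda>y. h y * \<psi> (x + k - y) - h y * \<psi> (x - y) -
         (\<Sum>i\<in>UNIV. k $ i * (h y * partial_x i \<psi> (x - y))))"
        by (intro Bochner_Integration.integrable_diff Bochner_Integration.integrable_sum
            integrable_mult_right int cont)
      show "integrable lborel (\<lambda>y. \<bar>h y\<bar> * (C * (norm k)\<^sup>2))" using intabs by simp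
      fix y
      have "h y * \<psi> (x + k - y) - h y * \<psi> (x - y) -
         (\<Sum>i\<in>UNIV. k $ i * (h y * partial_x i \<psi> (x - y))) =
         h y * (\<psi> ((x - y) + k) - \<psi> (x - y) - (\<Sum>i\<in>UNIV. k $ i * partial_x i \<psi> (x - y)))"
        by (simp add: algebra_simps sum_distrib_left)
      then show "\<bar>h y * \<psi> (x + k - y) - h y * \<psi> (x - y) -
         (\<Sum>i\<in>UNIV. k $ i * (h y * partial_x i \<psi> (x - y)))\<bar> \<le> \<bar>h y\<bar> * (C * (norm k)\<^sup>2)"
        using C(2)[of "x - y" k] by (simp add: abs_mult mult_left_mono)
    qed
    also have "\<dots> = I * C * (norm k)\<^sup>2" by (simp add: I_def)
    finally show ?thesis .
  qed
  show ?thesis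
  proof (rule has_derivativeI_sandwich[of 1 _ _ _ _ "\<lambda>y. I * C * norm (y - x)"])
    show "bounded_linear (\<lambda>k. \<Sum>i\<in>UNIV. k $ i * convolution h (partial_x i \<psi>) x)"
      by (intro bounded_linear_sum bounded_linear_mult_const bounded_linear_vec_nth)
    show "((\<lambda>y. I * C * norm (y - x)) \<longlongrightarrow> 0) (at x)"
      by (rule tendsto_eq_intros | simp)+
    fix y assume "y \<noteq> x"
    then show "norm (convolution h \<psi> y - convolution h \<psi> x -
        (\<Sum>i\<in>UNIV. (y - x) $ i * convolution h (partial_x i \<psi>) x)) / norm (y - x) \<le> I * C * norm (y - x)"
      using bound[of "y - x"] by (simp add: divide_le_eq power2_eq_square mult.assoc)
  qed simp
qed

lemma smooth_convolution:
  assumes h: "h \<in> compactly_supported U" and "\<psi> \<in> test_functions UNIV"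
  shows "smooth (convolution h \<psi>)"
proof -
  have diff: "convolution h \<psi> differentiable_on UNIV" if "\<psi> \<in> test_functions UNIV" for \<psi>
    using convolution_has_derivative[OF h that] by (auto simp: differentiable_on_def differentiable_def)
  have "smooth_upto k (convolution h \<psi>)" if "\<psi> \<in> test_functions UNIV" for k \<psi>
    using that
  proof (induction k arbitrary: \<psi>)
    case (Suc k)
    have "partial_x i (convolution h \<psi>) = convolution h (partial_x i \<psi>)" for i
      using partial_x_eq[OF convolution_has_derivative[OF h Suc.prems]] by (auto simp: sum_axis)
    then show ?case using diff Suc by (simp add: test_functions_partial)
  qed (simp add: diff)
  then show ?thesis using assms(2) by (simp add: smooth_iff)
qed

lemma lborel_integral_reflect:
  fixes f :: "real^'n::finite \<Rightarrow> real"
  assumes [measurable]: "f \<in> borel_measurable borel"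
  shows "(\<integral>y. f (x - y) \<partial>lborel) = (\<integral>y. f y \<partial>lborel)"
proof -
  have "(lborel :: (real^'n) measure) = distr lborel borel (\<lambda>y. x - y)"
    by (subst lborel_affine[of "-1" x]) (simp_all add: density_1)
  then have "(\<integral>y. f y \<partial>lborel) = (\<integral>y. f y \<partial>distr lborel borel (\<lambda>y. x - y))" by simp
  also have "\<dots> = (\<integral>y. f (x - y) \<partial>lborel)" by (rule integral_distr) auto
  finally show ?thesis ..
qed

lemma convolution_commute:
  assumes "h \<in> compactly_supported U" "continuous_on UNIV \<psi>"
  shows "convolution h \<psi> x = (\<integral>z. h (x - z) * \<psi> z \<partial>lborel)"
proof -
  have "(\<lambda>y. h y * \<psi> (x - y)) \<in> borel_measurable borel"
    by (intro borel_measurable_continuous_onI continuous_on_mult compactly_supported_continuous[OF assms(1)]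
          continuous_on_compose2[OF assms(2)]) (auto intro!: continuous_intros)
  from lborel_integral_reflect[OF this, of x] show ?thesis by (simp add: convolution_def)
qed

text \<open>The common form of the bump functions built below and of the rescaled kernels
  \<open>scaled_mollifier \<eta> j\<close>, with the radius as a parameter.\<close>

definition mollifier :: "real \<Rightarrow> (real^'n::finite \<Rightarrow> real) \<Rightarrow> bool" where
  "mollifier r \<rho> \<longleftrightarrow> smooth \<rho> \<and> (\<forall>x. \<rho> x \<ge> 0) \<and> (\<forall>x. norm x > r \<longrightarrow> \<rho> x = 0) \<and>
     (\<integral>x. \<rho> x \<partial>lborel) = 1"

lemma mollifier_test_function: "mollifier r \<rho> \<Longrightarrow> \<rho> \<in> test_functions UNIV"
  by (rule test_functionsI[of _ "cball 0 r"]) (auto simp: mollifier_def)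

lemma mollifier_integrable: "mollifier r \<rho> \<Longrightarrow> integrable lborel \<rho>"
  using integrable_compactly_supported[OF locally_finite_lborel]
    test_functions_compactly_supported mollifier_test_function by blast

lemma exists_mollifier:
  assumes "r > 0"
  shows "\<exists>\<rho> :: real^'n::finite \<Rightarrow> real. mollifier r \<rho>"
proof -
  define b :: "real^'n \<Rightarrow> real" where "b x = flat 0 (r\<^sup>2 - (\<Sum>i\<in>UNIV. x $ i * x $ i))" for x
  have n2: "(\<Sum>i\<in>UNIV. x $ i * x $ i) = (norm x)\<^sup>2" for x :: "real^'n"
    by (simp add: power2_norm_eq_inner inner_vec_def)
  have sm: "smooth b"
    unfolding b_def
    by (intro smooth_flat smooth_diff smooth_const smooth_sum smooth_mult smooth_coordinate)
  have b0: "b x \<ge> 0" for x by (simp add: b_def flat_nonneg)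
  have bz: "b x = 0" if "norm x > r" for x
    using assms power_mono[OF less_imp_le[OF that], of 2] by (auto simp: b_def n2 flat_def not_less)
  have tf: "b \<in> test_functions UNIV"
    by (rule test_functionsI[of _ "cball 0 r"]) (use sm bz in auto)
  have int: "integrable lborel b"
    using integrable_compactly_supported[OF locally_finite_lborel test_functions_compactly_supported[OF tf]] .
  have "b 0 > 0" using assms by (simp add: b_def flat_def)
  \<comment> \<open>A nonnegative function with integral 0 vanishes almost everywhere; its zero set
    is closed, so it would contain the origin, where b is positive.\<close>
  have "(\<integral>x. b x \<partial>lborel) \<noteq> 0"
  proof
    assume "(\<integral>x. b x \<partial>lborel) = 0"
    then have "AE x in lborel. b x = 0"
      using integral_nonneg_eq_0_iff_AE[OF int] b0 by simp
    then have "AE x\<in>UNIV in lebesgue. x \<in> {x. b x = 0}"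
      by (auto intro: AE_completion)
    moreover have "closed {x. b x = 0}"
      using smooth_continuous[OF sm, of UNIV] by (intro closed_Collect_eq) auto
    ultimately have "b 0 = 0"
      using mem_closed_if_AE_lebesgue_open[of UNIV "{x. b x = 0}" 0] by auto
    then show False using \<open>b 0 > 0\<close> by simp
  qed
  moreover have "(\<integral>x. b x \<partial>lborel) \<ge> 0" using b0 by simp
  ultimately have "(\<integral>x. b x \<partial>lborel) > 0" by simp
  moreover have "smooth (\<lambda>x. (1 / (\<integral>x. b x \<partial>lborel)) * b x)"
    by (intro smooth_cmult sm)
  ultimately have "mollifier r (\<lambda>x. (1 / (\<integral>x. b x \<partial>lborel)) * b x)"
    using b0 bz int by (simp add: mollifier_def)
  then show ?thesis by blast
qed

section \<open>Approximation by convolution and smooth cutoffs\<close>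

lemma mollifier_shift_integrable:
  assumes h: "h \<in> compactly_supported U" and \<rho>: "mollifier r \<rho>"
  shows "integrable lborel (\<lambda>z. h (x - z) * \<rho> z)"
proof -
  have "(\<lambda>z. h (x - z) * \<rho> z) \<in> compactly_supported UNIV"
    by (intro compactly_supported_mult test_functions_compactly_supported
          mollifier_test_function[OF \<rho>] continuous_on_compose2[OF compactly_supported_continuous[OF h, of UNIV]])
       (auto intro!: continuous_intros)
  then show ?thesis by (rule integrable_compactly_supported[OF locally_finite_lborel])
qed

text \<open>A convolution averages \<open>h\<close> over the ball of radius r. This one estimate
  serves three purposes: \<open>e = 0\<close> gives exact values, \<open>c = 0\<close> gives bounds,
  and \<open>c = h x\<close> gives convergence.\<close>

lemma convolution_near:
  assumes h: "h \<in> compactly_supported U" and \<rho>: "mollifier r \<rho>"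
    and "\<And>y. dist x y \<le> r \<Longrightarrow> \<bar>h y - c\<bar> \<le> e"
  shows "\<bar>convolution h \<rho> x - c\<bar> \<le> e"
proof -
  have cont: "continuous_on UNIV \<rho>" using \<rho> smooth_continuous by (auto simp: mollifier_def)
  have int: "integrable lborel (\<lambda>z. h (x - z) * \<rho> z)" by (rule mollifier_shift_integrable[OF h \<rho>])
  have int\<rho>: "integrable lborel \<rho>" by (rule mollifier_integrable[OF \<rho>])
  have "convolution h \<rho> x - c = (\<integral>z. h (x - z) * \<rho> z - c * \<rho> z \<partial>lborel)"
    using convolution_commute[OF h cont] int int\<rho> \<rho> by (simp add: mollifier_def)
  also have "\<bar>\<dots>\<bar> \<le> (\<integral>z. e * \<rho> z \<partial>lborel)"
  proof (rule integral_abs_bound_integral)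
    show "\<bar>h (x - z) * \<rho> z - c * \<rho> z\<bar> \<le> e * \<rho> z" for z
    proof (cases "norm z > r")
      case True
      then show ?thesis using \<rho> by (simp add: mollifier_def)
    next
      case False
      then have "\<bar>h (x - z) - c\<bar> * \<rho> z \<le> e * \<rho> z"
        using \<rho> by (intro mult_right_mono assms(3)) (auto simp: mollifier_def dist_norm)
      then show ?thesis
        using \<rho> by (simp add: mollifier_def abs_mult flip: left_diff_distrib)
    qed
  qed (use int int\<rho> in auto)
  also have "\<dots> = e" using \<rho> by (simp add: mollifier_def)
  finally show ?thesis .
qed

lemma convolution_const:
  assumes "h \<in> compactly_supported U" "mollifier r \<rho>" "\<And>y. dist x y \<le> r \<Longrightarrow> h y = c"
  shows "convolution h \<rho> x = c"
  using convolution_near[OF assms(1,2), of x c 0] assms(3) by auto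

lemma convolution_nonneg:
  assumes "\<And>x. h x \<ge> 0" "mollifier r \<rho>"
  shows "convolution h \<rho> x \<ge> 0"
  using assms by (auto simp: convolution_def mollifier_def intro!: integral_nonneg_AE)

lemma compact_infdist_subset:
  assumes "compact K" "K \<noteq> {}" "open U" "K \<subseteq> U"
  obtains e where "e > 0" "compact {x. infdist x K \<le> e}" "{x::'a::heine_borel. infdist x K \<le> e} \<subseteq> U"
proof -
  obtain e where e: "e > 0" "(\<Union>x\<in>K. cball x e) \<subseteq> U"
    using compact_subset_open_imp_cball_epsilon_subset[OF assms(1,3,4)] by blast
  have "{x. infdist x K \<le> e} \<subseteq> U"
  proof
    fix x assume "x \<in> {x. infdist x K \<le> e}"
    moreover obtain y where "y \<in> K" "infdist x K = dist x y"
      using infdist_attains_inf[of K x] assms by (auto simp: compact_imp_closed)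
    ultimately have "x \<in> cball y e" by (simp add: dist_commute)
    with \<open>y \<in> K\<close> e(2) show "x \<in> U" by blast
  qed
  with e(1) compact_infdist_le[OF assms(2,1) e(1)] that show ?thesis by blast
qed

lemma compactly_supported_uniformly_continuous:
  assumes "f \<in> compactly_supported U"
  shows "uniformly_continuous_on UNIV f"
  unfolding uniformly_continuous_on_def
proof (intro allI impI)
  fix e :: real assume "e > 0"
  obtain K where K: "compact K" "K \<subseteq> U" "\<And>x. x \<notin> K \<Longrightarrow> f x = 0"
    using assms by (rule compactly_supportedE) blast
  \<comment> \<open>Enlarged by 1 so that two points at distance below 1 both lie in L as soon as
    one of them is in K; otherwise both values are 0.\<close>
  define L where "L = {x + y | x y. x \<in> K \<and> y \<in> cball 0 1}"
  have "compact L" unfolding L_def by (intro compact_sums K) simp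
  then have "uniformly_continuous_on L f"
    by (intro compact_uniformly_continuous compactly_supported_continuous[OF assms])
  then obtain d where d: "d > 0" "\<And>x y. x \<in> L \<Longrightarrow> y \<in> L \<Longrightarrow> dist y x < d \<Longrightarrow> dist (f y) (f x) < e"
    using \<open>e > 0\<close> unfolding uniformly_continuous_on_def by metis
  have L: "y \<in> L" if "x \<in> K" "dist y x < 1" for x y
  proof -
    have "y = x + (y - x)" "y - x \<in> cball 0 1" using that by (auto simp: dist_norm norm_minus_commute)
    then show ?thesis unfolding L_def using that(1) by blast
  qed
  have "dist (f y) (f x) < e" if "dist y x < min d 1" for x y
  proof (cases "x \<in> K \<or> y \<in> K")
    case True
    then have "x \<in> L" "y \<in> L"
      using L[of x x] L[of x y] L[of y x] L[of y y] that by (auto simp: dist_commute)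
    then show ?thesis using d(2) that by simp
  next
    case False
    then show ?thesis using K(3) \<open>e > 0\<close> by simp
  qed
  then show "\<exists>d>0. \<forall>x\<in>UNIV. \<forall>y\<in>UNIV. dist y x < d \<longrightarrow> dist (f y) (f x) < e"
    using d(1) by (intro exI[of _ "min d 1"]) auto
qed

lemma convolution_close:
  assumes h: "h \<in> compactly_supported U" and "\<epsilon> > 0"
  shows "\<exists>d>0. \<forall>r \<rho> x. mollifier r \<rho> \<longrightarrow> r < d \<longrightarrow> \<bar>convolution h \<rho> x - h x\<bar> < \<epsilon>"
proof -
  obtain d where d: "d > 0" "\<And>x y. dist y x < d \<Longrightarrow> dist (h y) (h x) < \<epsilon> / 2"
    using compactly_supported_uniformly_continuous[OF h] half_gt_zero[OF \<open>\<epsilon> > 0\<close>]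
    unfolding uniformly_continuous_on_def by (metis UNIV_I)
  have "\<bar>convolution h \<rho> x - h x\<bar> < \<epsilon>" if "mollifier r \<rho>" "r < d" for r \<rho> x
  proof -
    have "\<bar>convolution h \<rho> x - h x\<bar> \<le> \<epsilon> / 2"
      using d(2) that(2)
      by (intro convolution_near[OF h that(1)])
         (auto simp: dist_real_def dist_commute intro!: less_imp_le)
    then show ?thesis using \<open>\<epsilon> > 0\<close> by linarith
  qed
  with d(1) show ?thesis by blast
qed

text \<open>Besides converging uniformly, the approximants share one compact support in U and
  inherit bounds and sign, so that integrals against locally finite measures and estimates by
  positive functionals pass to the limit.\<close>

lemma smooth_approximation:
  assumes U: "open U" and h: "h \<in> compactly_supported U"
  obtains g K where "compact K" "K \<subseteq> U" "\<And>k. g k \<in> test_functions U"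
    "\<And>k x. x \<notin> K \<Longrightarrow> g k x = 0" "uniform_limit UNIV g h sequentially"
    "\<And>M k x. (\<And>x. \<bar>h x\<bar> \<le> M) \<Longrightarrow> \<bar>g k x\<bar> \<le> M"
    "\<And>k x. (\<And>x. h x \<ge> 0) \<Longrightarrow> g k x \<ge> 0"
proof -
  obtain K0 where K0: "compact K0" "K0 \<subseteq> U" "\<And>x. x \<notin> K0 \<Longrightarrow> h x = 0"
    using h by (rule compactly_supportedE) blast
  show ?thesis
  proof (cases "K0 = {}")
    \<comment> \<open>\<open>infdist\<close> to the empty set is 0, so the neighbourhoods used in
      the other case would be the whole space.\<close>
    case True
    then have "h = (\<lambda>x. 0)" using K0(3) by auto
    then show ?thesis by (intro that[of "{}" "\<lambda>_ _. 0"]) (auto intro: uniform_limit_const)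
  next
    case False
    obtain e where e: "e > 0" "compact {x. infdist x K0 \<le> e}" "{x. infdist x K0 \<le> e} \<subseteq> U"
      using compact_infdist_subset[OF K0(1) False U K0(2)] by blast
    define r where "r k = e / real (Suc k)" for k
    have r0: "r k > 0" "r k \<le> e" for k using e(1) by (auto simp: r_def field_simps)
    have "\<forall>k. \<exists>\<rho> :: real^'a \<Rightarrow> real. mollifier (r k) \<rho>" using exists_mollifier[OF r0(1)] by blast
    then obtain \<rho> :: "nat \<Rightarrow> real^'a \<Rightarrow> real" where \<rho>: "\<And>k. mollifier (r k) (\<rho> k)"
      unfolding choice_iff by blast
    define g where "g k = convolution h (\<rho> k)" for k
    have gz: "g k x = 0" if "x \<notin> {x. infdist x K0 \<le> e}" for k x
      unfolding g_def
    proof (rule convolution_const[OF h \<rho>])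
      fix y assume "dist x y \<le> r k"
      then have "y \<notin> K0"
        using that infdist_le[of y K0 x] r0(2)[of k] by auto
      then show "h y = 0" by (rule K0(3))
    qed
    show ?thesis
    proof (rule that[of "{x. infdist x K0 \<le> e}" g])
      show "g k \<in> test_functions U" for k
        by (rule test_functionsI[OF _ e(2,3) gz])
           (auto simp: g_def intro!: smooth_convolution[OF h] mollifier_test_function[OF \<rho>])
      show "uniform_limit UNIV g h sequentially"
      proof (rule uniform_limitI)
        fix \<epsilon> :: real assume "\<epsilon> > 0"
        obtain d where d: "d > 0" "\<And>r \<rho> x. mollifier r \<rho> \<Longrightarrow> r < d \<Longrightarrow> \<bar>convolution h \<rho> x - h x\<bar> < \<epsilon>"
          using convolution_close[OF h \<open>\<epsilon> > 0\<close>] by blast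
        have "r \<longlonglongrightarrow> 0" unfolding r_def
          using tendsto_mult_left[OF LIMSEQ_inverse_real_of_nat, of e] by (simp add: divide_inverse)
        then have "\<forall>\<^sub>F k in sequentially. r k < d" using d(1) by (simp add: order_tendstoD)
        then show "\<forall>\<^sub>F k in sequentially. \<forall>x\<in>UNIV. dist (g k x) (h x) < \<epsilon>"
          by eventually_elim (use d(2) \<rho> in \<open>auto simp: g_def dist_real_def\<close>)
      qed
      show "\<bar>g k x\<bar> \<le> M" if "\<And>x. \<bar>h x\<bar> \<le> M" for M k x
        using convolution_near[OF h \<rho>, where x=x and c=0 and e=M] that by (simp add: g_def)
      show "g k x \<ge> 0" if "\<And>x. h x \<ge> 0" for k x
        unfolding g_def by (rule convolution_nonneg[OF that \<rho>])
    qed (use e gz in auto)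
  qed
qed

text \<open>\<phi> equals 1 on a neighbourhood of K, not only on K, so that approximants supported
  near K are still dominated by multiples of \<phi>.\<close>

lemma smooth_cutoff:
  assumes K: "compact K" and U: "open U" "K \<subseteq> U"
  obtains \<phi> V where "\<phi> \<in> test_functions U" "open V" "K \<subseteq> V" "V \<subseteq> U"
    "\<And>x. x \<in> V \<Longrightarrow> \<phi> x = 1" "\<And>x. 0 \<le> \<phi> x" "\<And>x. \<phi> x \<le> 1"
proof (cases "K = {}")
  case True
  then show ?thesis by (intro that[of "\<lambda>_. 0" "{}"]) auto
next
  case False
  obtain e where e: "e > 0" "compact {x. infdist x K \<le> e}" "{x. infdist x K \<le> e} \<subseteq> U"
    using compact_infdist_subset[OF K False U] by blast
  \<comment> \<open>Equal to 1 within e/3 of K and to 0 beyond 2e/3. Averaging at radius e/6 then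
    leaves the value 1 on the e/6-neighbourhood and 0 outside the e-neighbourhood.\<close>
  define h where "h x = max 0 (min 1 (2 - 3 * infdist x K / e))" for x
  have h0: "h y = 0" if "infdist y K \<ge> 2 * e / 3" for y
    using that e(1) by (simp add: h_def field_simps)
  have h1: "h y = 1" if "infdist y K \<le> e / 3" for y
    using that e(1) by (simp add: h_def field_simps)
  have "continuous_on UNIV h"
    unfolding h_def using e(1) by (intro continuous_intros) auto
  then have h: "h \<in> compactly_supported U"
    by (rule compactly_supportedI[OF _ e(2,3)]) (use e(1) in \<open>auto intro!: h0\<close>)
  obtain \<rho> :: "real^'a \<Rightarrow> real" where \<rho>: "mollifier (e / 6) \<rho>"
    using exists_mollifier[of "e / 6"] e(1) by auto
  let ?\<phi> = "convolution h \<rho>"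
  let ?V = "{x. infdist x K < e / 6}"
  have far: "infdist y K \<ge> infdist x K - e / 6" and near: "infdist y K \<le> infdist x K + e / 6"
    if "dist x y \<le> e / 6" for x y
    using that infdist_triangle[of x K y] infdist_triangle[of y K x] by (auto simp: dist_commute)
  show ?thesis
  proof (rule that[of ?\<phi> ?V])
    show "?\<phi> \<in> test_functions U"
    proof (rule test_functionsI[OF _ e(2,3)])
      show "smooth ?\<phi>" by (rule smooth_convolution[OF h mollifier_test_function[OF \<rho>]])
      show "?\<phi> x = 0" if "x \<notin> {x. infdist x K \<le> e}" for x
      proof (rule convolution_const[OF h \<rho>])
        show "h y = 0" if "dist x y \<le> e / 6" for y
          using that e(1) far[OF that] \<open>x \<notin> _\<close> by (intro h0) simp
      qed
    qed
    show "open ?V" by (intro open_Collect_less continuous_intros)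
    show "K \<subseteq> ?V" using e(1) by auto
    show "?V \<subseteq> U" using e by force
    show "?\<phi> x = 1" if "x \<in> ?V" for x
    proof (rule convolution_const[OF h \<rho>])
      show "h y = 1" if "dist x y \<le> e / 6" for y
        using that e(1) near[OF that] \<open>x \<in> ?V\<close> by (intro h1) simp
    qed
    show "0 \<le> ?\<phi> x" for x by (rule convolution_nonneg[OF _ \<rho>]) (simp add: h_def)
    show "?\<phi> x \<le> 1" for x
      using convolution_near[OF h \<rho>, of x 0 1] by (auto simp: h_def)
  qed
qed

section \<open>The Riesz representation theorem\<close>

text \<open>The domain A is a parameter because the Riesz theorem concerns continuous functions,
  whereas currents give functionals on test functions.\<close>

definition positive_linear_on :: "('a \<Rightarrow> real) set \<Rightarrow> (('a \<Rightarrow> real) \<Rightarrow> real) \<Rightarrow> bool" where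
  "positive_linear_on A L \<longleftrightarrow>
     (\<forall>f\<in>A. \<forall>g\<in>A. L (\<lambda>x. f x + g x) = L f + L g) \<and>
     (\<forall>f\<in>A. \<forall>c. L (\<lambda>x. c * f x) = c * L f) \<and>
     (\<forall>f\<in>A. (\<forall>x. f x \<ge> 0) \<longrightarrow> L f \<ge> 0)"

lemma positive_linear_on_add:
  "positive_linear_on A L \<Longrightarrow> f \<in> A \<Longrightarrow> g \<in> A \<Longrightarrow> L (\<lambda>x. f x + g x) = L f + L g"
  and positive_linear_on_cmult:
  "positive_linear_on A L \<Longrightarrow> f \<in> A \<Longrightarrow> L (\<lambda>x. c * f x) = c * L f"
  and positive_linear_on_nonneg:
  "positive_linear_on A L \<Longrightarrow> f \<in> A \<Longrightarrow> (\<And>x. f x \<ge> 0) \<Longrightarrow> L f \<ge> 0"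
  by (auto simp: positive_linear_on_def)

section \<open>The outer measure of a positive functional\<close>

context
  fixes U :: "(real^'n::finite) set" and L :: "(real^'n \<Rightarrow> real) \<Rightarrow> real"
  assumes U: "open U" and L: "positive_linear_on (compactly_supported U) L"
begin

lemma riesz_diff:
  assumes "f \<in> compactly_supported U" "g \<in> compactly_supported U"
  shows "L (\<lambda>x. f x - g x) = L f - L g"
proof -
  have "L (\<lambda>x. f x + (-1) * g x) = L f + (-1) * L g"
    using positive_linear_on_add[OF L assms(1) compactly_supported_cmult[OF assms(2), of "-1"]]
      positive_linear_on_cmult[OF L assms(2), of "-1"] by simp
  then show ?thesis by simp
qed

lemma riesz_0: "L (\<lambda>x. 0) = 0"
  using positive_linear_on_cmult[OF L, of "\<lambda>x. 0" 0] by simp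

lemma riesz_mono:
  assumes "f \<in> compactly_supported U" "g \<in> compactly_supported U" "\<And>x. f x \<le> g x"
  shows "L f \<le> L g"
  using riesz_diff[OF assms(2,1)]
    positive_linear_on_nonneg[OF L compactly_supported_diff[OF assms(2,1)]] assms(3) by simp

lemma riesz_sum:
  assumes "\<And>k::nat. f k \<in> compactly_supported U"
  shows "(\<lambda>x. \<Sum>k<n. f k x) \<in> compactly_supported U \<and> L (\<lambda>x. \<Sum>k<n. f k x) = (\<Sum>k<n. L (f k))"
  using assms
  by (induction n) (auto simp: riesz_0 positive_linear_on_add[OF L] compactly_supported_add)

text \<open>The relation usually written f \<prec> V, of which \<open>open_mass V\<close> takes the
  supremum. Supports also lie in U, the domain of L, so that V may range over all open subsets of
  the space.\<close>

definition subordinate :: "(real^'n) set \<Rightarrow> (real^'n \<Rightarrow> real) set" where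
  "subordinate V = {f \<in> compactly_supported (U \<inter> V). \<forall>x. 0 \<le> f x \<and> f x \<le> 1}"

definition open_mass :: "(real^'n) set \<Rightarrow> ennreal" where
  "open_mass V = (SUP f\<in>subordinate V. ennreal (L f))"

definition riesz_outer :: "(real^'n) set \<Rightarrow> ennreal" where
  "riesz_outer E = (INF V\<in>{V. open V \<and> E \<subseteq> V}. open_mass V)"

lemma subordinate_supported: "f \<in> subordinate V \<Longrightarrow> f \<in> compactly_supported U"
  using compactly_supported_mono[of "U \<inter> V" U] by (auto simp: subordinate_def)

lemma subordinate_zero: "(\<lambda>x. 0) \<in> subordinate V"
  by (simp add: subordinate_def)

lemma subordinate_mono: "V \<subseteq> W \<Longrightarrow> subordinate V \<subseteq> subordinate W"
  using compactly_supported_mono[of "U \<inter> V" "U \<inter> W"] by (auto simp: subordinate_def)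

lemma open_mass_mono: "V \<subseteq> W \<Longrightarrow> open_mass V \<le> open_mass W"
  unfolding open_mass_def by (intro SUP_subset_mono subordinate_mono) auto

lemma open_mass_upper: "f \<in> subordinate V \<Longrightarrow> ennreal (L f) \<le> open_mass V"
  unfolding open_mass_def by (rule SUP_upper)

lemma riesz_nonneg: "f \<in> subordinate V \<Longrightarrow> L f \<ge> 0"
  using positive_linear_on_nonneg[OF L subordinate_supported] by (auto simp: subordinate_def)

lemma open_mass_empty: "open_mass {} = 0"
proof -
  have "f = (\<lambda>x. 0)" if "f \<in> subordinate {}" for f
    using that by (auto simp: subordinate_def elim!: compactly_supportedE)
  then have "ennreal (L f) \<le> 0" if "f \<in> subordinate {}" for f
    using that riesz_0 by force
  then show ?thesis
    unfolding open_mass_def by (intro antisym SUP_least) auto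
qed

text \<open>A partition of unity for two sets: \<phi> is supported in V and equals 1 near the part
  of K outside W. Hence \<open>f x * \<phi> x\<close> belongs to V, and
  \<open>(1 - \<phi> x) * f x\<close>, which lives on \<open>K - N\<close>, belongs to W.\<close>

lemma open_mass_Un:
  assumes "open V" "open W"
  shows "open_mass (V \<union> W) \<le> open_mass V + open_mass W"
  unfolding open_mass_def[of "V \<union> W"]
proof (rule SUP_least)
  fix f assume f: "f \<in> subordinate (V \<union> W)"
  then have f01: "\<And>x. 0 \<le> f x" "\<And>x. f x \<le> 1" by (auto simp: subordinate_def)
  from f obtain K where K: "compact K" "K \<subseteq> U \<inter> (V \<union> W)" "\<And>x. x \<notin> K \<Longrightarrow> f x = 0"
    by (auto simp: subordinate_def elim: compactly_supportedE)
  have "compact (K - W)" using K(1) assms(2) by (rule compact_diff)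
  moreover have "K - W \<subseteq> U \<inter> V" using K(2) by auto
  ultimately obtain \<phi> N where \<phi>: "\<phi> \<in> test_functions (U \<inter> V)" "open N" "K - W \<subseteq> N"
    "\<And>x. x \<in> N \<Longrightarrow> \<phi> x = 1" "\<And>x. 0 \<le> \<phi> x" "\<And>x. \<phi> x \<le> 1"
    using smooth_cutoff[of "K - W" "U \<inter> V"] U assms(1) by (metis open_Int)
  have cont: "continuous_on UNIV \<phi>" "continuous_on UNIV f"
    using \<phi>(1) test_functions_smooth smooth_continuous
      compactly_supported_continuous[OF subordinate_supported[OF f]] by blast+
  let ?f1 = "\<lambda>x. f x * \<phi> x" and ?f2 = "\<lambda>x. (1 - \<phi> x) * f x"
  have f1: "?f1 \<in> subordinate V"
    unfolding subordinate_def
    using compactly_supported_mult[OF test_functions_compactly_supported[OF \<phi>(1)] cont(2)] f01 \<phi>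
    by (auto intro: mult_le_one)
  have "?f2 \<in> compactly_supported (U \<inter> W)"
  proof (rule compactly_supportedI)
    show "continuous_on UNIV ?f2" by (intro continuous_intros cont)
    show "compact (K - N)" using K(1) \<phi>(2) by (rule compact_diff)
  qed (use K \<phi> in auto)
  then have f2: "?f2 \<in> subordinate W"
    using f01 \<phi> by (auto simp: subordinate_def intro: mult_le_one)
  have "L f = L (\<lambda>x. ?f1 x + ?f2 x)" by (rule arg_cong[of _ _ L]) (auto simp: algebra_simps)
  also have "\<dots> = L ?f1 + L ?f2"
    by (rule positive_linear_on_add[OF L]) (use f1 f2 subordinate_supported in blast)+
  finally have "ennreal (L f) = ennreal (L ?f1) + ennreal (L ?f2)"
    using riesz_nonneg[OF f1] riesz_nonneg[OF f2] by (simp add: ennreal_plus)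
  also have "\<dots> \<le> open_mass V + open_mass W"
    by (intro add_mono open_mass_upper f1 f2)
  finally show "ennreal (L f) \<le> open_mass V + open_mass W" .
qed

lemma open_mass_UN:
  fixes V :: "nat \<Rightarrow> (real^'n) set"
  assumes "\<And>i. open (V i)"
  shows "open_mass (\<Union>i. V i) \<le> (\<Sum>i. open_mass (V i))"
  unfolding open_mass_def[of "\<Union>i. V i"]
proof (rule SUP_least)
  fix f assume f: "f \<in> subordinate (\<Union>i. V i)"
  then obtain K where K: "compact K" "K \<subseteq> U \<inter> (\<Union>i. V i)" "\<And>x. x \<notin> K \<Longrightarrow> f x = 0"
    by (auto simp: subordinate_def elim: compactly_supportedE)
  have "K \<subseteq> \<Union> (range V)" using K(2) by auto
  then obtain I where I: "finite I" "K \<subseteq> (\<Union>i\<in>I. V i)"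
    using compactE_image[OF K(1), of UNIV V] assms by auto
  have "f \<in> subordinate (\<Union>i\<in>I. V i)"
    using f K I unfolding subordinate_def
    by (auto intro!: compactly_supportedI[of _ K] elim: compactly_supported_continuous)
  then have "ennreal (L f) \<le> open_mass (\<Union>i\<in>I. V i)" by (rule open_mass_upper)
  also have "\<dots> \<le> (\<Sum>i\<in>I. open_mass (V i))"
    using I(1)
  proof (induction I rule: finite_induct)
    case (insert i I)
    have "open_mass (V i \<union> (\<Union>j\<in>I. V j)) \<le> open_mass (V i) + open_mass (\<Union>j\<in>I. V j)"
      using assms by (intro open_mass_Un) auto
    also have "\<dots> \<le> open_mass (V i) + (\<Sum>i\<in>I. open_mass (V i))"
      by (intro add_left_mono insert.IH)
    finally show ?case using insert.hyps by simp
  qed (simp add: open_mass_empty)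
  also have "\<dots> \<le> (\<Sum>i. open_mass (V i))" by (rule sum_le_suminf) (use I(1) in auto)
  finally show "ennreal (L f) \<le> (\<Sum>i. open_mass (V i))" .
qed

lemma riesz_outer_open: "open V \<Longrightarrow> riesz_outer V = open_mass V"
  unfolding riesz_outer_def by (intro antisym INF_lower INF_greatest open_mass_mono) auto

lemma riesz_outer_le: "open V \<Longrightarrow> E \<subseteq> V \<Longrightarrow> riesz_outer E \<le> open_mass V"
  unfolding riesz_outer_def by (rule INF_lower) auto

lemma riesz_outer_mono: "E \<subseteq> F \<Longrightarrow> riesz_outer E \<le> riesz_outer F"
  unfolding riesz_outer_def by (rule INF_superset_mono) auto

lemma riesz_outer_UN:
  fixes E :: "nat \<Rightarrow> (real^'n) set"
  shows "riesz_outer (\<Union>i. E i) \<le> (\<Sum>i. riesz_outer (E i))"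
proof (rule ennreal_le_epsilon)
  fix e :: real assume e: "e > 0" and fin: "(\<Sum>i. riesz_outer (E i)) < top"
  have "\<exists>V. open V \<and> E i \<subseteq> V \<and> open_mass V \<le> riesz_outer (E i) + ennreal (e * (1 / 2) ^ Suc i)" for i
  proof -
    have "riesz_outer (E i) < top"
      using fin ennreal_suminf_lessD by blast
    then have "riesz_outer (E i) < riesz_outer (E i) + ennreal (e * (1 / 2) ^ Suc i)"
      using e by (simp add: ennreal_zero_less_mult_iff)
    then show ?thesis
      unfolding riesz_outer_def INF_less_iff by (auto intro: less_imp_le)
  qed
  then have "\<forall>i. \<exists>V. open V \<and> E i \<subseteq> V \<and> open_mass V \<le> riesz_outer (E i) + ennreal (e * (1 / 2) ^ Suc i)"
    by blast
  then obtain V where V: "\<And>i. open (V i)" "\<And>i. E i \<subseteq> V i"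
    "\<And>i. open_mass (V i) \<le> riesz_outer (E i) + ennreal (e * (1 / 2) ^ Suc i)"
    unfolding choice_iff by blast
  have "riesz_outer (\<Union>i. E i) \<le> open_mass (\<Union>i. V i)"
    using V by (intro riesz_outer_le) auto
  also have "\<dots> \<le> (\<Sum>i. open_mass (V i))" by (rule open_mass_UN[OF V(1)])
  also have "\<dots> \<le> (\<Sum>i. riesz_outer (E i) + ennreal (e * (1 / 2) ^ Suc i))"
    by (rule suminf_le[OF V(3)]) auto
  also have "\<dots> = (\<Sum>i. riesz_outer (E i)) + (\<Sum>i. ennreal (e * (1 / 2) ^ Suc i))"
    by (rule suminf_add[symmetric]) auto
  also have "(\<Sum>i. ennreal (e * (1 / 2) ^ Suc i)) = ennreal e"
  proof -
    have "(\<lambda>i. e * (1 / 2) ^ Suc i) sums (e * 1)"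
      by (rule sums_mult) (rule power_half_series)
    then show ?thesis using e by (subst suminf_ennreal_eq[of _ e]) auto
  qed
  finally show "riesz_outer (\<Union>i. E i) \<le> (\<Sum>i. riesz_outer (E i)) + ennreal e" .
qed

text \<open>Caratheodory's inequality for V, tested on an open W: \<open>f\<close> lives on a
  compact K inside V, and \<open>g\<close> on \<open>W - K\<close>, which is open and contains
  \<open>W - V\<close>. At each point one of them vanishes, so their sum still takes values in
  [0, 1].\<close>

lemma open_mass_split:
  assumes "open V" "open W"
  shows "open_mass (W \<inter> V) + riesz_outer (W - V) \<le> open_mass W"
proof -
  have "ennreal (L f) + riesz_outer (W - V) \<le> open_mass W" if f: "f \<in> subordinate (W \<inter> V)" for f
  proof -
    from f obtain K where K: "compact K" "K \<subseteq> U \<inter> (W \<inter> V)" "\<And>x. x \<notin> K \<Longrightarrow> f x = 0"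
      by (auto simp: subordinate_def elim: compactly_supportedE)
    have "ennreal (L f) + ennreal (L g) \<le> open_mass W" if g: "g \<in> subordinate (W - K)" for g
    proof -
      have disj: "f x = 0 \<or> g x = 0" for x
        using g K(3)[of x] unfolding subordinate_def by (auto elim!: compactly_supportedE)
      have f': "f \<in> subordinate W" and g': "g \<in> subordinate W"
        using f g subordinate_mono[of "W \<inter> V" W] subordinate_mono[of "W - K" W] by auto
      have le1: "f x + g x \<le> 1" for x
        using disj[of x] f' g' by (auto simp: subordinate_def)
      have fg: "(\<lambda>x. f x + g x) \<in> subordinate W"
        using f' g' le1 compactly_supported_add[of f "U \<inter> W" g] by (auto simp: subordinate_def)
      have "ennreal (L f) + ennreal (L g) = ennreal (L (\<lambda>x. f x + g x))"
        using riesz_nonneg[OF f] riesz_nonneg[OF g]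
        by (simp add: positive_linear_on_add[OF L subordinate_supported[OF f] subordinate_supported[OF g]] ennreal_plus)
      then show ?thesis using open_mass_upper[OF fg] by simp
    qed
    then have "(SUP g\<in>subordinate (W - K). ennreal (L f) + ennreal (L g)) \<le> open_mass W"
      by (intro SUP_least)
    then have "ennreal (L f) + open_mass (W - K) \<le> open_mass W"
      unfolding open_mass_def[of "W - K"] using subordinate_zero
      by (subst ennreal_SUP_add_right) auto
    moreover have "riesz_outer (W - V) \<le> open_mass (W - K)"
      using K assms by (intro riesz_outer_le open_Diff compact_imp_closed) auto
    ultimately show ?thesis by (meson add_left_mono order_trans)
  qed
  then have "(SUP f\<in>subordinate (W \<inter> V). ennreal (L f) + riesz_outer (W - V)) \<le> open_mass W"
    by (intro SUP_least)
  then show ?thesis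
    unfolding open_mass_def[of "W \<inter> V"] using subordinate_zero
    by (subst ennreal_SUP_add_left[symmetric]) auto
qed

lemma open_lambda_system:
  assumes "open V"
  shows "V \<in> lambda_system UNIV (Pow UNIV) riesz_outer"
  unfolding lambda_system_def
proof (intro CollectI conjI ballI antisym)
  show "V \<in> Pow UNIV" by simp
  fix E :: "(real^'n) set"
  show "riesz_outer (V \<inter> E) + riesz_outer ((UNIV - V) \<inter> E) \<le> riesz_outer E"
    unfolding riesz_outer_def[of E]
  proof (rule INF_greatest, clarsimp)
    fix W assume W: "open W" "E \<subseteq> W"
    have "riesz_outer (V \<inter> E) \<le> open_mass (W \<inter> V)"
      using W assms by (intro riesz_outer_le) auto
    moreover have "riesz_outer ((UNIV - V) \<inter> E) \<le> riesz_outer (W - V)"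
      using W by (intro riesz_outer_mono) auto
    ultimately show "riesz_outer (V \<inter> E) + riesz_outer ((UNIV - V) \<inter> E) \<le> open_mass W"
      using open_mass_split[OF assms W(1)] add_mono order_trans by blast
  qed
  \<comment> \<open>Countable subadditivity is applied to two sets by padding the sequence with
    empty sets.\<close>
  define A where "A i = (if i = 0 then V \<inter> E else if i = 1 then (UNIV - V) \<inter> E else {})" for i :: nat
  have "riesz_outer {} = 0" using riesz_outer_open[of "{}"] open_mass_empty by simp
  then have "(\<Sum>i. riesz_outer (A i)) = (\<Sum>i\<in>{0,1}. riesz_outer (A i))"
    by (intro suminf_finite) (auto simp: A_def)
  also have "\<dots> = riesz_outer (V \<inter> E) + riesz_outer ((UNIV - V) \<inter> E)" by (simp add: A_def)
  finally have sum: "(\<Sum>i. riesz_outer (A i)) = riesz_outer (V \<inter> E) + riesz_outer ((UNIV - V) \<inter> E)" .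
  have "(\<Union>i. A i) = E" by (auto simp: A_def split: if_splits)
  then show "riesz_outer E \<le> riesz_outer (V \<inter> E) + riesz_outer ((UNIV - V) \<inter> E)"
    using riesz_outer_UN[of A] unfolding sum by (simp only:)
qed

definition riesz_measure :: "(real^'n) measure" where
  "riesz_measure = measure_of UNIV (sets borel) riesz_outer"

lemma sets_riesz_measure: "sets riesz_measure = sets borel"
  using sets.sigma_sets_eq[of borel] by (simp add: riesz_measure_def)

text \<open>Caratheodory's lemma makes the outer measure a measure on its measurable sets; these
  contain the open sets, hence all Borel sets.\<close>

lemma emeasure_riesz_measure:
  assumes "E \<in> sets borel"
  shows "emeasure riesz_measure E = riesz_outer E"
proof -
  have empty: "riesz_outer {} = 0" using riesz_outer_open[of "{}"] open_mass_empty by simp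
  have outer: "outer_measure_space (Pow UNIV) riesz_outer"
    unfolding outer_measure_space_def positive_def increasing_def countably_subadditive_def
    using riesz_outer_mono riesz_outer_UN empty by auto
  interpret P: sigma_algebra "UNIV :: (real^'n) set" "Pow UNIV" by (rule sigma_algebra_Pow)
  have ms: "measure_space UNIV (lambda_system UNIV (Pow UNIV) riesz_outer) riesz_outer"
    by (rule P.caratheodory_lemma[OF outer])
  then interpret Q: sigma_algebra "UNIV :: (real^'n) set" "lambda_system UNIV (Pow UNIV) riesz_outer"
    by (simp add: measure_space_def)
  have "sets borel \<subseteq> lambda_system UNIV (Pow UNIV) riesz_outer"
    unfolding sets_borel by (rule Q.sigma_sets_subset) (use open_lambda_system in blast)
  moreover have "sigma_algebra UNIV (sets (borel :: (real^'n) measure))"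
    using sets.sigma_algebra_axioms[of "borel :: (real^'n) measure"] by (simp only: space_borel)
  ultimately have "measure_space UNIV (sets borel) riesz_outer"
    by (intro measure_down[OF ms])
  then show ?thesis
    unfolding riesz_measure_def measure_space_def using assms
    by (intro emeasure_measure_of_sigma) blast+
qed

section \<open>Integrals against the Riesz measure\<close>

lemma open_mass_le_functional:
  assumes "f \<in> compactly_supported U" "\<And>x. x \<in> V \<Longrightarrow> f x \<ge> 1" "\<And>x. f x \<ge> 0"
  shows "open_mass V \<le> ennreal (L f)"
  unfolding open_mass_def
proof (rule SUP_least)
  fix g assume g: "g \<in> subordinate V"
  have "g x \<le> f x" for x
  proof (cases "x \<in> V")
    case True
    then show ?thesis using g assms(2)[OF True] by (auto simp: subordinate_def intro: order_trans)
  next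
    case False
    then have "g x = 0" using g by (auto simp: subordinate_def elim!: compactly_supportedE)
    then show ?thesis using assms(3) by simp
  qed
  then show "ennreal (L g) \<le> ennreal (L f)"
    by (intro ennreal_leI riesz_mono subordinate_supported[OF g] assms(1))
qed

lemma riesz_measure_neighborhood:
  assumes "compact K" "K \<subseteq> U"
  obtains V where "open V" "K \<subseteq> V" "emeasure riesz_measure V < \<infinity>"
proof -
  obtain \<phi> V where \<phi>: "\<phi> \<in> test_functions U" "open V" "K \<subseteq> V"
    "\<And>x. x \<in> V \<Longrightarrow> \<phi> x = 1" "\<And>x. 0 \<le> \<phi> x"
    using smooth_cutoff[OF assms(1) U assms(2)] by metis
  have "open_mass V \<le> ennreal (L \<phi>)"
    using \<phi> by (intro open_mass_le_functional test_functions_compactly_supported) auto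
  also have "\<dots> < \<infinity>" by simp
  finally have "emeasure riesz_measure V < \<infinity>"
    using \<phi>(2) by (simp add: emeasure_riesz_measure riesz_outer_open)
  with \<phi> that show ?thesis by blast
qed

lemma locally_finite_riesz_measure: "locally_finite_measure U riesz_measure"
  unfolding locally_finite_measure_def
proof (intro conjI allI impI sets_riesz_measure)
  fix K assume "compact K \<and> K \<subseteq> U"
  then obtain V where "open V" "K \<subseteq> V" "emeasure riesz_measure V < \<infinity>"
    using riesz_measure_neighborhood by blast
  then show "emeasure riesz_measure K < \<infinity>"
    using emeasure_mono[of K V riesz_measure] by (auto simp: sets_riesz_measure intro: le_less_trans)
qed

text \<open>
  Both \<open>L\<close> and the integral of the slice of \<open>f\<close> between the levels \<open>k \<epsilon>\<close> and \<open>(k + 1) \<epsilon>\<close> lie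
  between \<open>\<epsilon> \<mu>{f > (k + 1) \<epsilon>}\<close> and \<open>\<epsilon> \<mu>{f > (k - 1) \<epsilon>}\<close>, and these bounds telescope.
\<close>

lemma riesz_representation_nonneg:
  assumes f: "f \<in> compactly_supported U" and f0: "\<And>x. f x \<ge> 0"
  shows "L f = (\<integral>x. f x \<partial>riesz_measure)"
proof -
  let ?\<mu> = riesz_measure
  obtain K where K: "compact K" "K \<subseteq> U" "\<And>x. x \<notin> K \<Longrightarrow> f x = 0"
    using f by (rule compactly_supportedE) blast
  obtain V where V: "open V" "K \<subseteq> V" "emeasure ?\<mu> V < \<infinity>"
    using riesz_measure_neighborhood[OF K(1,2)] by blast
  obtain B where B: "B > 0" "\<And>x. \<bar>f x\<bar> \<le> B" using f by (rule compactly_supported_bounded) blast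
  have fcont: "continuous_on UNIV f" by (rule compactly_supported_continuous[OF f])
  have main: "\<bar>L f - (\<integral>x. f x \<partial>?\<mu>)\<bar> \<le> \<epsilon> * (2 * measure ?\<mu> V)" if \<epsilon>: "\<epsilon> > 0" for \<epsilon>
  proof -
    define N where "N = nat \<lceil>B / \<epsilon>\<rceil>"
    have N: "f x \<le> real N * \<epsilon>" for x
    proof -
      have "B / \<epsilon> \<le> real N" unfolding N_def by linarith
      then have "B \<le> real N * \<epsilon>" using \<epsilon> by (simp add: field_simps)
      then show ?thesis using B(2)[of x] by linarith
    qed
    define s where "s k x = min (max (f x - real k * \<epsilon>) 0) \<epsilon>" for k x
    \<comment> \<open>\<open>H (Suc k)\<close> is the level set \<open>{f > k \<epsilon>}\<close>.
      \<open>H 0\<close> stands for level -1, where \<open>{f > - \<epsilon>}\<close> would be the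
      whole space; V takes its place because it contains K and has finite mass.\<close>
    define H where "H k = (case k of 0 \<Rightarrow> V | Suc k \<Rightarrow> {x. f x > real k * \<epsilon>})" for k
    have H_open: "open (H k)" for k
      using V(1) fcont by (cases k) (auto simp: H_def intro!: open_Collect_less continuous_intros)
    have H_sub: "H (Suc k) \<subseteq> H k" for k
    proof
      fix x assume x: "x \<in> H (Suc k)"
      show "x \<in> H k"
      proof (cases k)
        case 0
        then have "f x > 0" using x by (simp add: H_def)
        then show ?thesis using 0 K(3)[of x] V(2) by (auto simp: H_def)
      next
        case (Suc m)
        have "real m * \<epsilon> < real (Suc m) * \<epsilon>" using \<epsilon> by simp
        then show ?thesis using x Suc by (simp add: H_def)
      qed
    qed
    have H_V: "H k \<subseteq> V" for k
    proof (induction k)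
      case (Suc k)
      then show ?case using H_sub[of k] by blast
    qed (simp add: H_def)
    have H_fin: "emeasure ?\<mu> (H k) < \<infinity>" for k
      using emeasure_mono[OF H_V[of k], of ?\<mu>] V(1,3) sets_riesz_measure
      by (auto intro: le_less_trans)
    define m where "m k = measure ?\<mu> (H k)" for k
    have m_eq: "open_mass (H k) = ennreal (m k)" for k
      using H_open[of k] H_fin[of k] unfolding m_def
      by (subst emeasure_eq_ennreal_measure[symmetric])
         (auto simp: emeasure_riesz_measure riesz_outer_open)
    have m0: "m k \<ge> 0" for k by (simp add: m_def)
    have m_mono: "m (Suc k) \<le> m k" for k
      unfolding m_def using H_sub[of k] H_fin[of k] H_open[of k]
      by (intro measure_mono_fmeasurable) (auto simp: fmeasurable_def sets_riesz_measure H_open)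
    have sum_s: "(\<Sum>k<n. s k x) = min (f x) (real n * \<epsilon>)" for n x
    proof (induction n)
      case (Suc n)
      then show ?case using \<epsilon> f0[of x] by (simp add: s_def algebra_simps min_def max_def)
    qed (use f0[of x] in simp)
    have s_cs: "s k \<in> compactly_supported U" for k
      by (rule compactly_supportedI[OF _ K(1,2)])
         (use \<epsilon> K(3) in \<open>auto simp: s_def[abs_def] intro!: continuous_intros fcont\<close>)
    have s0: "s k x \<ge> 0" and s1: "s k x \<le> \<epsilon>" for k x using \<epsilon> by (auto simp: s_def)
    have s_eq: "s k x = \<epsilon>" if "x \<in> H (Suc (Suc k))" for k x
      using that \<epsilon> by (simp add: s_def H_def algebra_simps)
    have s_zero: "s k x = 0" if "x \<notin> H (Suc k)" for k x
      using that \<epsilon> by (simp add: s_def H_def)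
    have scale: "\<epsilon> * L (\<lambda>x. (1 / \<epsilon>) * s k x) = L (s k)" for k
      using \<epsilon> positive_linear_on_cmult[OF L s_cs, of "1 / \<epsilon>" k] by simp
    have up: "L (s k) \<le> \<epsilon> * m k" for k
    proof -
      have "(\<lambda>x. (1 / \<epsilon>) * s k x) \<in> subordinate (H k)"
      proof -
        let ?C = "K \<inter> {x. f x \<ge> real k * \<epsilon>}"
        have "?C \<subseteq> H k"
        proof (cases k)
          case 0
          then show ?thesis using V(2) by (auto simp: H_def)
        next
          case (Suc n)
          have "real n * \<epsilon> < real (Suc n) * \<epsilon>" using \<epsilon> by simp
          then show ?thesis using Suc by (auto simp: H_def)
        qed
        moreover have "compact ?C"
          using fcont by (intro compact_Int_closed K(1) closed_Collect_le) (auto intro!: continuous_intros)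
        ultimately have "(\<lambda>x. (1 / \<epsilon>) * s k x) \<in> compactly_supported (U \<inter> H k)"
          using K(2,3) \<epsilon> s_cs[of k] 
          by (intro compactly_supportedI[of _ ?C] continuous_intros compactly_supported_continuous[OF s_cs])
             (auto simp: s_def)
        then show ?thesis using s0 s1 \<epsilon> by (simp add: subordinate_def)
      qed
      then have "ennreal (L (\<lambda>x. (1 / \<epsilon>) * s k x)) \<le> ennreal (m k)"
        using open_mass_upper m_eq by metis
      then have "L (\<lambda>x. (1 / \<epsilon>) * s k x) \<le> m k" using m0 by (simp only: ennreal_le_iff)
      then show ?thesis
        unfolding scale[of k, symmetric] using \<epsilon> by (intro mult_left_mono) auto
    qed
    have low: "\<epsilon> * m (Suc (Suc k)) \<le> L (s k)" for k
    proof -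
      have "open_mass (H (Suc (Suc k))) \<le> ennreal (L (\<lambda>x. (1 / \<epsilon>) * s k x))"
        using s_eq s0 \<epsilon> by (intro open_mass_le_functional compactly_supported_cmult s_cs) auto
      moreover have "L (\<lambda>x. (1 / \<epsilon>) * s k x) \<ge> 0"
        using s0 \<epsilon> by (intro positive_linear_on_nonneg[OF L] compactly_supported_cmult s_cs) auto
      ultimately have "m (Suc (Suc k)) \<le> L (\<lambda>x. (1 / \<epsilon>) * s k x)"
        by (simp only: m_eq ennreal_le_iff)
      then show ?thesis
        unfolding scale[of k, symmetric] using \<epsilon> by (intro mult_left_mono) auto
    qed
    note int = integrable_compactly_supported[OF locally_finite_riesz_measure]
    have ind: "integrable ?\<mu> (\<lambda>x. \<epsilon> * indicator (H k) x)" "(\<integral>x. \<epsilon> * indicator (H k) x \<partial>?\<mu>) = \<epsilon> * m k" for k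
      using H_fin[of k] H_open[of k] by (auto simp: sets_riesz_measure m_def)
    have up': "(\<integral>x. s k x \<partial>?\<mu>) \<le> \<epsilon> * m k" for k
    proof -
      have "(\<integral>x. s k x \<partial>?\<mu>) \<le> (\<integral>x. \<epsilon> * indicator (H k) x \<partial>?\<mu>)"
      proof (rule integral_mono[OF int[OF s_cs] ind(1)])
        have "x \<notin> H k \<Longrightarrow> s k x = 0" for x using s_zero[of x k] H_sub[of k] by blast
        then show "s k x \<le> \<epsilon> * indicator (H k) x" for x
          using s1[of k x] by (cases "x \<in> H k") auto
      qed
      then show ?thesis by (simp only: ind(2))
    qed
    have low': "\<epsilon> * m (Suc (Suc k)) \<le> (\<integral>x. s k x \<partial>?\<mu>)" for k
    proof -
      have "(\<integral>x. \<epsilon> * indicator (H (Suc (Suc k))) x \<partial>?\<mu>) \<le> (\<integral>x. s k x \<partial>?\<mu>)"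
      proof (rule integral_mono[OF ind(1) int[OF s_cs]])
        show "\<epsilon> * indicator (H (Suc (Suc k))) x \<le> s k x" for x
          using s_eq[of x k] s0[of k x] by (cases "x \<in> H (Suc (Suc k))") auto
      qed
      then show ?thesis by (simp only: ind(2))
    qed
    have f_eq: "f = (\<lambda>x. \<Sum>k<N. s k x)" using sum_s N by (auto simp: min_def)
    have "L f = (\<Sum>k<N. L (s k))" by (subst f_eq) (simp add: riesz_sum s_cs)
    moreover have "(\<integral>x. f x \<partial>?\<mu>) = (\<Sum>k<N. \<integral>x. s k x \<partial>?\<mu>)"
      by (subst f_eq) (simp add: int s_cs)
    ultimately have "\<bar>L f - (\<integral>x. f x \<partial>?\<mu>)\<bar> = \<bar>\<Sum>k<N. L (s k) - (\<integral>x. s k x \<partial>?\<mu>)\<bar>"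
      by (simp add: sum_subtractf)
    also have "\<dots> \<le> (\<Sum>k<N. \<epsilon> * (m k - m (Suc (Suc k))))"
    proof (rule order_trans[OF sum_abs sum_mono])
      fix k
      show "\<bar>L (s k) - (\<integral>x. s k x \<partial>?\<mu>)\<bar> \<le> \<epsilon> * (m k - m (Suc (Suc k)))"
        using up[of k] up'[of k] low[of k] low'[of k] by (simp add: right_diff_distrib)
    qed
    \<comment> \<open>A telescope of step two leaves the first two masses, each at most that of V,
      minus the last two.\<close>
    also have "\<dots> = \<epsilon> * (m 0 + m 1 - m N - m (Suc N))"
      by (induction N) (simp_all add: algebra_simps)
    also have "\<dots> \<le> \<epsilon> * (2 * m 0)"
      using \<epsilon> m0[of N] m0[of "Suc N"] m_mono[of 0] by (intro mult_left_mono) auto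
    finally show ?thesis by (simp add: m_def H_def)
  qed
  have "\<bar>L f - (\<integral>x. f x \<partial>?\<mu>)\<bar> \<le> 0 + e" if "e > 0" for e
  proof -
    have "measure ?\<mu> V \<ge> 0" by simp
    then have "2 * measure ?\<mu> V + 1 > 0" by linarith
    then have "e / (2 * measure ?\<mu> V + 1) * (2 * measure ?\<mu> V) \<le> e"
      using that by (simp add: field_simps)
    then show ?thesis
      using main[of "e / (2 * measure ?\<mu> V + 1)"] that \<open>2 * measure ?\<mu> V + 1 > 0\<close> by simp
  qed
  then have "\<bar>L f - (\<integral>x. f x \<partial>?\<mu>)\<bar> \<le> 0" by (rule field_le_epsilon)
  then show ?thesis by simp
qed

lemma riesz_representation_measure:
  assumes f: "f \<in> compactly_supported U"
  shows "L f = (\<integral>x. f x \<partial>riesz_measure)"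
proof -
  obtain K where K: "compact K" "K \<subseteq> U" "\<And>x. x \<notin> K \<Longrightarrow> f x = 0"
    using f by (rule compactly_supportedE) blast
  have cont: "continuous_on UNIV f" by (rule compactly_supported_continuous[OF f])
  have pos: "(\<lambda>x. max (f x) 0) \<in> compactly_supported U"
    and neg: "(\<lambda>x. max (- f x) 0) \<in> compactly_supported U"
    using K cont by (auto intro!: compactly_supportedI[of _ K] continuous_intros)
  have eq: "f = (\<lambda>x. max (f x) 0 - max (- f x) 0)" by auto
  have "L f = L (\<lambda>x. max (f x) 0) - L (\<lambda>x. max (- f x) 0)"
    by (subst eq) (rule riesz_diff[OF pos neg])
  also have "\<dots> = (\<integral>x. max (f x) 0 \<partial>riesz_measure) - (\<integral>x. max (- f x) 0 \<partial>riesz_measure)"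
    by (simp add: riesz_representation_nonneg pos neg)
  also have "\<dots> = (\<integral>x. max (f x) 0 - max (- f x) 0 \<partial>riesz_measure)"
    using integrable_compactly_supported[OF locally_finite_riesz_measure pos]
      integrable_compactly_supported[OF locally_finite_riesz_measure neg] by simp
  also have "\<dots> = (\<integral>x. f x \<partial>riesz_measure)" using eq by metis
  finally show ?thesis .
qed

end

theorem riesz_representation:
  fixes U :: "(real^'n::finite) set"
  assumes "open U" "positive_linear_on (compactly_supported U) L"
  shows "\<exists>\<mu>. locally_finite_measure U \<mu> \<and> (\<forall>f\<in>compactly_supported U. L f = (\<integral>x. f x \<partial>\<mu>))"
  using locally_finite_riesz_measure[OF assms] riesz_representation_measure[OF assms] by blast

section \<open>Positive functionals on test functions\<close>

text \<open>Sends the perturbations by \<epsilon> to 0 when the sign of \<open>b\<close> is unknown: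
  were \<open>a\<close> positive, \<epsilon> = a / (2 (|b| + 1)) would give
  \<open>a \<le> a / 2\<close>.\<close>

lemma le_0_if_le_scaled:
  assumes "\<And>\<epsilon>::real. \<epsilon> > 0 \<Longrightarrow> a \<le> \<epsilon> * b"
  shows "a \<le> 0"
proof (rule ccontr)
  assume "\<not> a \<le> 0"
  have "a \<le> a / (2 * (\<bar>b\<bar> + 1)) * b" using \<open>\<not> a \<le> 0\<close> by (intro assms) simp
  also have "\<dots> \<le> a / (2 * (\<bar>b\<bar> + 1)) * (\<bar>b\<bar> + 1)"
    using \<open>\<not> a \<le> 0\<close> by (intro mult_left_mono) auto
  also have "\<dots> = a / 2"
  proof -
    have "a / (2 * c) * c = a / 2" if "c \<noteq> 0" for c using that by simp
    then show ?thesis by (smt (verit))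
  qed
  finally show False using \<open>\<not> a \<le> 0\<close> by simp
qed

definition linear_on_tests :: "(real^'n::finite) set \<Rightarrow> 'n distr \<Rightarrow> bool" where
  "linear_on_tests U D \<longleftrightarrow>
     (\<forall>f\<in>test_functions U. \<forall>g\<in>test_functions U. D (\<lambda>x. f x + g x) = D f + D g) \<and>
     (\<forall>f\<in>test_functions U. \<forall>c. D (\<lambda>x. c * f x) = c * D f)"

lemma linear_on_tests_add:
  "linear_on_tests U D \<Longrightarrow> f \<in> test_functions U \<Longrightarrow> g \<in> test_functions U \<Longrightarrow>
    D (\<lambda>x. f x + g x) = D f + D g"
  and linear_on_tests_cmult:
  "linear_on_tests U D \<Longrightarrow> f \<in> test_functions U \<Longrightarrow> D (\<lambda>x. c * f x) = c * D f"
  by (auto simp: linear_on_tests_def)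

lemma linear_on_tests_0: "linear_on_tests U D \<Longrightarrow> D (\<lambda>x. 0) = 0"
  using linear_on_tests_cmult[of U D "\<lambda>x. 0" 0] by simp

lemma linear_on_tests_diff:
  assumes "linear_on_tests U D" "f \<in> test_functions U" "g \<in> test_functions U"
  shows "D (\<lambda>x. f x - g x) = D f - D g"
  using linear_on_tests_add[OF assms(1,2) test_functions_cmult[OF assms(3), of "-1"]]
    linear_on_tests_cmult[OF assms(1,3), of "-1"] by simp

lemma linear_on_tests_sum:
  assumes "linear_on_tests U D" "\<And>i. i \<in> I \<Longrightarrow> f i \<in> test_functions U"
  shows "D (\<lambda>x. \<Sum>i\<in>I. f i x) = (\<Sum>i\<in>I. D (f i))"
  using assms(2)
  by (induction I rule: infinite_finite_induct)
     (auto simp: linear_on_tests_0[OF assms(1)] linear_on_tests_add[OF assms(1)] test_functions_sum)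

lemma positive_linear_on_imp_linear:
  "positive_linear_on (test_functions U) D \<Longrightarrow> linear_on_tests U D"
  by (auto simp: positive_linear_on_def linear_on_tests_def)

lemma positive_linear_on_mono:
  assumes "positive_linear_on (test_functions U) D" "f \<in> test_functions U" "g \<in> test_functions U"
    "\<And>x. f x \<le> g x"
  shows "D f \<le> D g"
  using linear_on_tests_diff[OF positive_linear_on_imp_linear[OF assms(1)] assms(3,2)]
    positive_linear_on_nonneg[OF assms(1) test_functions_diff[OF assms(3,2)]] assms(4) by simp

text \<open>Plays the role of the bound of an integral by supremum times mass: the value
  \<open>D \<phi>\<close> on a cutoff stands for the mass near the support.\<close>

lemma positive_linear_on_bound:
  assumes D: "positive_linear_on (test_functions U) D" "g \<in> test_functions U" "\<phi> \<in> test_functions U"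
    and "\<And>x. \<bar>g x\<bar> \<le> e * \<phi> x"
  shows "\<bar>D g\<bar> \<le> e * D \<phi>"
proof -
  note lin = positive_linear_on_imp_linear[OF D(1)]
  have "D g \<le> D (\<lambda>x. e * \<phi> x)"
    using assms(4) by (intro positive_linear_on_mono[OF D(1,2)] test_functions_cmult D(3)) (auto simp: abs_le_iff)
  moreover have "D (\<lambda>x. (-1) * g x) \<le> D (\<lambda>x. e * \<phi> x)"
    using assms(4) by (intro positive_linear_on_mono[OF D(1)] test_functions_cmult D) (auto simp: abs_le_iff)
  ultimately show ?thesis
    using linear_on_tests_cmult[OF lin D(3), of e] linear_on_tests_cmult[OF lin D(2), of "-1"]
    by (simp add: abs_le_iff)
qed

text \<open>A nonnegative test function need not have a smooth square root, but f + \<epsilon> has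
  one. Multiplied by a cutoff \<phi> equal to 1 on the support of f, it has the square f +
  \<epsilon> \<phi>^2, and \<epsilon> is sent to 0.\<close>

lemma positive_if_nonneg_on_squares:
  assumes U: "open U" and lin: "linear_on_tests U D"
    and sq: "\<And>f. f \<in> test_functions U \<Longrightarrow> D (\<lambda>x. f x * f x) \<ge> 0"
  shows "positive_linear_on (test_functions U) D"
proof -
  have "D f \<ge> 0" if f: "f \<in> test_functions U" and f0: "\<forall>x. f x \<ge> 0" for f
  proof -
    obtain K where K: "compact K" "K \<subseteq> U" "\<And>x. x \<notin> K \<Longrightarrow> f x = 0"
      using test_functions_compactly_supported[OF f] by (rule compactly_supportedE) blast
    obtain \<phi> V where \<phi>: "\<phi> \<in> test_functions U" "open V" "K \<subseteq> V" "\<And>x. x \<in> V \<Longrightarrow> \<phi> x = 1"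
      using smooth_cutoff[OF K(1) U K(2)] by metis
    have \<phi>2: "(\<lambda>x. \<phi> x * \<phi> x) \<in> test_functions U"
      by (intro test_functions_mult \<phi>(1) test_functions_smooth[OF \<phi>(1)])
    have "- D f \<le> \<epsilon> * D (\<lambda>x. \<phi> x * \<phi> x)" if \<epsilon>: "\<epsilon> > 0" for \<epsilon>
    proof -
      have pos: "f x + \<epsilon> > 0" for x using f0 \<epsilon> by (simp add: add_nonneg_pos)
      define g where "g x = (f x + \<epsilon>) powr (1 / 2) * \<phi> x" for x
      have g: "g \<in> test_functions U"
        unfolding g_def
        by (intro test_functions_mult \<phi>(1) smooth_powr pos smooth_add smooth_const test_functions_smooth[OF f])
      have "g x * g x = f x + \<epsilon> * (\<phi> x * \<phi> x)" for x
      proof -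
        have "(f x + \<epsilon>) powr (1 / 2) * (f x + \<epsilon>) powr (1 / 2) = f x + \<epsilon>"
          using pos[of x] by (simp flip: powr_add)
        then have "g x * g x = (f x + \<epsilon>) * (\<phi> x * \<phi> x)"
          unfolding g_def by (metis mult.assoc mult.commute)
        moreover have "f x * (\<phi> x * \<phi> x) = f x"
          using K(3)[of x] \<phi>(3,4) by (cases "x \<in> K") auto
        ultimately show ?thesis by (simp add: distrib_right)
      qed
      then have "0 \<le> D (\<lambda>x. f x + \<epsilon> * (\<phi> x * \<phi> x))" using sq[OF g] by simp
      also have "\<dots> = D f + \<epsilon> * D (\<lambda>x. \<phi> x * \<phi> x)"
        using linear_on_tests_add[OF lin f test_functions_cmult[OF \<phi>2]]
          linear_on_tests_cmult[OF lin \<phi>2] by simp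
      finally show ?thesis by simp
    qed
    then have "- D f \<le> 0" by (rule le_0_if_le_scaled)
    then show ?thesis by simp
  qed
  then show ?thesis using lin by (auto simp: positive_linear_on_def linear_on_tests_def)
qed

text \<open>Extends D from test functions to continuous functions, the setting of the Riesz theorem.
  For f in \<open>compactly_supported U\<close> and D positive, the supremum runs over a nonempty
  set bounded above, by \<open>test_function_squeeze\<close>.\<close>

definition upper_extension :: "(real^'n::finite) set \<Rightarrow> 'n distr \<Rightarrow> (real^'n \<Rightarrow> real) \<Rightarrow> real" where
  "upper_extension U D f = (SUP g\<in>{g\<in>test_functions U. \<forall>x. g x \<le> f x}. D g)"

context
  fixes U :: "(real^'n::finite) set" and D :: "'n distr"
  assumes U: "open U" and D: "positive_linear_on (test_functions U) D"
begin

lemma upper_extension_bounds: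
  assumes "g \<in> test_functions U" "g' \<in> test_functions U" "\<And>x. g x \<le> f x" "\<And>x. f x \<le> g' x"
  shows "D g \<le> upper_extension U D f" "upper_extension U D f \<le> D g'"
proof -
  have le: "D h \<le> D g'" if "h \<in> test_functions U" "\<forall>x. h x \<le> f x" for h
    using that assms by (intro positive_linear_on_mono[OF D]) (auto intro: order_trans)
  show "D g \<le> upper_extension U D f"
    unfolding upper_extension_def
    by (rule cSUP_upper) (use assms le in \<open>auto intro!: bdd_aboveI[of _ "D g'"]\<close>)
  show "upper_extension U D f \<le> D g'"
    unfolding upper_extension_def by (rule cSUP_least) (use assms le in auto)
qed

lemma test_function_squeeze:
  assumes f: "f \<in> compactly_supported U" and "e > 0"
  obtains g g' where "g \<in> test_functions U" "g' \<in> test_functions U" "\<And>x. g x \<le> f x" "\<And>x. f x \<le> g' x"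
    "D g' - D g \<le> e"
proof -
  obtain K where K: "compact K" "K \<subseteq> U" "\<And>x. x \<notin> K \<Longrightarrow> f x = 0"
    using f by (rule compactly_supportedE) blast
  obtain h L where L: "compact L" "L \<subseteq> U" and h: "\<And>k::nat. h k \<in> test_functions U"
    "\<And>k x. x \<notin> L \<Longrightarrow> h k x = 0" "uniform_limit UNIV h f sequentially"
    using smooth_approximation[OF U f] by metis
  have "compact (K \<union> L)" "K \<union> L \<subseteq> U" using K L by auto
  then obtain \<phi> V where \<phi>: "\<phi> \<in> test_functions U" "open V" "K \<union> L \<subseteq> V" "\<And>x. x \<in> V \<Longrightarrow> \<phi> x = 1"
    "\<And>x. 0 \<le> \<phi> x"
    using smooth_cutoff[of "K \<union> L" U] U by metis
  have D\<phi>: "D \<phi> \<ge> 0" by (rule positive_linear_on_nonneg[OF D \<phi>(1,5)])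
  \<comment> \<open>Under D the functions \<open>h k x - \<delta> * \<phi> x\<close> and
    \<open>h k x + \<delta> * \<phi> x\<close> differ by 2 \<delta> D \<phi>, which this choice
    makes at most e; the +1 guards against \<open>D \<phi> = 0\<close>.\<close>
  define \<delta> where "\<delta> = e / (2 * (D \<phi> + 1))"
  have "\<delta> > 0" using \<open>e > 0\<close> D\<phi> by (simp add: \<delta>_def)
  then obtain k where k: "\<And>x. dist (h k x) (f x) < \<delta>"
    using uniform_limitD[OF h(3)] unfolding eventually_sequentially by (metis UNIV_I order_refl)
  have le: "\<bar>h k x - f x\<bar> \<le> \<delta> * \<phi> x" for x
    using k[of x] h(2)[of x k] K(3)[of x] \<phi>(3) \<phi>(4,5)[of x] \<open>\<delta> > 0\<close>
    by (cases "x \<in> K \<union> L") (auto simp: dist_real_def)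
  note lin = positive_linear_on_imp_linear[OF D]
  have tf: "(\<lambda>x. \<delta> * \<phi> x) \<in> test_functions U" by (rule test_functions_cmult[OF \<phi>(1)])
  show ?thesis
  proof (rule that[of "\<lambda>x. h k x - \<delta> * \<phi> x" "\<lambda>x. h k x + \<delta> * \<phi> x"])
    show "(\<lambda>x. h k x - \<delta> * \<phi> x) \<in> test_functions U" by (rule test_functions_diff[OF h(1) tf])
    show "(\<lambda>x. h k x + \<delta> * \<phi> x) \<in> test_functions U" by (rule test_functions_add[OF h(1) tf])
    show "h k x - \<delta> * \<phi> x \<le> f x" "f x \<le> h k x + \<delta> * \<phi> x" for x
      using le[of x] by (auto simp: abs_le_iff)
    have "D (\<lambda>x. h k x + \<delta> * \<phi> x) - D (\<lambda>x. h k x - \<delta> * \<phi> x) = 2 * \<delta> * D \<phi>"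
      using linear_on_tests_diff[OF lin h(1) tf] linear_on_tests_add[OF lin h(1) tf]
        linear_on_tests_cmult[OF lin \<phi>(1)] by simp
    also have "\<dots> = e * (D \<phi> / (D \<phi> + 1))"
    proof -
      have "2 * (e / (2 * c)) * x = e * (x / c)" for c x :: real by simp
      then show ?thesis unfolding \<delta>_def .
    qed
    also have "\<dots> \<le> e * 1"
      using D\<phi> \<open>e > 0\<close> by (intro mult_left_mono) auto
    finally show "D (\<lambda>x. h k x + \<delta> * \<phi> x) - D (\<lambda>x. h k x - \<delta> * \<phi> x) \<le> e" by simp
  qed
qed

lemma upper_extension_eq: "f \<in> test_functions U \<Longrightarrow> upper_extension U D f = D f"
  using upper_extension_bounds[of f f f] by auto

text \<open>Both sides lie between the values of D on the sum of the two lower and on the sum of the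
  two upper squeezing functions, and these values differ by at most e.\<close>

lemma upper_extension_add:
  assumes f: "f \<in> compactly_supported U" and f': "f' \<in> compactly_supported U"
  shows "upper_extension U D (\<lambda>x. f x + f' x) = upper_extension U D f + upper_extension U D f'"
proof -
  let ?E = "upper_extension U D"
  note lin = positive_linear_on_imp_linear[OF D]
  have "\<bar>?E (\<lambda>x. f x + f' x) - (?E f + ?E f')\<bar> \<le> e" if "e > 0" for e
  proof -
    obtain g h where g: "g \<in> test_functions U" "h \<in> test_functions U" "\<And>x. g x \<le> f x" "\<And>x. f x \<le> h x"
      "D h - D g \<le> e / 2"
      using test_function_squeeze[OF f, of "e / 2"] \<open>e > 0\<close> by auto
    obtain g' h' where g': "g' \<in> test_functions U" "h' \<in> test_functions U" "\<And>x. g' x \<le> f' x" "\<And>x. f' x \<le> h' x"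
      "D h' - D g' \<le> e / 2"
      using test_function_squeeze[OF f', of "e / 2"] \<open>e > 0\<close> by auto
    have "D (\<lambda>x. g x + g' x) \<le> ?E (\<lambda>x. f x + f' x)" "?E (\<lambda>x. f x + f' x) \<le> D (\<lambda>x. h x + h' x)"
      using g g' by (auto intro!: upper_extension_bounds[of "\<lambda>x. g x + g' x" "\<lambda>x. h x + h' x"]
          test_functions_add add_mono)
    then show ?thesis
      using upper_extension_bounds[OF g(1-4)] upper_extension_bounds[OF g'(1-4)] g(5) g'(5)
        linear_on_tests_add[OF lin g(1) g'(1)] linear_on_tests_add[OF lin g(2) g'(2)]
      unfolding abs_le_iff by linarith
  qed
  then have "\<bar>?E (\<lambda>x. f x + f' x) - (?E f + ?E f')\<bar> \<le> 0"
    by (intro le_0_if_le_scaled[of _ 1]) auto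
  then show ?thesis by simp
qed

lemma upper_extension_cmult:
  assumes f: "f \<in> compactly_supported U"
  shows "upper_extension U D (\<lambda>x. c * f x) = c * upper_extension U D f"
proof -
  let ?E = "upper_extension U D"
  note lin = positive_linear_on_imp_linear[OF D]
  have "\<bar>?E (\<lambda>x. c * f x) - c * ?E f\<bar> \<le> e * \<bar>c\<bar>" if "e > 0" for e
  proof -
    obtain g h where g: "g \<in> test_functions U" "h \<in> test_functions U" "\<And>x. g x \<le> f x" "\<And>x. f x \<le> h x"
      "D h - D g \<le> e"
      using test_function_squeeze[OF f \<open>e > 0\<close>] by blast
    have tf: "(\<lambda>x. c * g x) \<in> test_functions U" "(\<lambda>x. c * h x) \<in> test_functions U"
      by (intro test_functions_cmult g)+
    note E = upper_extension_bounds[OF g(1-4)]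
    have gap: "\<bar>c\<bar> * (D h - D g) \<le> e * \<bar>c\<bar>"
      using mult_left_mono[OF g(5), of "\<bar>c\<bar>"] by (simp add: mult.commute)
    show ?thesis
    proof (cases "c \<ge> 0")
      case True
      have "c * D g \<le> ?E (\<lambda>x. c * f x)" "?E (\<lambda>x. c * f x) \<le> c * D h"
        using upper_extension_bounds[OF tf, of "\<lambda>x. c * f x"] True g(3,4)
          linear_on_tests_cmult[OF lin] g(1,2) by (auto simp: mult_left_mono)
      moreover have "c * D g \<le> c * ?E f" "c * ?E f \<le> c * D h"
        using E True by (auto simp: mult_left_mono)
      moreover have "c * D h - c * D g \<le> e * \<bar>c\<bar>" using gap True by (simp add: algebra_simps)
      ultimately show ?thesis unfolding abs_le_iff by linarith
    next
      case False
      have "c * D h \<le> ?E (\<lambda>x. c * f x)" "?E (\<lambda>x. c * f x) \<le> c * D g"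
        using upper_extension_bounds[OF tf(2,1), of "\<lambda>x. c * f x"] False g(3,4)
          linear_on_tests_cmult[OF lin] g(1,2) by (auto simp: mult_left_mono_neg)
      moreover have "c * D h \<le> c * ?E f" "c * ?E f \<le> c * D g"
        using E False by (auto simp: mult_left_mono_neg)
      moreover have "c * D g - c * D h \<le> e * \<bar>c\<bar>" using gap False by (simp add: algebra_simps)
      ultimately show ?thesis unfolding abs_le_iff by linarith
    qed
  qed
  then have "\<bar>?E (\<lambda>x. c * f x) - c * ?E f\<bar> \<le> 0" by (rule le_0_if_le_scaled)
  then show ?thesis by simp
qed

lemma upper_extension_positive: "positive_linear_on (compactly_supported U) (upper_extension U D)"
  unfolding positive_linear_on_def
proof (intro conjI ballI allI impI)
  fix f :: "real^'n \<Rightarrow> real"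
  assume f: "f \<in> compactly_supported U" and f0: "\<forall>x. f x \<ge> 0"
  obtain g h where "g \<in> test_functions U" and h: "h \<in> test_functions U"
    and "\<And>x. g x \<le> f x" and fh: "\<And>x. f x \<le> h x" and "D h - D g \<le> 1"
    by (rule test_function_squeeze[OF f zero_less_one]) (rule that)
  show "upper_extension U D f \<ge> 0"
    using upper_extension_bounds(1)[of "\<lambda>x. 0" h f] h fh f0
      linear_on_tests_0[OF positive_linear_on_imp_linear[OF D]] by simp
qed (auto simp: upper_extension_add upper_extension_cmult)

theorem positive_distribution_is_measure:
  "\<exists>\<mu>. locally_finite_measure U \<mu> \<and> (\<forall>f\<in>test_functions U. D f = (\<integral>x. f x \<partial>\<mu>))"
  using riesz_representation[OF U upper_extension_positive] upper_extension_eq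
    test_functions_compactly_supported by metis

end


section \<open>Products of continuous functions with measures\<close>

text \<open>\<open>u\<close> is continuous only on U and arbitrary elsewhere. The product is
  continuous on U and, being 0 there, on the complement of K; these two open sets cover the
  space.\<close>

lemma compactly_supported_mult_local:
  assumes "open U" "continuous_on U u" "f \<in> compactly_supported U"
  shows "(\<lambda>x. u x * f x) \<in> compactly_supported U"
proof -
  obtain K where K: "compact K" "K \<subseteq> U" "\<And>x. x \<notin> K \<Longrightarrow> f x = 0"
    using assms(3) by (rule compactly_supportedE) blast
  have "continuous_on (U \<union> - K) (\<lambda>x. u x * f x)"
  proof (rule continuous_on_open_Un[OF assms(1)])
    show "open (- K)" using K(1) by (simp add: compact_imp_closed open_Compl)
    show "continuous_on U (\<lambda>x. u x * f x)"
      by (intro continuous_on_mult assms(2) compactly_supported_continuous[OF assms(3)])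
    have "continuous_on (- K) (\<lambda>x. u x * f x) \<longleftrightarrow> continuous_on (- K) (\<lambda>x. 0 :: real)"
      by (rule continuous_on_cong) (use K(3) in auto)
    then show "continuous_on (- K) (\<lambda>x. u x * f x)" by simp
  qed
  moreover have "U \<union> - K = UNIV" using K(2) by auto
  ultimately show ?thesis
    using K by (intro compactly_supportedI[of _ K]) auto
qed

text \<open>\<open>distr_mult\<close> uses a pair of measures picked by \<open>SOME\<close>. R and Q
  show that such a pair exists, but the pair obtained need not represent R and Q separately; only
  the difference of its integrals is known, and only on test functions.\<close>

lemma represents_measure_difference:
  assumes "open U" "positive_linear_on (test_functions U) R" "positive_linear_on (test_functions U) Q"
    and "\<And>f. f \<in> test_functions U \<Longrightarrow> D f = R f - Q f"
  obtains \<mu> \<nu> where "represents_measure U D (\<mu>, \<nu>)"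
    "\<And>u f. distr_mult U u D f = (\<integral>x. u x * f x \<partial>\<mu>) - (\<integral>x. u x * f x \<partial>\<nu>)"
proof -
  obtain \<mu> \<nu> where "locally_finite_measure U \<mu>" "\<forall>f\<in>test_functions U. R f = (\<integral>x. f x \<partial>\<mu>)"
    "locally_finite_measure U \<nu>" "\<forall>f\<in>test_functions U. Q f = (\<integral>x. f x \<partial>\<nu>)"
    using positive_distribution_is_measure assms(1-3) by metis
  then have "represents_measure U D (\<mu>, \<nu>)" using assms(4) by (simp add: represents_measure_iff)
  then have "represents_measure U D (SOME m. represents_measure U D m)" by (rule someI)
  moreover obtain \<mu>' \<nu>' where "(SOME m. represents_measure U D m) = (\<mu>', \<nu>')" by (cases "SOME m. represents_measure U D m")
  ultimately show ?thesis using that[of \<mu>' \<nu>'] by (simp add: distr_mult_def)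
qed

text \<open>The chosen pair depends on D only through the predicate
  \<open>represents_measure U D\<close>, which sees D on test functions alone.\<close>

lemma distr_mult_cong:
  assumes "\<And>f. f \<in> test_functions U \<Longrightarrow> D f = D' f"
  shows "distr_mult U u D = distr_mult U u D'"
proof -
  have "represents_measure U D = represents_measure U D'"
    using assms by (auto simp: fun_eq_iff represents_measure_iff)
  then show ?thesis by (simp add: distr_mult_def)
qed

text \<open>The chosen measures can be much larger than R and Q, so integrating
  \<open>u x * f x - g x\<close> against them directly gives no useful bound. Test functions
  \<open>H k\<close> approximating this difference are bounded by \<open>e * \<phi> x\<close>; on
  them D = R - Q, so positivity bounds \<open>D (H k)\<close>, and the limit in k recovers the
  integrals.\<close>

lemma distr_mult_near:
  assumes U: "open U" and R: "positive_linear_on (test_functions U) R"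
    and Q: "positive_linear_on (test_functions U) Q"
    and D: "\<And>f. f \<in> test_functions U \<Longrightarrow> D f = R f - Q f"
    and u: "continuous_on U u" and f: "f \<in> test_functions U" and g: "g \<in> test_functions U"
    and \<phi>: "\<phi> \<in> test_functions U" "open V" "\<And>x. x \<in> V \<Longrightarrow> \<phi> x = 1" "\<And>x. 0 \<le> \<phi> x"
    and K: "compact K" "K \<subseteq> U" "K \<subseteq> V" "\<And>x. x \<notin> K \<Longrightarrow> f x = 0" "\<And>x. x \<notin> K \<Longrightarrow> g x = 0"
    and near: "\<And>x. \<bar>u x * f x - g x\<bar> \<le> e"
  shows "\<bar>distr_mult U u D f - D g\<bar> \<le> e * (R \<phi> + Q \<phi>)"
proof -
  obtain \<mu> \<nu> where rep: "represents_measure U D (\<mu>, \<nu>)"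
    and dm: "\<And>u f. distr_mult U u D f = (\<integral>x. u x * f x \<partial>\<mu>) - (\<integral>x. u x * f x \<partial>\<nu>)"
    using represents_measure_difference[OF U R Q D] by blast
  have \<mu>: "locally_finite_measure U \<mu>" and \<nu>: "locally_finite_measure U \<nu>"
    and rD: "\<And>f. f \<in> test_functions U \<Longrightarrow> D f = (\<integral>x. f x \<partial>\<mu>) - (\<integral>x. f x \<partial>\<nu>)"
    using rep by (auto simp: represents_measure_iff)
  define h where "h x = u x * f x - g x" for x
  have uf: "(\<lambda>x. u x * f x) \<in> compactly_supported U"
    by (rule compactly_supported_mult_local[OF U u test_functions_compactly_supported[OF f]])
  have hU: "h \<in> compactly_supported U"
    unfolding h_def by (rule compactly_supported_diff[OF uf test_functions_compactly_supported[OF g]])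
  \<comment> \<open>Approximating inside U \<inter> V keeps the supports of the \<open>H k\<close>
    where \<phi> is 1.\<close>
  then have h: "h \<in> compactly_supported (U \<inter> V)"
    using K by (intro compactly_supportedI[of _ K] compactly_supported_continuous[OF hU]) (auto simp: h_def)
  obtain H L where L: "compact L" "L \<subseteq> U \<inter> V" and H: "\<And>k::nat. H k \<in> test_functions (U \<inter> V)"
    "\<And>k x. x \<notin> L \<Longrightarrow> H k x = 0" "uniform_limit UNIV H h sequentially"
    "\<And>M k x. (\<And>x. \<bar>h x\<bar> \<le> M) \<Longrightarrow> \<bar>H k x\<bar> \<le> M"
    using smooth_approximation[OF open_Int[OF U \<phi>(2)] h] by metis
  have HU: "H k \<in> test_functions U" for k using H(1)[of k] test_functions_mono[of "U \<inter> V" U] by auto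
  have "(\<lambda>k. D (H k)) \<longlonglongrightarrow> (\<integral>x. h x \<partial>\<mu>) - (\<integral>x. h x \<partial>\<nu>)"
    unfolding rD[OF HU]
    using L H by (intro tendsto_diff uniform_limit_integral[OF \<mu> L(1)] uniform_limit_integral[OF \<nu> L(1)]
        test_functions_compactly_supported HU) auto
  also have "(\<integral>x. h x \<partial>\<mu>) - (\<integral>x. h x \<partial>\<nu>) = distr_mult U u D f - D g"
    unfolding h_def dm rD[OF g]
    using uf test_functions_compactly_supported[OF g] \<mu> \<nu> by (simp add: integrable_compactly_supported)
  finally have lim: "(\<lambda>k. D (H k)) \<longlonglongrightarrow> distr_mult U u D f - D g" .
  have "\<bar>D (H k)\<bar> \<le> e * (R \<phi> + Q \<phi>)" for k
  proof -
    have "\<bar>h x\<bar> \<le> e" for x using near by (simp add: h_def)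
    then have "\<bar>H k x\<bar> \<le> e" for x by (rule H(4))
    then have le: "\<bar>H k x\<bar> \<le> e * \<phi> x" for x
      using H(2)[of x k] L(2) \<phi>(3,4)[of x] near[of x] abs_ge_zero[of "u x * f x - g x"]
      by (cases "x \<in> L") (auto intro!: mult_nonneg_nonneg)
    show ?thesis
      using positive_linear_on_bound[OF R HU \<phi>(1) le] positive_linear_on_bound[OF Q HU \<phi>(1) le]
      by (simp add: D[OF HU] distrib_left)
  qed
  then show ?thesis
    by (intro tendsto_upperbound[OF tendsto_rabs[OF lim]]) auto
qed

lemma distr_mult_linear:
  assumes "open U" "positive_linear_on (test_functions U) R" "positive_linear_on (test_functions U) Q"
    and "\<And>f. f \<in> test_functions U \<Longrightarrow> D f = R f - Q f" and u: "continuous_on U u"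
  shows "linear_on_tests U (distr_mult U u D)"
proof -
  obtain \<mu> \<nu> where rep: "represents_measure U D (\<mu>, \<nu>)"
    and dm: "\<And>u f. distr_mult U u D f = (\<integral>x. u x * f x \<partial>\<mu>) - (\<integral>x. u x * f x \<partial>\<nu>)"
    using represents_measure_difference[OF assms(1-4)] by blast
  have int: "integrable \<mu> (\<lambda>x. u x * f x)" "integrable \<nu> (\<lambda>x. u x * f x)" if "f \<in> test_functions U" for f
    using rep compactly_supported_mult_local[OF assms(1) u test_functions_compactly_supported[OF that]]
    by (auto simp: represents_measure_iff integrable_compactly_supported)
  have "(\<integral>x. u x * (c * f x) \<partial>M) = c * (\<integral>x. u x * f x \<partial>M)" for c f and M :: "(real^'a) measure"
    by (simp add: mult.left_commute)
  then show ?thesis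
    using int by (simp add: linear_on_tests_def dm distrib_left right_diff_distrib)
qed

text \<open>A fixed test function \<open>g k\<close> close to the limit product mediates:
  \<open>Dj j (g k)\<close> converges, and each product is close to the value of its functional on
  \<open>g k\<close>. The masses \<open>Rj j \<phi> + Qj j \<phi>\<close> converge, hence are
  eventually bounded by a constant.\<close>

lemma distr_mult_tendsto:
  assumes U: "open U"
    and R: "\<And>j. positive_linear_on (test_functions U) (Rj j)" "positive_linear_on (test_functions U) R"
    and Q: "\<And>j. positive_linear_on (test_functions U) (Qj j)" "positive_linear_on (test_functions U) Q"
    and Dj: "\<And>j f. f \<in> test_functions U \<Longrightarrow> Dj j f = Rj j f - Qj j f"
    and D: "\<And>f. f \<in> test_functions U \<Longrightarrow> D f = R f - Q f"
    and R_lim: "\<And>f. f \<in> test_functions U \<Longrightarrow> (\<lambda>j. Rj j f) \<longlonglongrightarrow> R f"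
    and Q_lim: "\<And>f. f \<in> test_functions U \<Longrightarrow> (\<lambda>j. Qj j f) \<longlonglongrightarrow> Q f"
    and u: "\<And>j. continuous_on U (uj j)" "continuous_on U u"
    and u_lim: "locally_uniform_limit U uj u" and f: "f \<in> test_functions U"
  shows "(\<lambda>j. distr_mult U (uj j) (Dj j) f) \<longlonglongrightarrow> distr_mult U u D f"
proof -
  let ?h = "\<lambda>x. u x * f x"
  obtain K where K: "compact K" "K \<subseteq> U" "\<And>x. x \<notin> K \<Longrightarrow> f x = 0"
    using test_functions_compactly_supported[OF f] by (rule compactly_supportedE) blast
  have h: "?h \<in> compactly_supported U"
    by (rule compactly_supported_mult_local[OF U u(2) test_functions_compactly_supported[OF f]])
  obtain g L where L: "compact L" "L \<subseteq> U" and g: "\<And>k::nat. g k \<in> test_functions U"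
    "\<And>k x. x \<notin> L \<Longrightarrow> g k x = 0" "uniform_limit UNIV g ?h sequentially"
    using smooth_approximation[OF U h] by metis
  have KL: "compact (K \<union> L)" "K \<union> L \<subseteq> U" using K L by auto
  obtain \<phi> V where \<phi>: "\<phi> \<in> test_functions U" "open V" "K \<union> L \<subseteq> V" "\<And>x. x \<in> V \<Longrightarrow> \<phi> x = 1" "\<And>x. 0 \<le> \<phi> x"
    using smooth_cutoff[OF KL(1) U KL(2)] by metis
  obtain B where B: "B > 0" "\<And>x. \<bar>f x\<bar> \<le> B"
    using compactly_supported_bounded[OF test_functions_compactly_supported[OF f]] by blast
  define C where "C = R \<phi> + Q \<phi> + 1"
  have C: "C \<ge> 1"
    using positive_linear_on_nonneg[OF R(2) \<phi>(1,5)] positive_linear_on_nonneg[OF Q(2) \<phi>(1,5)] by (simp add: C_def)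
  have "(\<lambda>j. Rj j \<phi> + Qj j \<phi>) \<longlonglongrightarrow> R \<phi> + Q \<phi>"
    by (intro tendsto_add R_lim Q_lim \<phi>(1))
  then have ev_C: "\<forall>\<^sub>F j in sequentially. Rj j \<phi> + Qj j \<phi> < C"
    by (rule order_tendstoD) (simp add: C_def)
  show ?thesis
  proof (rule tendstoI)
    fix \<epsilon> :: real assume "\<epsilon> > 0"
    \<comment> \<open>The errors below are at most 2 \<epsilon>/9, \<epsilon>/9 and \<epsilon>/3,
      together less than \<epsilon>.\<close>
    define e where "e = \<epsilon> / (9 * C)"
    have e: "e > 0" "e * C = \<epsilon> / 9" using \<open>\<epsilon> > 0\<close> C by (auto simp: e_def)
    obtain k where k: "\<And>x. dist (g k x) (?h x) < e"
      using uniform_limitD[OF g(3) e(1)] unfolding eventually_sequentially by (metis UNIV_I order_refl)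
    have "(\<lambda>j. Dj j (g k)) \<longlonglongrightarrow> D (g k)"
      unfolding Dj[OF g(1)] D[OF g(1)] by (intro tendsto_diff R_lim Q_lim g(1))
    then have ev_D: "\<forall>\<^sub>F j in sequentially. dist (Dj j (g k)) (D (g k)) < \<epsilon> / 3"
      by (rule tendstoD) (use \<open>\<epsilon> > 0\<close> in simp)
    have ev_u: "\<forall>\<^sub>F j in sequentially. \<forall>x\<in>K. dist (uj j x) (u x) < e / B"
      using u_lim K e(1) B(1) by (intro uniform_limitD) (auto simp: locally_uniform_limit_def)
    have near: "\<bar>distr_mult U u D f - D (g k)\<bar> \<le> e * (R \<phi> + Q \<phi>)"
      by (rule distr_mult_near[OF U R(2) Q(2) D u(2) f g(1) \<phi>(1,2,4,5) KL \<phi>(3)])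
         (use K(3) g(2) k in \<open>auto simp: dist_real_def abs_minus_commute intro!: less_imp_le\<close>)
    from ev_C ev_D ev_u
    show "\<forall>\<^sub>F j in sequentially. dist (distr_mult U (uj j) (Dj j) f) (distr_mult U u D f) < \<epsilon>"
    proof eventually_elim
      case (elim j)
      have "\<bar>uj j x * f x - g k x\<bar> \<le> 2 * e" for x
      proof -
        have "\<bar>uj j x - u x\<bar> * \<bar>f x\<bar> \<le> e"
        proof (cases "x \<in> K")
          case True
          then have "\<bar>uj j x - u x\<bar> * \<bar>f x\<bar> \<le> e / B * B"
            using elim(3) B by (intro mult_mono) (auto simp: dist_real_def intro: less_imp_le)
          then show ?thesis using B(1) by simp
        qed (use K(3) e(1) in simp)
        then have "\<bar>uj j x * f x - u x * f x\<bar> \<le> e" by (simp add: abs_mult flip: left_diff_distrib)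
        then show ?thesis using k[of x] by (simp add: dist_real_def)
      qed
      then have "\<bar>distr_mult U (uj j) (Dj j) f - Dj j (g k)\<bar> \<le> 2 * e * (Rj j \<phi> + Qj j \<phi>)"
        by (intro distr_mult_near[OF U R(1) Q(1) Dj u(1) f g(1) \<phi>(1,2,4,5) KL \<phi>(3)])
           (use K(3) g(2) in auto)
      also have "\<dots> \<le> 2 * e * C" using e(1) elim(1) by (intro mult_left_mono) auto
      finally have 1: "\<bar>distr_mult U (uj j) (Dj j) f - Dj j (g k)\<bar> \<le> 2 * (\<epsilon> / 9)"
        using e(2) by simp
      have "e * (R \<phi> + Q \<phi>) \<le> e * C" using e(1) by (intro mult_left_mono) (auto simp: C_def)
      then have 2: "\<bar>distr_mult U u D f - D (g k)\<bar> \<le> \<epsilon> / 9" using near e(2) by simp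
      show ?case using 1 2 elim(2) \<open>\<epsilon> > 0\<close> unfolding dist_real_def by linarith
    qed
  qed
qed

section \<open>Smooth Cholesky factorisation\<close>

text \<open>Induction by elimination: the pivot \<open>A k k\<close> is strictly positive, so its
  inverse square root \<open>r\<close> is smooth; \<open>A k i x * r x\<close> is the new row, and
  the Schur complement \<open>A'\<close> is again positive definite.\<close>

lemma smooth_cholesky:
  fixes A :: "'i \<Rightarrow> 'i \<Rightarrow> real^'n::finite \<Rightarrow> real"
  assumes "finite I" and "\<And>i j. i \<in> I \<Longrightarrow> j \<in> I \<Longrightarrow> smooth (A i j)"
    and "\<And>i j x. i \<in> I \<Longrightarrow> j \<in> I \<Longrightarrow> A i j x = A j i x"
    and "\<And>x y. \<exists>i\<in>I. y i \<noteq> 0 \<Longrightarrow> 0 < (\<Sum>i\<in>I. \<Sum>j\<in>I. A i j x * y i * y j)"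
  shows "\<exists>c. (\<forall>k\<in>I. \<forall>i\<in>I. smooth (c k i)) \<and>
    (\<forall>x. \<forall>i\<in>I. \<forall>j\<in>I. A i j x = (\<Sum>k\<in>I. c k i x * c k j x))"
  using assms
proof (induction I arbitrary: A rule: finite_induct)
  case (insert k I)
  note sm = insert.prems(1) and sym = insert.prems(2) and pos = insert.prems(3)
  have Akk: "A k k x > 0" for x
  proof -
    have "0 < (\<Sum>i\<in>insert k I. \<Sum>j\<in>insert k I. A i j x * of_bool (i = k) * of_bool (j = k))"
      by (rule pos) auto
    also have "\<dots> = A k k x"
    proof -
      have "(\<Sum>i\<in>I. A i k x * of_bool (i = k)) = 0" "(\<Sum>j\<in>I. A i j x * of_bool (j = k)) = 0" for i
        using insert.hyps(2) by (auto intro!: sum.neutral)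
      then show ?thesis
        using insert.hyps by (simp add: sum.distrib mult.assoc flip: sum_distrib_left sum_distrib_right)
          (auto intro!: sum.neutral)
    qed
    finally show ?thesis .
  qed
  define r where "r x = A k k x powr (- 1 / 2)" for x
  have r: "smooth r" unfolding r_def by (rule smooth_powr[OF sm Akk]) auto
  have rr: "A k k x * (r x * r x) = 1" for x
  proof -
    have "r x * r x = A k k x powr (- 1)" by (simp add: r_def flip: powr_add)
    then show ?thesis using Akk[of x] by (simp add: powr_minus_divide)
  qed
  define A' where "A' i j x = A i j x - A k i x * A k j x * (r x * r x)" for i j x
  have "\<exists>c. (\<forall>k\<in>I. \<forall>i\<in>I. smooth (c k i)) \<and>
    (\<forall>x. \<forall>i\<in>I. \<forall>j\<in>I. A' i j x = (\<Sum>k\<in>I. c k i x * c k j x))"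
  proof (rule insert.IH)
    show "smooth (A' i j)" if "i \<in> I" "j \<in> I" for i j
      unfolding A'_def[abs_def] by (intro smooth_diff smooth_mult r sm) (use that in auto)
    show "A' i j x = A' j i x" if "i \<in> I" "j \<in> I" for i j x
      using sym[of i j x] that by (simp add: A'_def mult_ac)
    fix x and y :: "'i \<Rightarrow> real" assume y: "\<exists>i\<in>I. y i \<noteq> 0"
    define s where "s = (\<Sum>j\<in>I. A k j x * y j)"
    \<comment> \<open>The k-th coordinate minimises the form of A when the others are given by y; at
      this point the form equals that of the Schur complement at y.\<close>
    define z where "z i = (if i = k then - s * (r x * r x) else y i)" for i
    have zI: "z i = y i" if "i \<in> I" for i using that insert.hyps by (auto simp: z_def)
    have "0 < (\<Sum>i\<in>insert k I. \<Sum>j\<in>insert k I. A i j x * z i * z j)"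
      by (rule pos) (use y zI in auto)
    also have "\<dots> = A k k x * z k * z k + (\<Sum>j\<in>I. A k j x * z k * y j) +
       (\<Sum>i\<in>I. A i k x * y i * z k) + (\<Sum>i\<in>I. \<Sum>j\<in>I. A i j x * y i * y j)"
      using insert.hyps by (simp add: sum.distrib zI cong: sum.cong)
    also have "(\<Sum>j\<in>I. A k j x * z k * y j) = z k * s"
      by (simp add: s_def sum_distrib_left mult_ac)
    also have "(\<Sum>i\<in>I. A i k x * y i * z k) = z k * s"
    proof -
      have "(\<Sum>i\<in>I. A i k x * y i * z k) = (\<Sum>i\<in>I. z k * (A k i x * y i))"
        using sym[of _ k x] by (intro sum.cong) auto
      then show ?thesis by (simp add: s_def sum_distrib_left)
    qed
    also have "A k k x * z k * z k = - (z k * s) * (A k k x * (r x * r x))"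
      by (simp add: z_def mult_ac)
    also have "- (z k * s) * (A k k x * (r x * r x)) + z k * s + z k * s +
       (\<Sum>i\<in>I. \<Sum>j\<in>I. A i j x * y i * y j) = (\<Sum>i\<in>I. \<Sum>j\<in>I. A' i j x * y i * y j)"
    proof -
      have "(\<Sum>i\<in>I. \<Sum>j\<in>I. A k i x * A k j x * (r x * r x) * y i * y j) = (r x * r x) * (s * s)"
        unfolding s_def sum_product by (simp add: sum_distrib_left mult_ac)
      moreover have "z k * s = - ((r x * r x) * (s * s))" by (simp add: z_def mult_ac)
      ultimately show ?thesis
        unfolding A'_def left_diff_distrib sum_subtractf rr by simp
    qed
    finally show "0 < (\<Sum>i\<in>I. \<Sum>j\<in>I. A' i j x * y i * y j)" .
  qed
  then obtain c where c: "\<And>l i. l \<in> I \<Longrightarrow> i \<in> I \<Longrightarrow> smooth (c l i)"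
    "\<And>x i j. i \<in> I \<Longrightarrow> j \<in> I \<Longrightarrow> A' i j x = (\<Sum>l\<in>I. c l i x * c l j x)" by blast
  define c' where "c' l i = (if l = k then (\<lambda>x. A k i x * r x) else if i = k then (\<lambda>x. 0) else c l i)" for l i
  show ?case
  proof (intro exI[of _ c'] conjI ballI allI)
    show "smooth (c' l i)" if "l \<in> insert k I" "i \<in> insert k I" for l i
      using that c(1) by (auto simp: c'_def intro!: smooth_mult sm r)
    fix x i j assume ij: "i \<in> insert k I" "j \<in> insert k I"
    have "(\<Sum>l\<in>insert k I. c' l i x * c' l j x) =
       A k i x * A k j x * (r x * r x) + (\<Sum>l\<in>I. c' l i x * c' l j x)"
      using insert.hyps by (simp add: c'_def mult_ac)
    also have "\<dots> = A i j x"
    proof (cases "i = k \<or> j = k")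
      case True
      then have "(\<Sum>l\<in>I. c' l i x * c' l j x) = 0"
        using insert.hyps by (intro sum.neutral) (auto simp: c'_def)
      moreover have "A k i x * A k j x * (r x * r x) = A i j x"
      proof (cases "i = k")
        case True
        then have "A k i x * A k j x * (r x * r x) = A k j x * (A k k x * (r x * r x))" by (simp add: mult_ac)
        then show ?thesis using rr True by simp
      next
        case False
        then have "j = k" using \<open>i = k \<or> j = k\<close> by simp
        then have "A k i x * A k j x * (r x * r x) = A k i x * (A k k x * (r x * r x))" by (simp add: mult_ac)
        then show ?thesis using rr \<open>j = k\<close> sym[of k i x] ij by simp
      qed
      ultimately show ?thesis by simp
    next
      case False
      then have "(\<Sum>l\<in>I. c' l i x * c' l j x) = (\<Sum>l\<in>I. c l i x * c l j x)"
        using insert.hyps by (intro sum.cong) (auto simp: c'_def)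
      then show ?thesis using c(2)[of i j x] ij False by (simp add: A'_def)
    qed
    finally show "A i j x = (\<Sum>l\<in>insert k I. c' l i x * c' l j x)" ..
  qed
qed auto


section \<open>Mollified convex functions\<close>

text \<open>Were the second derivative of w along y negative, then \<open>G'\<close>, which is 0 at
  0, would be negative just after 0, and the mean value theorem would make the symmetric second
  difference \<open>G\<close> negative there.\<close>

lemma hessian_nonneg:
  fixes w :: "real^'n::finite \<Rightarrow> real"
  assumes w: "smooth w" and "\<delta> > 0"
    and sd: "\<And>s. 0 < s \<Longrightarrow> s < \<delta> \<Longrightarrow> 2 * w x \<le> w (x + s *\<^sub>R y) + w (x - s *\<^sub>R y)"
  shows "0 \<le> (\<Sum>i\<in>UNIV. \<Sum>j\<in>UNIV. partial_x j (partial_x i w) x * y $ i * y $ j)"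
proof (rule ccontr)
  let ?H = "\<Sum>i\<in>UNIV. \<Sum>j\<in>UNIV. partial_x j (partial_x i w) x * y $ i * y $ j"
  assume "\<not> 0 \<le> ?H"
  define g where "g z s = (\<Sum>i\<in>UNIV. z $ i * partial_x i w (x + s *\<^sub>R z))" for z s
  define G where "G s = w (x + s *\<^sub>R y) + w (x + s *\<^sub>R (- y)) - 2 * w x" for s
  define G' where "G' s = g y s + g (- y) s" for s
  have G: "(G has_real_derivative G' s) (at s)" for s
    unfolding G_def G'_def g_def
    by (rule derivative_eq_intros smooth_along_line[OF w] refl)+ simp
  have g': "(g z has_real_derivative
      (\<Sum>i\<in>UNIV. z $ i * (\<Sum>j\<in>UNIV. z $ j * partial_x j (partial_x i w) (x + s *\<^sub>R z)))) (at s)" for z s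
    unfolding g_def by (intro DERIV_sum DERIV_cmult smooth_along_line smooth_partial w)
  have "(G' has_real_derivative 2 * ?H) (at 0)"
  proof -
    have "(\<Sum>i\<in>UNIV. z $ i * (\<Sum>j\<in>UNIV. z $ j * partial_x j (partial_x i w) (x + 0 *\<^sub>R z))) = ?H"
      if "z = y \<or> z = - y" for z
      using that by (auto simp: sum_distrib_left mult_ac intro!: sum.cong)
    from DERIV_add[OF g'[of y 0] g'[of "- y" 0], unfolded this[OF disjI1[OF refl]] this[OF disjI2[OF refl]]]
    show ?thesis unfolding G'_def mult_2 .
  qed
  then obtain d where d: "d > 0" "\<And>h. 0 < h \<Longrightarrow> h < d \<Longrightarrow> G' h < G' 0"
    using DERIV_neg_dec_right[of G' "2 * ?H" 0] \<open>\<not> 0 \<le> ?H\<close> by auto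
  have "G' 0 = 0" by (simp add: G'_def g_def sum_negf)
  define s where "s = min d \<delta> / 2"
  have s: "0 < s" "s < d" "s < \<delta>" using d(1) \<open>\<delta> > 0\<close> by (auto simp: s_def)
  obtain z where z: "0 < z" "z < s" "G s - G 0 = (s - 0) * G' z"
    using MVT2[OF s(1), of G G'] G by blast
  have "G s < 0" using z s d(2)[of z] \<open>G' 0 = 0\<close> by (simp add: G_def mult_pos_neg)
  moreover have "G s \<ge> 0" using sd[OF s(1,3)] by (simp add: G_def)
  ultimately show False by simp
qed

lemma convex_function_on_midpoint:
  assumes "convex_function_on U v" "ball x r \<subseteq> U" "norm y < r"
  shows "2 * v x \<le> v (x + y) + v (x - y)"
proof -
  have "convex_on (ball x r) v" using assms(1,2) by (simp add: convex_function_on_def)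
  moreover have "x + y \<in> ball x r" "x - y \<in> ball x r" using assms(3) by (auto simp: dist_norm)
  ultimately have "v ((1 - 1 / 2) *\<^sub>R (x + y) + (1 / 2) *\<^sub>R (x - y)) \<le> (1 - 1 / 2) * v (x + y) + 1 / 2 * v (x - y)"
    by (intro convex_onD) auto
  moreover have "(1 - 1 / 2) *\<^sub>R (x + y) + (1 / 2) *\<^sub>R (x - y) = x"
    by (simp add: scaleR_add_right scaleR_diff_right flip: scaleR_add_left)
  ultimately show ?thesis by simp
qed

lemma convex_function_on_continuous:
  assumes "open U" "convex_function_on U v"
  shows "continuous_on U v"
proof (rule continuous_at_imp_continuous_on, rule ballI)
  fix x assume "x \<in> U"
  then obtain r where r: "r > 0" "ball x r \<subseteq> U" using assms(1) openE by blast
  have "continuous_on (ball x r) v"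
    using assms(2) r(2) by (intro convex_on_continuous) (auto simp: convex_function_on_def)
  then show "isCont v x" using r(1) by (simp add: continuous_on_eq_continuous_at)
qed

text \<open>Since v is controlled only on U, a cut-off function \<open>h\<close> is mollified in its
  place. It agrees with v near K but need not be convex, so midpoint convexity survives the
  averaging only close to K, whence the neighbourhood W.\<close>

lemma convex_smooth_approximation:
  fixes v :: "real^'n::finite \<Rightarrow> real"
  assumes U: "open U" and v: "convex_function_on U v" and K: "compact K" "K \<subseteq> U"
  obtains w W where "open W" "K \<subseteq> W" "\<And>k::nat. smooth (w k)" "uniform_limit K w v sequentially"
    "\<And>k x y. x \<in> W \<Longrightarrow> 0 \<le> (\<Sum>i\<in>UNIV. \<Sum>j\<in>UNIV. partial_x j (partial_x i (w k)) x * y $ i * y $ j)"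
proof -
  obtain \<theta> V where \<theta>: "\<theta> \<in> test_functions U" "open V" "K \<subseteq> V" "V \<subseteq> U" "\<And>x. x \<in> V \<Longrightarrow> \<theta> x = 1"
    using smooth_cutoff[OF K(1) U K(2)] by metis
  define h where "h x = v x * \<theta> x" for x
  have h: "h \<in> compactly_supported U"
    unfolding h_def
    by (intro compactly_supported_mult_local[OF U] convex_function_on_continuous U v
          test_functions_compactly_supported \<theta>(1))
  have hv: "h x = v x" if "x \<in> V" for x using \<theta>(5)[OF that] by (simp add: h_def)
  obtain e where e: "e > 0" "(\<Union>x\<in>K. ball x e) \<subseteq> V"
    using compact_subset_open_imp_ball_epsilon_subset[OF K(1) \<theta>(2,3)] by blast
  \<comment> \<open>Three distances have to add up to less than e: from K to a point of W, the shift
    z by the mollifier, and the increment y. Each gets e/3.\<close>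
  define r where "r k = e / 3 / real (Suc k)" for k
  have r0: "r k > 0" "r k \<le> e / 3" for k using e(1) by (auto simp: r_def field_simps)
  have "\<forall>k. \<exists>\<rho> :: real^'n \<Rightarrow> real. mollifier (r k) \<rho>" using exists_mollifier[OF r0(1)] by blast
  then obtain \<rho> :: "nat \<Rightarrow> real^'n \<Rightarrow> real" where \<rho>: "\<And>k. mollifier (r k) (\<rho> k)"
    unfolding choice_iff by blast
  define W where "W = (\<Union>x\<in>K. ball x (e / 3))"
  have second: "2 * convolution h (\<rho> k) x \<le> convolution h (\<rho> k) (x + y) + convolution h (\<rho> k) (x - y)"
    if "x \<in> W" "norm y < e / 3" for k x y
  proof -
    have cont: "continuous_on UNIV (\<rho> k)" using \<rho>[of k] by (auto simp: mollifier_def intro: smooth_continuous)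
    have int: "integrable lborel (\<lambda>z. h (x' - z) * \<rho> k z)" for x'
      by (rule mollifier_shift_integrable[OF h \<rho>])
    have "(\<integral>z. 2 * (h (x - z) * \<rho> k z) \<partial>lborel) \<le>
       (\<integral>z. h (x + y - z) * \<rho> k z + h (x - y - z) * \<rho> k z \<partial>lborel)"
    proof (rule integral_mono)
      fix z
      show "2 * (h (x - z) * \<rho> k z) \<le> h (x + y - z) * \<rho> k z + h (x - y - z) * \<rho> k z"
      proof (cases "norm z > r k")
        case True
        then show ?thesis using \<rho>[of k] by (simp add: mollifier_def)
      next
        case False
        obtain x0 where x0: "x0 \<in> K" "dist x0 x < e / 3" using \<open>x \<in> W\<close> by (auto simp: W_def)
        have sub: "ball (x - z) (e / 3) \<subseteq> V"
        proof
          fix t assume "t \<in> ball (x - z) (e / 3)"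
          then have "dist x0 t < e"
            using x0(2) False r0(2)[of k] dist_triangle[of x0 t x] dist_triangle[of x t "x - z"]
            by (simp add: dist_norm)
          then have "t \<in> ball x0 e" by simp
          then show "t \<in> V" using e(2) x0(1) by blast
        qed
        have "2 * v (x - z) \<le> v ((x - z) + y) + v ((x - z) - y)"
          using sub \<theta>(4) that(2) by (intro convex_function_on_midpoint[OF v]) auto
        moreover have "x - z \<in> V" "(x - z) + y \<in> V" "(x - z) - y \<in> V"
          using sub that(2) e(1) by (auto intro!: subsetD[OF sub] simp: dist_norm)
        ultimately have "2 * h (x - z) \<le> h ((x - z) + y) + h ((x - z) - y)" by (simp add: hv)
        then have "2 * h (x - z) \<le> h (x + y - z) + h (x - y - z)" by (simp add: algebra_simps)
        then have "2 * h (x - z) * \<rho> k z \<le> (h (x + y - z) + h (x - y - z)) * \<rho> k z"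
          using \<rho>[of k] by (intro mult_right_mono) (auto simp: mollifier_def)
        then show ?thesis by (simp add: distrib_right)
      qed
    qed (use int in auto)
    then show ?thesis using int by (simp add: convolution_commute[OF h cont])
  qed
  show ?thesis
  proof (rule that[of W "\<lambda>k. convolution h (\<rho> k)"])
    show "open W" by (auto simp: W_def)
    show "K \<subseteq> W" using e(1) by (auto simp: W_def)
    show sm: "smooth (convolution h (\<rho> k))" for k
      by (rule smooth_convolution[OF h mollifier_test_function[OF \<rho>]])
    show "uniform_limit K (\<lambda>k. convolution h (\<rho> k)) v sequentially"
    proof (rule uniform_limitI)
      fix \<epsilon> :: real assume "\<epsilon> > 0"
      obtain d where d: "d > 0" "\<And>r \<rho> x. mollifier r \<rho> \<Longrightarrow> r < d \<Longrightarrow> \<bar>convolution h \<rho> x - h x\<bar> < \<epsilon>"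
        using convolution_close[OF h \<open>\<epsilon> > 0\<close>] by blast
      have "r = (\<lambda>k. e / 3 * inverse (real (Suc k)))"
        unfolding r_def by (simp only: divide_inverse)
      then have "r \<longlonglongrightarrow> 0"
        using tendsto_mult_left[OF LIMSEQ_inverse_real_of_nat, of "e / 3"] by (simp only: mult_zero_right)
      then have "\<forall>\<^sub>F k in sequentially. r k < d" using d(1) by (simp add: order_tendstoD)
      then show "\<forall>\<^sub>F k in sequentially. \<forall>x\<in>K. dist (convolution h (\<rho> k) x) (v x) < \<epsilon>"
      proof eventually_elim
        case (elim k)
        show ?case
        proof
          fix x assume "x \<in> K"
          then have "h x = v x" using \<theta>(3) by (intro hv) auto
          then show "dist (convolution h (\<rho> k) x) (v x) < \<epsilon>"
            using d(2)[OF \<rho> elim, of x] by (simp add: dist_real_def)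
        qed
      qed
    qed
    fix k x and y :: "real^'n" assume "x \<in> W"
    have "e / 3 / (norm y + 1) > 0" using e(1) by (simp add: add_nonneg_pos)
    moreover have "norm (s *\<^sub>R y) < e / 3" if "0 < s" "s < e / 3 / (norm y + 1)" for s
    proof -
      have "norm (s *\<^sub>R y) \<le> s * (norm y + 1)" using that(1) by simp
      also have "\<dots> < e / 3"
      proof -
        have "norm y + 1 > 0" by (simp add: add_nonneg_pos)
        from that(2)[unfolded pos_less_divide_eq[OF this]] show ?thesis .
      qed
      finally show ?thesis .
    qed
    ultimately show "0 \<le> (\<Sum>i\<in>UNIV. \<Sum>j\<in>UNIV. partial_x j (partial_x i (convolution h (\<rho> k))) x * y $ i * y $ j)"
      using second[OF \<open>x \<in> W\<close>] by (intro hessian_nonneg[OF sm, of "e / 3 / (norm y + 1)"]) auto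
  qed
qed

section \<open>Positive closed currents\<close>

text \<open>
  In terms of the signed matrix \<open>\<tau> \<epsilon>\<^sub>K \<epsilon>\<^sub>L S\<^sub>K\<^sub>L\<close> of coefficients, with \<open>\<epsilon>\<^sub>K\<close> the sign of
  \<open>dx\<^sub>K \<and> dx\<^sub>-\<^sub>K\<close>, positivity of a current of bidegree \<open>(m, m)\<close> is nonnegativity of the quadratic
  form \<open>(a\<^sub>K) \<mapsto> \<Sum> \<tau> \<epsilon>\<^sub>K \<epsilon>\<^sub>L S\<^sub>K\<^sub>L(a\<^sub>K a\<^sub>L)\<close>.
\<close>

definition total_sign :: "'n::finite itself \<Rightarrow> nat \<Rightarrow> real" where
  "total_sign _ m = sigma_sign CARD('n) * sigma_sign (CARD('n) - m) * (-1) ^ (m * (CARD('n) - m))"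

definition compl_sign :: "'n::{finite,linorder} set \<Rightarrow> real" where
  "compl_sign K = shuffle_sign K (- K)"

text \<open>For \<open>i \<in> K\<close>, the sign in dx_i \<and> dx_(K - {i}) =
  \<open>insert_sign i K\<close> dx_K.\<close>

definition insert_sign :: "'n::{finite,linorder} \<Rightarrow> 'n set \<Rightarrow> real" where
  "insert_sign i K = shuffle_sign {i} (K - {i})"

abbreviation index_sets :: "nat \<Rightarrow> 'n::finite set set" where
  "index_sets m \<equiv> {K. card K = m}"

definition quadratic_form :: "nat \<Rightarrow> 'n::{finite,linorder} current \<Rightarrow> ('n set \<Rightarrow> real^'n::{finite,linorder} \<Rightarrow> real) \<Rightarrow> real" where
  "quadratic_form m S a = (\<Sum>K\<in>index_sets m. \<Sum>L\<in>index_sets m.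
     total_sign TYPE('n) m * compl_sign K * compl_sign L * S K L (\<lambda>x. a K x * a L x))"

text \<open>The induction invariant. It is indexed by the bidegree m, which grows by one with each
  factor dd# v, and its positivity is stated on coefficients rather than test forms.\<close>

definition positive_closed :: "(real^'n::{finite,linorder}) set \<Rightarrow> nat \<Rightarrow> 'n current \<Rightarrow> bool" where
  "positive_closed U m S \<longleftrightarrow>
     (\<forall>K L. linear_on_tests U (S K L)) \<and>
     (\<forall>K L. card K \<noteq> m \<or> card L \<noteq> m \<longrightarrow> (\<forall>f\<in>test_functions U. S K L f = 0)) \<and>
     symmetric_current U S \<and> closed_current U S \<and>
     (\<forall>a. (\<forall>K. a K \<in> test_functions U) \<longrightarrow> 0 \<le> quadratic_form m S a)"

section \<open>Signs, and the operators d and d# on coefficients\<close>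

lemma sign_cases: "(- 1 :: real) ^ k = 1 \<or> (- 1 :: real) ^ k = - 1"
  by (cases "even k") auto

lemma sign_square: "((- 1) ^ k * (- 1) ^ k :: real) = 1"
  by (simp flip: power_add)

lemma compl_sign_square [simp]: "compl_sign K * compl_sign K = 1"
  by (simp add: compl_sign_def shuffle_sign_def sign_square)

lemma total_sign_cases: "total_sign (TYPE('n::finite)) m = 1 \<or> total_sign TYPE('n) m = - 1"
  using sign_cases unfolding total_sign_def sigma_sign_def by (metis (no_types) mult_1 mult_minus1 minus_minus)

lemma sigma_sign_Suc: "sigma_sign (Suc k) = (-1) ^ k * sigma_sign k"
proof -
  have "Suc k * (Suc k - 1) div 2 = k + k * (k - 1) div 2"
  proof (cases k)
    case (Suc l)
    have "Suc k * (Suc k - 1) = 2 * k + k * (k - 1)" using Suc by (simp add: algebra_simps)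
    then show ?thesis by simp
  qed simp
  then show ?thesis by (simp add: sigma_sign_def power_add)
qed

text \<open>Moving d\<xi>_j past m factors dx produces the sign (-1)^m in
  \<open>ddsharp_current_eq\<close>. It is exactly the change of the total sign from m to m + 1, so
  wedging with dd# v leaves no sign in the quadratic form.\<close>

lemma total_sign_Suc:
  assumes "Suc m \<le> CARD('n::finite)"
  shows "total_sign TYPE('n) (Suc m) * (-1) ^ m = total_sign TYPE('n) m"
proof -
  obtain k where k: "CARD('n) = Suc (m + k)" using assms by (metis le_Suc_ex add_Suc)
  then have "CARD('n) - m = Suc k" "CARD('n) - Suc m = k" by auto
  then show ?thesis
    unfolding total_sign_def by (simp add: sigma_sign_Suc power_add mult_ac)
qed

lemma wedge_sign_insert_x: "wedge_sign {i} {} K L = shuffle_sign {i} K"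
  by (simp add: wedge_sign_def shuffle_sign_def)

lemma wedge_sign_insert_xi: "wedge_sign {} {j} K L = (-1) ^ card K * shuffle_sign {j} L"
  by (simp add: wedge_sign_def shuffle_sign_def)

lemma d_current_eq:
  "d_current S K L f = - (\<Sum>i\<in>K. insert_sign i K * S (K - {i}) L (partial_x i f))"
  by (simp add: d_current_def distr_partial_def wedge_sign_insert_x insert_sign_def sum_negf)

lemma dsharp_current_eq:
  "dsharp_current S K L f = - ((-1) ^ card K * (\<Sum>j\<in>L. insert_sign j L * S K (L - {j}) (partial_x j f)))"
  by (simp add: dsharp_current_def distr_partial_def wedge_sign_insert_xi insert_sign_def sum_negf
      sum_distrib_left mult_ac)

text \<open>The two minus signs of the distributional derivatives cancel; the remaining power of -1
  comes from moving d\<xi>_j past the dx-factors of \<open>K - {i}\<close>.\<close>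

lemma ddsharp_current_eq:
  "d_current (dsharp_current S) K L f = (-1) ^ (card K - 1) *
    (\<Sum>i\<in>K. \<Sum>j\<in>L. insert_sign i K * insert_sign j L *
      S (K - {i}) (L - {j}) (partial_x j (partial_x i f)))"
proof -
  have "d_current (dsharp_current S) K L f =
     (\<Sum>i\<in>K. insert_sign i K * ((-1) ^ card (K - {i}) *
       (\<Sum>j\<in>L. insert_sign j L * S (K - {i}) (L - {j}) (partial_x j (partial_x i f)))))"
    unfolding d_current_eq dsharp_current_eq by (simp add: sum_negf)
  also have "\<dots> = (\<Sum>i\<in>K. (-1) ^ (card K - 1) * (\<Sum>j\<in>L. insert_sign i K * insert_sign j L *
      S (K - {i}) (L - {j}) (partial_x j (partial_x i f))))"
    by (intro sum.cong) (simp_all add: sum_distrib_left mult_ac)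
  finally show ?thesis by (simp add: sum_distrib_left)
qed

text \<open>Antisymmetry of dx_i \<and> dx_k. For i < k, removing i lowers the number of elements
  below k by one, while removing k leaves the number below i unchanged.\<close>

lemma insert_sign_anticommute:
  fixes K :: "'n::{finite,linorder} set"
  assumes "i \<in> K" "k \<in> K" "i \<noteq> k"
  shows "insert_sign k K * insert_sign i (K - {k}) = - (insert_sign i K * insert_sign k (K - {i}))"
proof -
  have eq: "insert_sign i A = (-1) ^ card {b\<in>A. b < i}" for i and A :: "'n set"
  proof -
    have "{(a, b). a \<in> {i} \<and> b \<in> A - {i} \<and> b < a} = (\<lambda>b. (i, b)) ` {b\<in>A. b < i}" by auto
    then have "card {(a, b). a \<in> {i} \<and> b \<in> A - {i} \<and> b < a} = card {b\<in>A. b < i}"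
      by (simp add: card_image inj_on_def)
    then show ?thesis by (simp add: insert_sign_def shuffle_sign_def)
  qed
  have main: "insert_sign k K * insert_sign i (K - {k}) = - (insert_sign i K * insert_sign k (K - {i}))"
    if "i < k" "i \<in> K" "k \<in> K" for i k
  proof -
    have "{b\<in>K. b < k} = insert i {b\<in>K - {i}. b < k}" using that by auto
    moreover have "i \<notin> {b\<in>K - {i}. b < k}" by simp
    ultimately have "card {b\<in>K. b < k} = Suc (card {b\<in>K - {i}. b < k})"
      by (metis card_insert_disjoint finite)
    moreover have "{b\<in>K - {k}. b < i} = {b\<in>K. b < i}" using that by auto
    ultimately show ?thesis by (simp add: eq)
  qed
  show ?thesis
  proof (cases "i < k")
    case True
    then show ?thesis using main assms by blast
  next
    case False
    then have "k < i" using assms(3) by simp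
    then show ?thesis using main[of k i] assms by simp
  qed
qed

text \<open>A sign antisymmetric in the two removed indices meets a second derivative symmetric in
  them. As S is arbitrary here, closedness of every dd# image follows at once.\<close>

lemma d_d_current:
  assumes "smooth f"
  shows "d_current (d_current S) K L f = 0"
proof -
  define F where "F k i = insert_sign k K * insert_sign i (K - {k}) *
     S (K - {k} - {i}) L (partial_x i (partial_x k f))" for k i
  \<comment> \<open>Diagonal terms are included as zeros so that the index set is a product and the
    sums can be swapped.\<close>
  define X where "X = (\<Sum>k\<in>K. \<Sum>i\<in>K. if i = k then 0 else F k i)"
  have "d_current (d_current S) K L f = (\<Sum>k\<in>K. \<Sum>i\<in>K - {k}. F k i)"
    unfolding d_current_eq F_def by (simp add: sum_negf sum_distrib_left mult_ac)
  also have "\<dots> = X"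
  proof -
    have "(\<Sum>i\<in>K - {k}. F k i) = (\<Sum>i\<in>K. if i = k then 0 else F k i)" if "k \<in> K" for k
      using that by (subst sum.remove[of K k "\<lambda>i. if i = k then 0 else F k i"]) (auto intro!: sum.cong)
    then show ?thesis by (simp add: X_def)
  qed
  also have "X = 0"
  proof -
    have anti: "F i k = - F k i" if "i \<in> K" "k \<in> K" "i \<noteq> k" for i k
    proof -
      have sign: "insert_sign i K * insert_sign k (K - {i}) = - (insert_sign k K * insert_sign i (K - {k}))"
        by (rule insert_sign_anticommute) (use that in auto)
      have "F i k = insert_sign i K * insert_sign k (K - {i}) *
         S (K - {i} - {k}) L (partial_x k (partial_x i f))"
        by (simp only: F_def)
      also have "K - {i} - {k} = K - {k} - {i}" by auto
      also have "partial_x k (partial_x i f) = partial_x i (partial_x k f)"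
        by (rule partial_x_commute[OF assms])
      finally show ?thesis by (simp only: sign F_def mult_minus_left)
    qed
    have "X = (\<Sum>i\<in>K. \<Sum>k\<in>K. if i = k then 0 else F k i)"
      unfolding X_def by (rule sum.swap)
    also have "\<dots> = (\<Sum>i\<in>K. \<Sum>k\<in>K. - (if k = i then 0 else F i k))"
    proof (intro sum.cong refl)
      fix i k assume "i \<in> K" "k \<in> K"
      then show "(if i = k then 0 else F k i) = - (if k = i then 0 else F i k)"
        using anti[of i k] by (cases "i = k") auto
    qed
    also have "\<dots> = - X" by (simp add: X_def sum_negf)
    finally show ?thesis by simp
  qed
  finally show ?thesis .
qed


subsection \<open>The coefficients are measures\<close>

text \<open>
  Testing with \<open>a\<^sub>K = f\<close> and \<open>a\<^sub>L = \<plusminus>f\<close> shows that the diagonal coefficients dominate the off-diagonal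
  ones, so that both parts below are nonnegative on squares.
\<close>

definition diagonal_part :: "nat \<Rightarrow> 'n::{finite,linorder} current \<Rightarrow> 'n set \<Rightarrow> 'n distr" where
  "diagonal_part m S K f = total_sign TYPE('n) m * S K K f"

definition neg_part :: "nat \<Rightarrow> 'n::{finite,linorder} current \<Rightarrow> 'n set \<Rightarrow> 'n set \<Rightarrow> 'n distr" where
  "neg_part m S K L f = diagonal_part m S K f + diagonal_part m S L f"

definition pos_part :: "nat \<Rightarrow> 'n::{finite,linorder} current \<Rightarrow> 'n set \<Rightarrow> 'n set \<Rightarrow> 'n distr" where
  "pos_part m S K L f = diagonal_part m S K f + diagonal_part m S L f + S K L f"

context
  fixes U :: "(real^'n::{finite,linorder}) set" and m :: nat and S :: "'n current"
  assumes U: "open U" and S: "positive_closed U m S"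
begin

lemma coefficient_linear: "linear_on_tests U (S K L)"
  and coefficient_zero: "card K \<noteq> m \<or> card L \<noteq> m \<Longrightarrow> f \<in> test_functions U \<Longrightarrow> S K L f = 0"
  and coefficient_symmetric: "f \<in> test_functions U \<Longrightarrow> S K L f = S L K f"
  and quadratic_form_nonneg: "(\<And>K. a K \<in> test_functions U) \<Longrightarrow> 0 \<le> quadratic_form m S a"
  and coefficient_closed: "f \<in> test_functions U \<Longrightarrow> d_current S K L f = 0"
  using S by (auto simp: positive_closed_def symmetric_current_def closed_current_def)

lemma quadratic_form_two:
  assumes "K \<noteq> L" "card K = m" "card L = m" "f \<in> test_functions U"
  shows "0 \<le> diagonal_part m S K (\<lambda>x. f x * f x) + diagonal_part m S L (\<lambda>x. f x * f x)
    + 2 * S K L (\<lambda>x. f x * f x)"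
proof -
  let ?\<tau> = "total_sign TYPE('n) m"
  \<comment> \<open>This sign, of square 1, turns both mixed terms into \<open>S K L\<close> applied
    to the square of f.\<close>
  define c where "c = ?\<tau> * compl_sign K * compl_sign L"
  define a where "a M = (if M = K then f else if M = L then (\<lambda>x. c * f x) else (\<lambda>x. 0))" for M
  have \<tau>2: "?\<tau> * ?\<tau> = 1" using total_sign_cases[where 'n='n, of m] by auto
  have c2: "c * c = 1"
  proof -
    have "c * c = (?\<tau> * ?\<tau>) * (compl_sign K * compl_sign K) * (compl_sign L * compl_sign L)"
      by (simp only: c_def mult_ac)
    then show ?thesis by (simp add: \<tau>2)
  qed
  have ff: "(\<lambda>x. f x * f x) \<in> test_functions U"
    by (intro test_functions_mult assms(4) test_functions_smooth[OF assms(4)])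
  have a: "a M \<in> test_functions U" for M
    using assms(4) by (auto simp: a_def intro: test_functions_cmult)
  have cc: "(\<lambda>x. c * f x * (c * f x)) = (\<lambda>x. f x * f x)"
  proof
    fix x
    have "c * f x * (c * f x) = (c * c) * (f x * f x)" by (simp only: mult_ac)
    then show "c * f x * (c * f x) = f x * f x" by (simp add: c2)
  qed
  have scale: "S M N (\<lambda>x. c * f x * f x) = c * S M N (\<lambda>x. f x * f x)"
    "S M N (\<lambda>x. f x * (c * f x)) = c * S M N (\<lambda>x. f x * f x)"
    "S M N (\<lambda>x. c * f x * (c * f x)) = S M N (\<lambda>x. f x * f x)" for M N
    using linear_on_tests_cmult[OF coefficient_linear ff, of M N c]
    by (simp_all only: cc) (simp_all add: mult_ac)
  have zero: "S M N (\<lambda>x. 0) = 0" for M N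
    by (rule linear_on_tests_0[OF coefficient_linear])
  define G where "G M N = ?\<tau> * compl_sign M * compl_sign N * S M N (\<lambda>x. a M x * a N x)" for M N
  have G0: "G M N = 0" if "M \<notin> {K, L} \<or> N \<notin> {K, L}" for M N
    using that zero by (auto simp: G_def a_def)
  have "quadratic_form m S a = (\<Sum>M\<in>{K, L}. \<Sum>N\<in>{K, L}. G M N)"
  proof -
    have "(\<Sum>N\<in>index_sets m. G M N) = (\<Sum>N\<in>{K, L}. G M N)" for M
      using assms G0 by (intro sum.mono_neutral_right) auto
    moreover have "(\<Sum>M\<in>index_sets m. \<Sum>N\<in>{K, L}. G M N) = (\<Sum>M\<in>{K, L}. \<Sum>N\<in>{K, L}. G M N)"
      using assms G0 by (intro sum.mono_neutral_right) auto
    ultimately show ?thesis by (simp add: quadratic_form_def G_def)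
  qed
  also have "\<dots> = G K K + G L L + G K L + G L K" using assms(1) by simp
  also have "G K K = diagonal_part m S K (\<lambda>x. f x * f x)"
    by (simp add: G_def a_def diagonal_part_def mult.assoc)
  also have "G L L = diagonal_part m S L (\<lambda>x. f x * f x)"
    using assms(1) by (simp add: G_def a_def diagonal_part_def mult.assoc cc[unfolded mult.assoc])
  also have "G K L = S K L (\<lambda>x. f x * f x)"
  proof -
    have "G K L = (c * c) * S K L (\<lambda>x. f x * f x)"
      using assms(1) by (simp add: G_def a_def scale(2) flip: c_def)
    then show ?thesis by (simp add: c2)
  qed
  also have "G L K = S K L (\<lambda>x. f x * f x)"
  proof -
    have "G L K = (c * c) * S L K (\<lambda>x. f x * f x)"
      using assms(1) by (simp add: G_def a_def scale(1)) (simp add: c_def mult_ac)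
    then show ?thesis using coefficient_symmetric[OF ff, of L K] by (simp add: c2)
  qed
  finally have "quadratic_form m S a = diagonal_part m S K (\<lambda>x. f x * f x) +
     diagonal_part m S L (\<lambda>x. f x * f x) + 2 * S K L (\<lambda>x. f x * f x)" by simp
  then show ?thesis using quadratic_form_nonneg[of a] a by simp
qed

lemma diagonal_part_square:
  assumes "f \<in> test_functions U"
  shows "0 \<le> diagonal_part m S K (\<lambda>x. f x * f x)"
proof (cases "card K = m")
  case True
  define a where "a M = (if M = K then f else (\<lambda>x. 0))" for M
  have zero: "S M N (\<lambda>x. 0) = 0" for M N
    by (rule linear_on_tests_0[OF coefficient_linear])
  define G where "G M N = total_sign TYPE('n) m * compl_sign M * compl_sign N * S M N (\<lambda>x. a M x * a N x)" for M N
  have G0: "G M N = 0" if "M \<noteq> K \<or> N \<noteq> K" for M N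
    using that zero by (auto simp: G_def a_def)
  have "quadratic_form m S a = (\<Sum>M\<in>index_sets m. \<Sum>N\<in>index_sets m. G M N)"
    by (simp add: quadratic_form_def G_def)
  also have "\<dots> = (\<Sum>M\<in>{K}. \<Sum>N\<in>index_sets m. G M N)"
    using True G0 by (intro sum.mono_neutral_right) (auto intro!: sum.neutral)
  also have "\<dots> = (\<Sum>M\<in>{K}. \<Sum>N\<in>{K}. G M N)"
    using True G0 by (intro sum.cong refl sum.mono_neutral_right) auto
  also have "\<dots> = diagonal_part m S K (\<lambda>x. f x * f x)"
    by (simp add: G_def a_def diagonal_part_def mult.assoc)
  finally show ?thesis using quadratic_form_nonneg[of a] assms by (simp add: a_def)
next
  case False
  have "(\<lambda>x. f x * f x) \<in> test_functions U"
    by (intro test_functions_mult assms test_functions_smooth[OF assms])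
  then show ?thesis using coefficient_zero[of K K] False by (simp add: diagonal_part_def)
qed

lemma linear_on_tests_combination:
  assumes "linear_on_tests U D" "linear_on_tests U E"
  shows "linear_on_tests U (\<lambda>f. b * D f + c * E f)"
  using assms unfolding linear_on_tests_def by (auto simp: algebra_simps)

lemma diagonal_part_linear: "linear_on_tests U (diagonal_part m S K)"
  using linear_on_tests_combination[OF coefficient_linear coefficient_linear, of "total_sign TYPE('n) m" K K 0]
  by (simp add: diagonal_part_def[abs_def])

lemma neg_part_linear: "linear_on_tests U (neg_part m S K L)"
  using linear_on_tests_combination[OF diagonal_part_linear diagonal_part_linear, of 1 K 1 L]
  by (simp add: neg_part_def[abs_def])

lemma pos_part_linear: "linear_on_tests U (pos_part m S K L)"
  using linear_on_tests_combination[OF neg_part_linear coefficient_linear, of 1 K L 1 K L]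
  by (simp add: neg_part_def pos_part_def[abs_def])

lemma neg_part_positive: "positive_linear_on (test_functions U) (neg_part m S K L)"
  by (rule positive_if_nonneg_on_squares[OF U neg_part_linear])
     (simp add: neg_part_def diagonal_part_square)

lemma pos_part_positive: "positive_linear_on (test_functions U) (pos_part m S K L)"
proof (rule positive_if_nonneg_on_squares[OF U pos_part_linear])
  fix f assume f: "f \<in> test_functions U"
  let ?f = "\<lambda>x. f x * f x"
  have ff: "?f \<in> test_functions U"
    by (intro test_functions_mult f test_functions_smooth[OF f])
  note diag = diagonal_part_square[OF f]
  show "0 \<le> pos_part m S K L ?f"
  proof (cases "card K = m \<and> card L = m")
    case True
    show ?thesis
    proof (cases "K = L")
      \<comment> \<open>Twice the diagonal part dominates \<open>S K K\<close>, which is that part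
        up to sign.\<close>
      case True
      then show ?thesis
        using diag[of K] total_sign_cases[where 'n='n, of m]
        by (auto simp: pos_part_def diagonal_part_def)
    next
      \<comment> \<open>Half of the bound in \<open>quadratic_form_two\<close> plus half of the
        diagonal terms.\<close>
      case False
      then show ?thesis
        using quadratic_form_two[OF False _ _ f] True diag[of K] diag[of L] by (simp add: pos_part_def)
    qed
  next
    case False
    then show ?thesis
      using coefficient_zero[OF _ ff, of K L] diag[of K] diag[of L] by (simp add: pos_part_def)
  qed
qed

lemma coefficient_decomposition: "S K L f = pos_part m S K L f - neg_part m S K L f"
  by (simp add: pos_part_def neg_part_def)

end

subsection \<open>Wedge products with the Hessian of a convex function\<close>

text \<open>A smooth factor can be moved onto the test function. Identities and inequalities for D
  therefore pass to its product with \<open>u\<close> through smooth approximations, although that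
  product is defined by an unspecified pair of measures.\<close>

lemma distr_mult_limit_smooth:
  assumes U: "open U" and R: "positive_linear_on (test_functions U) R"
    and Q: "positive_linear_on (test_functions U) Q"
    and D: "\<And>f. f \<in> test_functions U \<Longrightarrow> D f = R f - Q f"
    and u: "continuous_on U u" and f: "f \<in> test_functions U"
    and K: "compact K" "K \<subseteq> U" "\<And>x. x \<notin> K \<Longrightarrow> f x = 0"
    and w: "\<And>k. smooth (w k)" "uniform_limit K w u sequentially"
  shows "(\<lambda>k. D (\<lambda>x. w k x * f x)) \<longlonglongrightarrow> distr_mult U u D f"
proof -
  obtain \<phi> V where \<phi>: "\<phi> \<in> test_functions U" "open V" "K \<subseteq> V" "\<And>x. x \<in> V \<Longrightarrow> \<phi> x = 1" "\<And>x. 0 \<le> \<phi> x"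
    using smooth_cutoff[OF K(1) U K(2)] by metis
  obtain B where B: "B > 0" "\<And>x. \<bar>f x\<bar> \<le> B"
    using compactly_supported_bounded[OF test_functions_compactly_supported[OF f]] by blast
  define C where "C = R \<phi> + Q \<phi> + 1"
  have C: "C \<ge> 1" "R \<phi> + Q \<phi> < C"
    using positive_linear_on_nonneg[OF R \<phi>(1,5)] positive_linear_on_nonneg[OF Q \<phi>(1,5)] by (auto simp: C_def)
  show ?thesis
  proof (rule tendstoI)
    fix \<epsilon> :: real assume "\<epsilon> > 0"
    define e where "e = \<epsilon> / C"
    have e: "e > 0" "e * C = \<epsilon>" using \<open>\<epsilon> > 0\<close> C(1) by (auto simp: e_def)
    have "\<forall>\<^sub>F k in sequentially. \<forall>x\<in>K. dist (w k x) (u x) < e / B"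
      using w(2) e(1) B(1) by (intro uniform_limitD) auto
    then show "\<forall>\<^sub>F k in sequentially. dist (D (\<lambda>x. w k x * f x)) (distr_mult U u D f) < \<epsilon>"
    proof eventually_elim
      case (elim k)
      have near: "\<bar>u x * f x - w k x * f x\<bar> \<le> e" for x
      proof -
        have "\<bar>u x - w k x\<bar> * \<bar>f x\<bar> \<le> e"
        proof (cases "x \<in> K")
          case True
          then have "\<bar>u x - w k x\<bar> * \<bar>f x\<bar> \<le> e / B * B"
            using elim B by (intro mult_mono) (auto simp: dist_real_def abs_minus_commute intro: less_imp_le)
          then show ?thesis using B(1) by simp
        qed (use K(3) e(1) in simp)
        then show ?thesis by (simp add: abs_mult flip: left_diff_distrib)
      qed
      have "\<bar>distr_mult U u D f - D (\<lambda>x. w k x * f x)\<bar> \<le> e * (R \<phi> + Q \<phi>)"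
        by (rule distr_mult_near[OF U R Q D u f test_functions_mult[OF f w(1)] \<phi>(1,2,4,5) K(1,2) \<phi>(3) K(3) _ near])
           (auto simp: K(3))
      also have "\<dots> < e * C" using e(1) C(2) by (intro mult_strict_left_mono)
      finally show ?case using e(2) by (simp add: dist_real_def abs_minus_commute)
    qed
  qed
qed

text \<open>A pair (K, i) with i in K stands for one way in which dx_K arises as dx_i \<and> dx_I,
  with I = K - {i}. Indexed by such pairs, the fourfold sum over K, L, i, j becomes a double sum of
  Gram type.\<close>

definition insertions :: "nat \<Rightarrow> ('n::finite set \<times> 'n) set" where
  "insertions m = Sigma (index_sets (Suc m)) (\<lambda>K. K)"

definition insertion_sign :: "'n::{finite,linorder} set \<times> 'n \<Rightarrow> real" where
  "insertion_sign z = compl_sign (fst z) * insert_sign (snd z) (fst z)"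

definition removed :: "'n set \<times> 'n \<Rightarrow> 'n set" where
  "removed z = fst z - {snd z}"

lemma removed_index_sets: "z \<in> insertions m \<Longrightarrow> removed z \<in> index_sets m"
  by (auto simp: insertions_def removed_def)

lemma sum_insertions:
  fixes F :: "'n::{finite,linorder} set \<Rightarrow> 'n set \<Rightarrow> 'n \<Rightarrow> 'n \<Rightarrow> real"
  shows "(\<Sum>K\<in>index_sets (Suc m). \<Sum>L\<in>index_sets (Suc m). compl_sign K * compl_sign L *
     (\<Sum>i\<in>K. \<Sum>j\<in>L. insert_sign i K * insert_sign j L * F K L i j)) =
   (\<Sum>z\<in>insertions m. \<Sum>z'\<in>insertions m. insertion_sign z * insertion_sign z' *
     F (fst z) (fst z') (snd z) (snd z'))" (is "?L = ?R")
proof -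
  have "?L = (\<Sum>K\<in>index_sets (Suc m). \<Sum>L\<in>index_sets (Suc m). \<Sum>i\<in>K. \<Sum>j\<in>L.
     insertion_sign (K, i) * insertion_sign (L, j) * F K L i j)"
    by (simp add: sum_distrib_left insertion_sign_def mult_ac)
  also have "\<dots> = (\<Sum>K\<in>index_sets (Suc m). \<Sum>i\<in>K. \<Sum>L\<in>index_sets (Suc m). \<Sum>j\<in>L.
     insertion_sign (K, i) * insertion_sign (L, j) * F K L i j)"
    by (intro sum.cong refl sum.swap)
  also have "\<dots> = ?R"
  proof -
    have "sum g (insertions m) = (\<Sum>K\<in>index_sets (Suc m). \<Sum>i\<in>K. g (K, i))" for g :: "'n set \<times> 'n \<Rightarrow> real"
      unfolding insertions_def by (subst sum.Sigma) (auto simp: split_beta)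
    then show ?thesis by simp
  qed
  finally show ?thesis .
qed

section \<open>Integration by parts and nonnegativity of Hessian forms\<close>

context
  fixes U :: "(real^'n::{finite,linorder}) set" and m :: nat and S :: "'n current"
  assumes U: "open U" and S: "positive_closed U m S"
begin

text \<open>Different z may share an index set, so the functions \<open>b z\<close> are first
  collected over the fibres of \<pi>. The double sum is then the quadratic form of S at the
  resulting family, the factors \<open>compl_sign\<close> cancelling in pairs.\<close>

lemma gram_nonneg:
  assumes "finite Z" and \<pi>: "\<And>z. z \<in> Z \<Longrightarrow> \<pi> z \<in> index_sets m"
    and b: "\<And>z. z \<in> Z \<Longrightarrow> b z \<in> test_functions U"
  shows "0 \<le> total_sign TYPE('n) m *
    (\<Sum>z\<in>Z. \<Sum>z'\<in>Z. t z * t z' * S (\<pi> z) (\<pi> z') (\<lambda>x. b z x * b z' x))"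
proof -
  define B where "B I = (\<lambda>x. \<Sum>z\<in>{z\<in>Z. \<pi> z = I}. (compl_sign I * t z) * b z x)" for I
  have B: "B I \<in> test_functions U" for I
    unfolding B_def by (intro test_functions_sum test_functions_cmult b) auto
  have bb: "(\<lambda>x. b z x * b z' x) \<in> test_functions U" if "z \<in> Z" "z' \<in> Z" for z z'
    by (intro test_functions_mult b test_functions_smooth[OF b] that)
  define G where "G z z' = t z * t z' * S (\<pi> z) (\<pi> z') (\<lambda>x. b z x * b z' x)" for z z'
  have expand: "compl_sign I * compl_sign J * S I J (\<lambda>x. B I x * B J x) =
     (\<Sum>z\<in>{z\<in>Z. \<pi> z = I}. \<Sum>z'\<in>{z\<in>Z. \<pi> z = J}. G z z')" for I J
  proof -
    have eq: "(\<lambda>x. B I x * B J x) = (\<lambda>x. \<Sum>z\<in>{z\<in>Z. \<pi> z = I}. \<Sum>z'\<in>{z\<in>Z. \<pi> z = J}.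
       (compl_sign I * compl_sign J * (t z * t z')) * (b z x * b z' x))"
      unfolding B_def sum_product by (intro ext sum.cong refl) (simp add: mult_ac)
    have "S I J (\<lambda>x. B I x * B J x) = (\<Sum>z\<in>{z\<in>Z. \<pi> z = I}. \<Sum>z'\<in>{z\<in>Z. \<pi> z = J}.
       (compl_sign I * compl_sign J * (t z * t z')) * S I J (\<lambda>x. b z x * b z' x))"
      unfolding eq
      by (subst linear_on_tests_sum[OF coefficient_linear[OF U S]];
          (intro test_functions_sum test_functions_cmult bb sum.cong refl)?;
          (subst linear_on_tests_sum[OF coefficient_linear[OF U S]])?;
          (intro test_functions_sum test_functions_cmult bb sum.cong refl
             linear_on_tests_cmult[OF coefficient_linear[OF U S]])?; simp)
    also have "\<dots> = compl_sign I * compl_sign J *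
       (\<Sum>z\<in>{z\<in>Z. \<pi> z = I}. \<Sum>z'\<in>{z\<in>Z. \<pi> z = J}. G z z')"
      by (auto simp: G_def sum_distrib_left mult_ac intro!: sum.cong)
    finally have "compl_sign I * compl_sign J * S I J (\<lambda>x. B I x * B J x) =
       (compl_sign I * compl_sign I) * (compl_sign J * compl_sign J) *
       (\<Sum>z\<in>{z\<in>Z. \<pi> z = I}. \<Sum>z'\<in>{z\<in>Z. \<pi> z = J}. G z z')"
      by (simp only: mult_ac)
    then show ?thesis by simp
  qed
  have "quadratic_form m S B = (\<Sum>I\<in>index_sets m. \<Sum>J\<in>index_sets m. total_sign TYPE('n) m *
     (\<Sum>z\<in>{z\<in>Z. \<pi> z = I}. \<Sum>z'\<in>{z\<in>Z. \<pi> z = J}. G z z'))"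
    unfolding quadratic_form_def by (simp add: mult.assoc flip: expand)
  also have "\<dots> = total_sign TYPE('n) m * (\<Sum>I\<in>index_sets m. \<Sum>z\<in>{z\<in>Z. \<pi> z = I}.
     \<Sum>J\<in>index_sets m. \<Sum>z'\<in>{z\<in>Z. \<pi> z = J}. G z z')"
    unfolding sum_distrib_left[symmetric]
    by (intro arg_cong2[of _ _ _ _ "(*)"] refl sum.cong sum.swap)
  also have "\<dots> = total_sign TYPE('n) m * (\<Sum>z\<in>Z. \<Sum>z'\<in>Z. G z z')"
  proof -
    have "(\<Sum>J\<in>index_sets m. \<Sum>z'\<in>{z\<in>Z. \<pi> z = J}. G z z') = (\<Sum>z'\<in>Z. G z z')" for z
      using assms(1) \<pi> by (intro sum.group) auto
    moreover have "(\<Sum>I\<in>index_sets m. \<Sum>z\<in>{z\<in>Z. \<pi> z = I}. \<Sum>z'\<in>Z. G z z') = (\<Sum>z\<in>Z. \<Sum>z'\<in>Z. G z z')"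
      using assms(1) \<pi> by (intro sum.group) auto
    ultimately show ?thesis by simp
  qed
  finally show ?thesis
    using quadratic_form_nonneg[OF U S, of B] B by (simp add: G_def)
qed

lemma closed_x: "g \<in> test_functions U \<Longrightarrow>
    (\<Sum>i\<in>K. insert_sign i K * S (K - {i}) L (partial_x i g)) = 0"
  using coefficient_closed[OF U S, of g K L] by (simp add: d_current_eq)

text \<open>Closedness is tested on the product of w and f and expanded by Leibniz's rule. It is the
  signed sum over all i in K that can be integrated by parts, not its single terms.\<close>

lemma integrate_by_parts_x:
  assumes w: "smooth w" and f: "f \<in> test_functions U"
  shows "(\<Sum>i\<in>K. insert_sign i K * S (K - {i}) L (\<lambda>x. w x * partial_x i f x)) =
    - (\<Sum>i\<in>K. insert_sign i K * S (K - {i}) L (\<lambda>x. partial_x i w x * f x))"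
proof -
  have tf: "(\<lambda>x. w x * f x) \<in> test_functions U" "(\<lambda>x. w x * partial_x i f x) \<in> test_functions U"
    "(\<lambda>x. partial_x i w x * f x) \<in> test_functions U" for i
    by (intro test_functions_mult test_functions_partial f smooth_partial w)+
  have "S (K - {i}) L (partial_x i (\<lambda>x. w x * f x)) =
     S (K - {i}) L (\<lambda>x. w x * partial_x i f x) + S (K - {i}) L (\<lambda>x. partial_x i w x * f x)" for i
    unfolding partial_x_mult_smooth[OF w test_functions_smooth[OF f]]
    by (rule linear_on_tests_add[OF coefficient_linear[OF U S] tf(2,3)])
  then have "(\<Sum>i\<in>K. insert_sign i K * S (K - {i}) L (\<lambda>x. w x * partial_x i f x)) +
     (\<Sum>i\<in>K. insert_sign i K * S (K - {i}) L (\<lambda>x. partial_x i w x * f x)) = 0"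
    using closed_x[OF tf(1), of K L] by (simp add: distrib_left sum.distrib)
  then show ?thesis by simp
qed

text \<open>By symmetry of S, closedness under d is also closedness under d#.\<close>

lemma integrate_by_parts_xi:
  assumes w: "smooth w" and f: "f \<in> test_functions U"
  shows "(\<Sum>j\<in>L. insert_sign j L * S K (L - {j}) (\<lambda>x. w x * partial_x j f x)) =
    - (\<Sum>j\<in>L. insert_sign j L * S K (L - {j}) (\<lambda>x. partial_x j w x * f x))"
proof -
  have "(\<lambda>x. w x * partial_x i f x) \<in> test_functions U"
    "(\<lambda>x. partial_x i w x * f x) \<in> test_functions U" for i
    by (intro test_functions_mult test_functions_partial f smooth_partial w)+
  then have "S K (L - {j}) (\<lambda>x. w x * partial_x j f x) = S (L - {j}) K (\<lambda>x. w x * partial_x j f x)"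
    "S K (L - {j}) (\<lambda>x. partial_x j w x * f x) = S (L - {j}) K (\<lambda>x. partial_x j w x * f x)" for j
    by (auto intro: coefficient_symmetric[OF U S])
  then show ?thesis using integrate_by_parts_x[OF w f, of L K] by simp
qed

lemma integrate_by_parts_twice:
  assumes w: "smooth w" and f: "f \<in> test_functions U"
  shows "(\<Sum>i\<in>K. \<Sum>j\<in>L. insert_sign i K * insert_sign j L *
      S (K - {i}) (L - {j}) (\<lambda>x. w x * partial_x j (partial_x i f) x)) =
    (\<Sum>i\<in>K. \<Sum>j\<in>L. insert_sign i K * insert_sign j L *
      S (K - {i}) (L - {j}) (\<lambda>x. partial_x i (partial_x j w) x * f x))" (is "?L = ?R")
proof -
  have "?L = (\<Sum>i\<in>K. insert_sign i K * (\<Sum>j\<in>L. insert_sign j L *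
      S (K - {i}) (L - {j}) (\<lambda>x. w x * partial_x j (partial_x i f) x)))"
    by (simp add: sum_distrib_left mult_ac)
  also have "\<dots> = (\<Sum>i\<in>K. insert_sign i K * - (\<Sum>j\<in>L. insert_sign j L *
      S (K - {i}) (L - {j}) (\<lambda>x. partial_x j w x * partial_x i f x)))"
    by (simp only: integrate_by_parts_xi[OF w test_functions_partial[OF f]])
  also have "\<dots> = - (\<Sum>i\<in>K. \<Sum>j\<in>L. insert_sign i K * insert_sign j L *
      S (K - {i}) (L - {j}) (\<lambda>x. partial_x j w x * partial_x i f x))"
    by (simp add: sum_distrib_left sum_negf mult_ac)
  also have "\<dots> = - (\<Sum>j\<in>L. insert_sign j L * (\<Sum>i\<in>K. insert_sign i K *
      S (K - {i}) (L - {j}) (\<lambda>x. partial_x j w x * partial_x i f x)))"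
    by (subst sum.swap) (simp add: sum_distrib_left mult_ac)
  also have "\<dots> = - (\<Sum>j\<in>L. insert_sign j L * - (\<Sum>i\<in>K. insert_sign i K *
      S (K - {i}) (L - {j}) (\<lambda>x. partial_x i (partial_x j w) x * f x)))"
    by (simp only: integrate_by_parts_x[OF smooth_partial[OF w] f])
  also have "\<dots> = (\<Sum>j\<in>L. \<Sum>i\<in>K. insert_sign i K * insert_sign j L *
      S (K - {i}) (L - {j}) (\<lambda>x. partial_x i (partial_x j w) x * f x))"
    by (simp add: sum_distrib_left sum_negf mult_ac)
  also have "\<dots> = ?R" by (rule sum.swap)
  finally show ?thesis .
qed

text \<open>The quadratic form, evaluated at a, of \<Sum> H_ij dx_i \<and> d\<xi>_j \<and> S for an
  arbitrary matrix H of functions. The total sign is that of m because \<open>total_sign_Suc\<close>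
  has absorbed the rest.\<close>

definition hessian_form :: "('n \<Rightarrow> 'n \<Rightarrow> real^'n::{finite,linorder} \<Rightarrow> real) \<Rightarrow> ('n set \<Rightarrow> real^'n::{finite,linorder} \<Rightarrow> real) \<Rightarrow> real" where
  "hessian_form H a = total_sign TYPE('n) m *
     (\<Sum>z\<in>insertions m. \<Sum>z'\<in>insertions m. insertion_sign z * insertion_sign z' *
       S (removed z) (removed z') (\<lambda>x. H (snd z) (snd z') x * (a (fst z) x * a (fst z') x)))"

text \<open>For fixed \<open>k\<close> this is the Gram sum of the functions
  \<open>c k i x * a K x\<close>, indexed by the pairs (K, i).\<close>

lemma hessian_form_gram:
  assumes a: "\<And>K. a K \<in> test_functions U" and c: "\<And>k i. smooth (c k i)"
  shows "0 \<le> hessian_form (\<lambda>i j x. \<Sum>k\<in>(UNIV :: 'k::finite set). c k i x * c k j x) a"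
proof -
  define b where "b k z = (\<lambda>x. c k (snd z) x * a (fst z) x)" for k and z :: "'n set \<times> 'n"
  have b: "b k z \<in> test_functions U" for k z
    unfolding b_def by (rule test_functions_mult[OF a c])
  have bb: "(\<lambda>x. b k z x * b k z' x) \<in> test_functions U" for k z z'
    by (intro test_functions_mult b test_functions_smooth[OF b])
  have "S (removed z) (removed z') (\<lambda>x. (\<Sum>k\<in>UNIV. c k (snd z) x * c k (snd z') x) * (a (fst z) x * a (fst z') x))
     = (\<Sum>k\<in>UNIV. S (removed z) (removed z') (\<lambda>x. b k z x * b k z' x))" for z z'
  proof -
    have "(\<lambda>x. (\<Sum>k\<in>UNIV. c k (snd z) x * c k (snd z') x) * (a (fst z) x * a (fst z') x)) =
       (\<lambda>x. \<Sum>k\<in>UNIV. b k z x * b k z' x)"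
      by (simp add: b_def sum_distrib_left sum_distrib_right mult_ac)
    then show ?thesis using linear_on_tests_sum[OF coefficient_linear[OF U S] bb] by simp
  qed
  then have "hessian_form (\<lambda>i j x. \<Sum>k\<in>UNIV. c k i x * c k j x) a = total_sign TYPE('n) m *
     (\<Sum>z\<in>insertions m. \<Sum>z'\<in>insertions m. \<Sum>k\<in>UNIV. insertion_sign z * insertion_sign z' *
       S (removed z) (removed z') (\<lambda>x. b k z x * b k z' x))"
    by (simp add: hessian_form_def sum_distrib_left)
  also have "(\<Sum>z\<in>insertions m. \<Sum>z'\<in>insertions m. \<Sum>k\<in>UNIV. insertion_sign z * insertion_sign z' *
       S (removed z) (removed z') (\<lambda>x. b k z x * b k z' x)) =
     (\<Sum>k\<in>UNIV. \<Sum>z\<in>insertions m. \<Sum>z'\<in>insertions m. insertion_sign z * insertion_sign z' *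
       S (removed z) (removed z') (\<lambda>x. b k z x * b k z' x))"
    by (subst (2) sum.swap, subst sum.swap) (rule refl)
  finally have "hessian_form (\<lambda>i j x. \<Sum>k\<in>UNIV. c k i x * c k j x) a = (\<Sum>k\<in>UNIV. total_sign TYPE('n) m *
     (\<Sum>z\<in>insertions m. \<Sum>z'\<in>insertions m. insertion_sign z * insertion_sign z' *
       S (removed z) (removed z') (\<lambda>x. b k z x * b k z' x)))"
    by (simp add: sum_distrib_left)
  also have "\<dots> \<ge> 0"
    by (intro sum_nonneg gram_nonneg removed_index_sets b) auto
  finally show ?thesis .
qed

text \<open>
  The Hessian may be singular and is positive semidefinite only near the support of \<open>a\<close>, so the
  Cholesky factorisation is applied to \<open>\<psi> H + \<epsilon> I\<close> with a cutoff \<open>\<psi>\<close>.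
\<close>

lemma hessian_form_nonneg:
  assumes a: "\<And>K. a K \<in> test_functions U" "\<And>K x. x \<notin> C \<Longrightarrow> a K x = 0"
    and C: "compact C" "C \<subseteq> W" "open W"
    and H: "\<And>i j. smooth (H i j)" "\<And>i j. H i j = H j i"
    and psd: "\<And>x y :: real^'n::{finite,linorder}. x \<in> W \<Longrightarrow> 0 \<le> (\<Sum>i\<in>UNIV. \<Sum>j\<in>UNIV. H i j x * y $ i * y $ j)"
  shows "0 \<le> hessian_form H a"
proof -
  obtain \<psi> V where \<psi>: "\<psi> \<in> test_functions W" "C \<subseteq> V" "\<And>x. x \<in> V \<Longrightarrow> \<psi> x = 1" "\<And>x. 0 \<le> \<psi> x"
    using smooth_cutoff[OF C(1,3,2)] by metis
  have \<psi>_out: "\<psi> x = 0" if "x \<notin> W" for x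
    using test_functions_compactly_supported[OF \<psi>(1)] that by (auto elim!: compactly_supportedE)
  define \<delta> where "\<delta> i j = (\<lambda>x::real^'n::{finite,linorder}. of_bool (i = j) :: real)" for i j :: 'n
  have "- hessian_form H a \<le> \<epsilon> * hessian_form \<delta> a" if \<epsilon>: "\<epsilon> > 0" for \<epsilon>
  proof -
    define A where "A i j x = \<psi> x * H i j x + \<epsilon> * \<delta> i j x" for i j x
    have A: "smooth (A i j)" for i j
      unfolding A_def \<delta>_def
      by (intro smooth_add smooth_mult smooth_const H test_functions_smooth[OF \<psi>(1)])
    have "\<exists>c. (\<forall>k\<in>(UNIV :: 'n set). \<forall>i\<in>UNIV. smooth (c k i)) \<and>
       (\<forall>x. \<forall>i\<in>UNIV. \<forall>j\<in>UNIV. A i j x = (\<Sum>k\<in>UNIV. c k i x * c k j x))"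
    proof (rule smooth_cholesky)
      show "A i j x = A j i x" for i j x using H(2)[of i j] by (simp add: A_def \<delta>_def eq_commute)
      fix x and y :: "'n \<Rightarrow> real" assume "\<exists>i\<in>UNIV. y i \<noteq> 0"
      then obtain i where i: "y i \<noteq> 0" by blast
      \<comment> \<open>Off W the cutoff is 0, so nothing has to be known about H there.\<close>
      have "0 \<le> \<psi> x * (\<Sum>i\<in>UNIV. \<Sum>j\<in>UNIV. H i j x * y i * y j)"
      proof (cases "x \<in> W")
        case True
        then show ?thesis using psd[OF True, of "vec_lambda y"] \<psi>(4) by simp
      qed (simp add: \<psi>_out)
      moreover have "(\<Sum>j\<in>UNIV. \<delta> i j x * y i * y j) = y i * y i" for i
        by (subst sum.remove[of _ i]) (auto simp: \<delta>_def intro!: sum.neutral)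
      then have "\<epsilon> * (\<Sum>i\<in>UNIV. \<Sum>j\<in>UNIV. \<delta> i j x * y i * y j) > 0"
        using \<epsilon> i by (simp add: sum_pos2[of UNIV i] zero_less_mult_iff)
          (auto intro!: sum_pos2[of UNIV i] simp: zero_less_mult_iff linorder_neq_iff)
      moreover have "(\<Sum>i\<in>UNIV. \<Sum>j\<in>UNIV. A i j x * y i * y j) =
         \<psi> x * (\<Sum>i\<in>UNIV. \<Sum>j\<in>UNIV. H i j x * y i * y j) +
         \<epsilon> * (\<Sum>i\<in>UNIV. \<Sum>j\<in>UNIV. \<delta> i j x * y i * y j)"
        by (simp add: A_def distrib_right sum.distrib sum_distrib_left mult.assoc)
      ultimately show "0 < (\<Sum>i\<in>UNIV. \<Sum>j\<in>UNIV. A i j x * y i * y j)" by linarith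
    qed (auto simp: A)
    then obtain c :: "'n \<Rightarrow> 'n \<Rightarrow> _" where c: "\<And>k i. smooth (c k i)" "\<And>i j x. A i j x = (\<Sum>k\<in>UNIV. c k i x * c k j x)"
      by blast
    have "0 \<le> hessian_form A a"
      using hessian_form_gram[OF a(1) c(1)] c(2) by (simp add: hessian_form_def)
    also have "hessian_form A a = hessian_form H a + \<epsilon> * hessian_form \<delta> a"
    proof -
      have "S I J (\<lambda>x. A i j x * (a K x * a L x)) =
         S I J (\<lambda>x. H i j x * (a K x * a L x)) + \<epsilon> * S I J (\<lambda>x. \<delta> i j x * (a K x * a L x))" for I J i j K L
      proof -
        have aa: "(\<lambda>x. a K x * a L x) \<in> test_functions U"
          by (intro test_functions_mult a test_functions_smooth[OF a(1)])
        have tf: "(\<lambda>x. H i j x * (a K x * a L x)) \<in> test_functions U"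
          "(\<lambda>x. \<delta> i j x * (a K x * a L x)) \<in> test_functions U"
          unfolding \<delta>_def by (intro test_functions_mult aa H smooth_const)+
        have "A i j x * (a K x * a L x) = H i j x * (a K x * a L x) + \<epsilon> * (\<delta> i j x * (a K x * a L x))" for x
        proof (cases "x \<in> C")
          case True
          then have "\<psi> x = 1" using \<psi>(2,3) by blast
          then show ?thesis by (simp add: A_def distrib_right)
        next
          case False
          then show ?thesis using a(2) by simp
        qed
        then show ?thesis
          using linear_on_tests_add[OF coefficient_linear[OF U S] tf(1) test_functions_cmult[OF tf(2), of \<epsilon>], of I J]
            linear_on_tests_cmult[OF coefficient_linear[OF U S] tf(2), of I J \<epsilon>] by simp
      qed
      then show ?thesis
        by (simp add: hessian_form_def distrib_left sum.distrib sum_distrib_left mult_ac)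
    qed
    finally show ?thesis by simp
  qed
  then have "- hessian_form H a \<le> 0" by (rule le_0_if_le_scaled)
  then show ?thesis by simp
qed

section \<open>Products with a convex function and their dd#\<close>

context
  fixes v :: "real^'n::{finite,linorder} \<Rightarrow> real"
  assumes v: "convex_function_on U v"
begin

lemma mult_current_linear: "linear_on_tests U (mult_current U v S K L)"
  unfolding mult_current_def
  by (rule distr_mult_linear[OF U pos_part_positive[OF U S] neg_part_positive[OF U S]
        coefficient_decomposition[OF U S] convex_function_on_continuous[OF U v]])

lemma mult_current_tendsto:
  assumes "f \<in> test_functions U" "compact C" "C \<subseteq> U" "\<And>x. x \<notin> C \<Longrightarrow> f x = 0"
    and "\<And>k. smooth (w k)" "uniform_limit C w v sequentially"
  shows "(\<lambda>k. S K L (\<lambda>x. w k x * f x)) \<longlonglongrightarrow> mult_current U v S K L f"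
  unfolding mult_current_def
  by (rule distr_mult_limit_smooth[OF U pos_part_positive[OF U S] neg_part_positive[OF U S]
        coefficient_decomposition[OF U S] convex_function_on_continuous[OF U v] assms])

lemma mult_current_zero:
  assumes f: "f \<in> test_functions U" and "card K \<noteq> m \<or> card L \<noteq> m"
  shows "mult_current U v S K L f = 0"
proof -
  obtain C where C: "compact C" "C \<subseteq> U" "\<And>x. x \<notin> C \<Longrightarrow> f x = 0"
    using test_functions_compactly_supported[OF f] by (rule compactly_supportedE) blast
  obtain w :: "nat \<Rightarrow> real^'n::{finite,linorder} \<Rightarrow> real" where w: "\<And>k. smooth (w k)" "uniform_limit C w v sequentially"
    using convex_smooth_approximation[OF U v C(1,2)] by metis
  have "S K L (\<lambda>x. w k x * f x) = 0" for k
    by (rule coefficient_zero[OF U S assms(2) test_functions_mult[OF f w(1)]])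
  then show ?thesis
    using mult_current_tendsto[OF f C w, of K L] by (simp add: LIMSEQ_const_iff)
qed

lemma mult_current_symmetric:
  assumes "f \<in> test_functions U"
  shows "mult_current U v S K L f = mult_current U v S L K f"
  unfolding mult_current_def
  by (rule fun_cong[OF distr_mult_cong]) (rule coefficient_symmetric[OF U S])

lemma quadratic_form_ddsharp:
  assumes "Suc m \<le> CARD('n)"
  shows "quadratic_form (Suc m) (d_current (dsharp_current (mult_current U v S))) a =
    total_sign TYPE('n) m * (\<Sum>K\<in>index_sets (Suc m). \<Sum>L\<in>index_sets (Suc m). compl_sign K * compl_sign L *
      (\<Sum>i\<in>K. \<Sum>j\<in>L. insert_sign i K * insert_sign j L *
        mult_current U v S (K - {i}) (L - {j}) (partial_x j (partial_x i (\<lambda>x. a K x * a L x)))))"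
proof -
  have "total_sign TYPE('n) (Suc m) * compl_sign K * compl_sign L *
      d_current (dsharp_current (mult_current U v S)) K L f = (total_sign TYPE('n) (Suc m) * (-1) ^ m) *
      (compl_sign K * compl_sign L * (\<Sum>i\<in>K. \<Sum>j\<in>L. insert_sign i K * insert_sign j L *
        mult_current U v S (K - {i}) (L - {j}) (partial_x j (partial_x i f))))"
    if "card K = Suc m" for K L f
    using that by (simp add: ddsharp_current_eq)
  then show ?thesis
    unfolding total_sign_Suc[OF assms] quadratic_form_def sum_distrib_left
    by (intro sum.cong refl) (simp add: sum_distrib_left mult_ac)
qed

text \<open>The smooth functions \<open>w k\<close> replacing v have nonnegative Hessian only on a
  neighbourhood of the common support C of the \<open>a K\<close>; that is enough, since all test
  functions involved vanish off C.\<close>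

lemma quadratic_form_ddsharp_nonneg:
  assumes "Suc m \<le> CARD('n)" and a: "\<And>K. a K \<in> test_functions U"
  shows "0 \<le> quadratic_form (Suc m) (d_current (dsharp_current (mult_current U v S))) a"
proof -
  have "\<forall>K. \<exists>C. compact C \<and> C \<subseteq> U \<and> (\<forall>x. x \<notin> C \<longrightarrow> a K x = 0)"
    using test_functions_compactly_supported[OF a] by (auto simp: compactly_supported_def)
  then obtain Cs where Cs: "\<And>K. compact (Cs K)" "\<And>K. Cs K \<subseteq> U" "\<And>K x. x \<notin> Cs K \<Longrightarrow> a K x = 0"
    unfolding choice_iff by blast
  define C where "C = (\<Union>K\<in>UNIV. Cs K)"
  have C: "compact C" "C \<subseteq> U" "\<And>K x. x \<notin> C \<Longrightarrow> a K x = 0"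
    using Cs by (auto simp: C_def intro!: compact_UN)
  obtain w W where W: "open W" "C \<subseteq> W" and w: "\<And>k::nat. smooth (w k)" "uniform_limit C w v sequentially"
    and psd: "\<And>k x y. x \<in> W \<Longrightarrow> 0 \<le> (\<Sum>i\<in>UNIV. \<Sum>j\<in>UNIV. partial_x j (partial_x i (w k)) x * y $ i * y $ j)"
    by (rule convex_smooth_approximation[OF U v C(1,2)]) (rule that)
  have aa: "(\<lambda>x. a K x * a L x) \<in> test_functions U" for K L
    by (intro test_functions_mult a test_functions_smooth[OF a])
  have dd: "partial_x j (partial_x i (\<lambda>x. a K x * a L x)) \<in> test_functions U" for i j K L
    by (intro test_functions_partial aa)
  have dd0: "partial_x j (partial_x i (\<lambda>x. a K x * a L x)) x = 0" if "x \<notin> C" for i j K L x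
    using compact_imp_closed[OF C(1)] C(3) that by (auto intro!: partial_x_zero_outside[of C])
  \<comment> \<open>The quadratic form with its innermost term left open, so that it can be
    evaluated on the approximants as well.\<close>
  let ?X = "\<lambda>F. total_sign TYPE('n) m * (\<Sum>K\<in>index_sets (Suc m). \<Sum>L\<in>index_sets (Suc m).
      compl_sign K * compl_sign L *
      (\<Sum>i\<in>K. \<Sum>j\<in>L. insert_sign i K * insert_sign j L * F K L i j))"
  have lim: "(\<lambda>k. ?X (\<lambda>K L i j. S (K - {i}) (L - {j}) (\<lambda>x. w k x * partial_x j (partial_x i (\<lambda>x. a K x * a L x)) x)))
     \<longlonglongrightarrow> quadratic_form (Suc m) (d_current (dsharp_current (mult_current U v S))) a"
    unfolding quadratic_form_ddsharp[OF assms(1)]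
    by (intro tendsto_mult tendsto_const tendsto_sum mult_current_tendsto[OF dd C(1,2) dd0 w])
  have nonneg: "0 \<le> ?X (\<lambda>K L i j. S (K - {i}) (L - {j}) (\<lambda>x. w k x * partial_x j (partial_x i (\<lambda>x. a K x * a L x)) x))" for k
  proof -
    have "?X (\<lambda>K L i j. S (K - {i}) (L - {j}) (\<lambda>x. w k x * partial_x j (partial_x i (\<lambda>x. a K x * a L x)) x)) =
       ?X (\<lambda>K L i j. S (K - {i}) (L - {j}) (\<lambda>x. partial_x i (partial_x j (w k)) x * (a K x * a L x)))"
      by (simp only: integrate_by_parts_twice[OF w(1) aa])
    also have "\<dots> = hessian_form (\<lambda>i j. partial_x i (partial_x j (w k))) a"
      unfolding sum_insertions hessian_form_def removed_def ..
    also have "\<dots> \<ge> 0"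
    proof (rule hessian_form_nonneg[OF a C(3) C(1) W(2,1)])
      show "partial_x i (partial_x j (w k)) = partial_x j (partial_x i (w k))" for i j
        by (rule partial_x_commute[OF w(1)])
      show "0 \<le> (\<Sum>i\<in>UNIV. \<Sum>j\<in>UNIV. partial_x i (partial_x j (w k)) x * y $ i * y $ j)" if "x \<in> W" for x y
        using psd[OF that, of k y] by (simp add: partial_x_commute[OF w(1)])
    qed (auto intro: smooth_partial w(1))
    finally show ?thesis .
  qed
  show ?thesis by (rule LIMSEQ_le_const[OF lim]) (use nonneg in blast)
qed

theorem positive_closed_ddsharp:
  assumes "Suc m \<le> CARD('n)"
  shows "positive_closed U (Suc m) (d_current (dsharp_current (mult_current U v S)))"
  unfolding positive_closed_def
proof (intro conjI allI impI)
  let ?M = "mult_current U v S"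
  let ?W = "d_current (dsharp_current ?M)"
  have zero: "?W K L f = 0" if "card K \<noteq> Suc m \<or> card L \<noteq> Suc m" "f \<in> test_functions U" for K L f
  proof -
    have "?M (K - {i}) (L - {j}) (partial_x j (partial_x i f)) = 0" if "i \<in> K" "j \<in> L" for i j
    proof (rule mult_current_zero)
      \<comment> \<open>Both sets are nonempty, so \<open>card (K - {i}) = m\<close> forces
        \<open>card K = Suc m\<close> despite truncated subtraction, and likewise for L.\<close>
      have "card K > 0" "card L > 0" using that by (auto simp: card_gt_0_iff)
      then show "card (K - {i}) \<noteq> m \<or> card (L - {j}) \<noteq> m"
        using \<open>card K \<noteq> Suc m \<or> card L \<noteq> Suc m\<close> that by auto
    qed (intro test_functions_partial \<open>f \<in> test_functions U\<close>)
    then show ?thesis by (simp add: ddsharp_current_eq)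
  qed
  show "linear_on_tests U (?W K L)" for K L
  proof -
    have tf: "partial_x j (partial_x i f) \<in> test_functions U" if "f \<in> test_functions U" for i j f
      by (intro test_functions_partial that)
    have "?M (K - {i}) (L - {j}) (partial_x j (partial_x i (\<lambda>x. f x + g x))) =
       ?M (K - {i}) (L - {j}) (partial_x j (partial_x i f)) + ?M (K - {i}) (L - {j}) (partial_x j (partial_x i g))"
      if "f \<in> test_functions U" "g \<in> test_functions U" for f g i j
      using linear_on_tests_add[OF mult_current_linear tf[OF that(1)] tf[OF that(2)]]
      by (simp add: partial_x_add_smooth smooth_partial test_functions_smooth[OF that(1)] test_functions_smooth[OF that(2)])
    moreover have "?M (K - {i}) (L - {j}) (partial_x j (partial_x i (\<lambda>x. c * f x))) =
       c * ?M (K - {i}) (L - {j}) (partial_x j (partial_x i f))"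
      if "f \<in> test_functions U" for f i j c
      using linear_on_tests_cmult[OF mult_current_linear tf[OF that]]
      by (simp add: partial_x_cmult_smooth smooth_partial test_functions_smooth[OF that])
    ultimately show ?thesis
      unfolding linear_on_tests_def ddsharp_current_eq
      by (simp add: distrib_left sum.distrib sum_distrib_left mult_ac)
  qed
  show "\<forall>f\<in>test_functions U. ?W K L f = 0" if "card K \<noteq> Suc m \<or> card L \<noteq> Suc m" for K L
    using zero[OF that] by blast
  show "symmetric_current U ?W"
    unfolding symmetric_current_def
  proof (intro allI ballI)
    fix K L f assume f: "f \<in> test_functions U"
    show "?W K L f = ?W L K f"
    proof (cases "card K = Suc m \<and> card L = Suc m")
      case True
      have "?M (K - {i}) (L - {j}) (partial_x j (partial_x i f)) =
         ?M (L - {j}) (K - {i}) (partial_x i (partial_x j f))" for i j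
        using mult_current_symmetric[OF test_functions_partial[OF test_functions_partial[OF f]], of "K - {i}" "L - {j}" j i]
          partial_x_commute[OF test_functions_smooth[OF f], of i j] by simp
      then have "?W K L f = (-1) ^ m * (\<Sum>i\<in>K. \<Sum>j\<in>L. insert_sign j L * insert_sign i K *
         ?M (L - {j}) (K - {i}) (partial_x i (partial_x j f)))"
        using True by (simp add: ddsharp_current_eq mult.commute[of "insert_sign _ K"])
      also have "\<dots> = ?W L K f"
        using True by (subst sum.swap) (simp add: ddsharp_current_eq)
      finally show ?thesis .
    next
      case False
      then show ?thesis using zero[OF _ f] by metis
    qed
  qed
  show "closed_current U ?W"
    unfolding closed_current_def using d_d_current test_functions_smooth by blast
  show "0 \<le> quadratic_form (Suc m) ?W a" if "\<forall>K. a K \<in> test_functions U" for a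
    using quadratic_form_ddsharp_nonneg[OF assms] that by blast
qed

end

end

section \<open>Regularisation of currents\<close>

lemma locally_finite_sigma_finite:
  fixes \<mu> :: "(real^'n::finite) measure"
  assumes "locally_finite_measure UNIV \<mu>"
  shows "sigma_finite_measure \<mu>"
proof
  have s: "sets \<mu> = sets borel" using assms by (simp add: locally_finite_measure_def)
  show "\<exists>A. countable A \<and> A \<subseteq> sets \<mu> \<and> \<Union> A = space \<mu> \<and> (\<forall>a\<in>A. emeasure \<mu> a \<noteq> \<infinity>)"
  proof (intro exI conjI)
    let ?A = "range (\<lambda>n. cball (0 :: real^'n) (real n))"
    show "countable ?A" by simp
    show "?A \<subseteq> sets \<mu>" unfolding s by auto
    have "x \<in> \<Union> ?A" for x :: "real^'n"
    proof -
      obtain n where "norm x \<le> real n" using real_arch_simple by blast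
      then show ?thesis by (intro UN_I[of n]) simp_all
    qed
    then have "\<Union> ?A = UNIV" by (rule UNIV_eq_I[symmetric])
    then show "\<Union> ?A = space \<mu>" by (simp only: sets_eq_imp_space_eq[OF s] space_borel)
    have "emeasure \<mu> (cball 0 (real n)) < \<infinity>" for n
      using assms compact_cball[of 0 "real n"] unfolding locally_finite_measure_def by blast
    then show "\<forall>a\<in>?A. emeasure \<mu> a \<noteq> \<infinity>" by (simp add: less_top)
  qed
qed

text \<open>Joint continuity gives joint measurability, as the product of the Borel algebras is the
  Borel algebra of the product; compactness of \<open>K \<times> L\<close> gives integrability, and
  Fubini applies.\<close>

lemma continuous_compact_integral_swap:
  fixes F :: "real^'n::finite \<Rightarrow> real^'n \<Rightarrow> real"
  assumes \<mu>: "locally_finite_measure UNIV \<mu>"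
    and F: "continuous_on UNIV (\<lambda>z. F (fst z) (snd z))"
    and K: "compact K" "compact L" "\<And>x y. x \<notin> K \<or> y \<notin> L \<Longrightarrow> F x y = 0"
  shows "(\<integral>x. (\<integral>y. F x y \<partial>\<mu>) \<partial>lborel) = (\<integral>y. (\<integral>x. F x y \<partial>lborel) \<partial>\<mu>)"
    and "integrable lborel (\<lambda>x. \<integral>y. F x y \<partial>\<mu>)"
proof -
  have s: "sets \<mu> = sets borel" using \<mu> by (simp add: locally_finite_measure_def)
  interpret \<mu>: sigma_finite_measure \<mu> by (rule locally_finite_sigma_finite[OF \<mu>])
  interpret pair_sigma_finite lborel \<mu> ..
  have sets_pair: "sets (lborel \<Otimes>\<^sub>M \<mu>) = sets (borel :: ((real^'n) \<times> (real^'n)) measure)"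
    using s by (simp add: borel_prod[symmetric] cong: sets_pair_measure_cong)
  have "(\<lambda>z. F (fst z) (snd z)) \<in> borel_measurable borel"
    by (rule borel_measurable_continuous_onI[OF F])
  then have meas: "(\<lambda>z. F (fst z) (snd z)) \<in> borel_measurable (lborel \<Otimes>\<^sub>M \<mu>)"
    using measurable_cong_sets[OF sets_pair refl] by blast
  have KL: "compact (K \<times> L)" by (rule compact_Times[OF K(1,2)])
  have "bounded ((\<lambda>z. F (fst z) (snd z)) ` (K \<times> L))"
    using F by (intro compact_imp_bounded compact_continuous_image KL) (rule continuous_on_subset, auto)
  then obtain B where B: "B > 0" "\<And>x y. x \<in> K \<Longrightarrow> y \<in> L \<Longrightarrow> \<bar>F x y\<bar> \<le> B"
    unfolding bounded_pos by auto
  have "K \<in> sets lborel" "L \<in> sets \<mu>" using K s by (auto simp: borel_compact)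
  moreover have "emeasure lborel K < \<infinity>" "emeasure \<mu> L < \<infinity>"
    using K \<mu> locally_finite_lborel[of UNIV] by (auto simp: locally_finite_measure_def)
  moreover have "F (fst z) (snd z) = 0" if "z \<notin> K \<times> L" for z
    using that K(3)[of "fst z" "snd z"] by (cases z) auto
  moreover have "\<bar>F (fst z) (snd z)\<bar> \<le> B" if "z \<in> K \<times> L" for z
    using that B(2) by auto
  ultimately have int: "integrable (lborel \<Otimes>\<^sub>M \<mu>) (\<lambda>z. F (fst z) (snd z))"
    using meas
    by (intro integrableI_bounded_set[of "K \<times> L" _ _ B] AE_I2 impI)
       (simp_all add: \<mu>.emeasure_pair_measure_Times ennreal_mult_less_top)
  then have int': "integrable (lborel \<Otimes>\<^sub>M \<mu>) (\<lambda>(x, y). F x y)" by (simp add: case_prod_unfold)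
  show "(\<integral>x. (\<integral>y. F x y \<partial>\<mu>) \<partial>lborel) = (\<integral>y. (\<integral>x. F x y \<partial>lborel) \<partial>\<mu>)"
    using Fubini_integral[OF int'] by simp
  show "integrable lborel (\<lambda>x. \<integral>y. F x y \<partial>\<mu>)"
    using integrable_fst[OF int'] by simp
qed

lemma lborel_integral_translate:
  fixes f :: "real^'n::finite \<Rightarrow> real"
  assumes [measurable]: "f \<in> borel_measurable borel"
  shows "(\<integral>x. f (x - y) \<partial>lborel) = (\<integral>x. f x \<partial>lborel)"
proof -
  have "(\<integral>x. f x \<partial>lborel) = (\<integral>x. f x \<partial>distr lborel borel ((+) (- y)))"
    by (simp only: lborel_distr_plus)
  also have "\<dots> = (\<integral>x. f (- y + x) \<partial>lborel)" by (rule integral_distr) auto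
  finally show ?thesis by simp
qed

text \<open>Fubini, the translation x = y + z, and Fubini again. Both integrands vanish unless y
  lies in the compact r-neighbourhood L of a compact set K carrying f.\<close>

lemma mollifier_measure_convolution:
  fixes f \<rho> :: "real^'n::finite \<Rightarrow> real"
  assumes \<mu>: "locally_finite_measure UNIV \<mu>" and \<rho>: "mollifier r \<rho>" and f: "f \<in> test_functions UNIV"
  shows "(\<integral>x. (\<integral>y. \<rho> (x - y) \<partial>\<mu>) * f x \<partial>lborel) = (\<integral>z. \<rho> z * (\<integral>y. f (y + z) \<partial>\<mu>) \<partial>lborel)"
    and "integrable lborel (\<lambda>x. (\<integral>y. \<rho> (x - y) \<partial>\<mu>) * f x)"
    and "integrable lborel (\<lambda>z. \<rho> z * (\<integral>y. f (y + z) \<partial>\<mu>))"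
proof -
  have cont: "continuous_on A \<rho>" "continuous_on A f" for A
    using \<rho> f test_functions_smooth by (auto simp: mollifier_def intro: smooth_continuous)
  have r: "\<rho> x = 0" if "norm x > r" for x using \<rho> that by (simp add: mollifier_def)
  obtain K where K: "compact K" "\<And>x. x \<notin> K \<Longrightarrow> f x = 0"
    using test_functions_compactly_supported[OF f] by (rule compactly_supportedE) blast
  define L where "L = {x + y | x y. x \<in> K \<and> y \<in> cball 0 r}"
  have L: "compact L" unfolding L_def by (intro compact_sums K) simp
  have in_L: "x - z \<in> L" if "x \<in> K" "norm z \<le> r" for x z
  proof -
    have "x - z = x + (- z)" "- z \<in> cball 0 r" using that by auto
    then show ?thesis unfolding L_def using that(1) by blast
  qed
  have F: "continuous_on UNIV (\<lambda>z. \<rho> (fst z - snd z) * f (fst z))"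
    by (intro continuous_intros continuous_on_compose2[OF cont(1)] continuous_on_compose2[OF cont(2)]) auto
  have F0: "\<rho> (x - y) * f x = 0" if "x \<notin> K \<or> y \<notin> L" for x y
  proof (cases "x \<in> K")
    case True
    then have "r < norm (x - y)" using that in_L[OF True, of "x - y"] by fastforce
    then show ?thesis using r by simp
  qed (simp add: K(2))
  have G: "continuous_on UNIV (\<lambda>z. \<rho> (fst z) * f (snd z + fst z))"
    by (intro continuous_intros continuous_on_compose2[OF cont(1)] continuous_on_compose2[OF cont(2)]) auto
  have G0: "\<rho> z * f (y + z) = 0" if "z \<notin> cball 0 r \<or> y \<notin> L" for z y
  proof (cases "z \<in> cball 0 r")
    case True
    then have "y + z \<notin> K" using that in_L[of "y + z" z] by auto
    then show ?thesis using K(2) by simp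
  qed (use r in auto)
  note FS = continuous_compact_integral_swap[OF \<mu> F K(1) L F0]
    and GS = continuous_compact_integral_swap[OF \<mu> G compact_cball[of 0 r] L G0]
  have "(\<integral>x. \<rho> (x - y) * f x \<partial>lborel) = (\<integral>z. \<rho> z * f (y + z) \<partial>lborel)" for y
  proof -
    have "(\<lambda>z. \<rho> z * f (y + z)) \<in> borel_measurable borel"
      by (intro borel_measurable_continuous_onI continuous_intros cont continuous_on_compose2[OF cont(2)]) auto
    from lborel_integral_translate[OF this, of y] show ?thesis by simp
  qed
  then show "(\<integral>x. (\<integral>y. \<rho> (x - y) \<partial>\<mu>) * f x \<partial>lborel) = (\<integral>z. \<rho> z * (\<integral>y. f (y + z) \<partial>\<mu>) \<partial>lborel)"
    using FS(1) GS(1) by simp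
  show "integrable lborel (\<lambda>x. (\<integral>y. \<rho> (x - y) \<partial>\<mu>) * f x)" using FS(2) by simp
  show "integrable lborel (\<lambda>z. \<rho> z * (\<integral>y. f (y + z) \<partial>\<mu>))" using GS(2) by simp
qed

section \<open>Regularisation as an average of translates\<close>

lemma test_functions_translate:
  assumes "f \<in> test_functions UNIV"
  shows "(\<lambda>y. f (y + z)) \<in> test_functions UNIV"
proof -
  obtain K where K: "compact K" "\<And>x. x \<notin> K \<Longrightarrow> f x = 0"
    using test_functions_compactly_supported[OF assms] by (rule compactly_supportedE) blast
  have "compact ((\<lambda>x. - z + x) ` K)" using K(1) by (rule compact_translation)
  then show ?thesis
  proof (rule test_functionsI[rotated])
    show "f (x + z) = 0" if "x \<notin> (\<lambda>x. - z + x) ` K" for x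
    proof (rule K(2))
      have "x = - z + (x + z)" by simp
      then show "x + z \<notin> K" using that by blast
    qed
  qed (auto intro: smooth_translate test_functions_smooth[OF assms])
qed

lemma test_functions_reflect:
  assumes "f \<in> test_functions UNIV"
  shows "(\<lambda>y. f (x - y)) \<in> test_functions UNIV"
proof -
  obtain K where K: "compact K" "\<And>x. x \<notin> K \<Longrightarrow> f x = 0"
    using test_functions_compactly_supported[OF assms] by (rule compactly_supportedE) blast
  have "compact ((\<lambda>y. x - y) ` K)"
    using K(1) by (intro compact_continuous_image continuous_intros)
  then show ?thesis
  proof (rule test_functionsI[rotated])
    show "f (x - y) = 0" if "y \<notin> (\<lambda>y. x - y) ` K" for y
    proof (rule K(2))
      have "y = x - (x - y)" by simp
      then show "x - y \<notin> K" using that by blast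
    qed
  qed (auto intro: smooth_reflect test_functions_smooth[OF assms])
qed

text \<open>Moves the translation from the kernel to the test function, so the regularised
  functional is an average of translates of D with weight \<open>\<rho> z\<close>. Properties
  preserved by translation and averaging are thus inherited.\<close>

lemma distr_conv_formula:
  assumes R: "positive_linear_on (test_functions UNIV) R" and Q: "positive_linear_on (test_functions UNIV) Q"
    and D: "\<And>f. f \<in> test_functions UNIV \<Longrightarrow> D f = R f - Q f"
    and \<rho>: "mollifier r \<rho>" and f: "f \<in> test_functions UNIV"
  shows "distr_of_fun (distr_conv D \<rho>) f = (\<integral>z. \<rho> z * D (\<lambda>y. f (y + z)) \<partial>lborel)"
    and "integrable lborel (\<lambda>z. \<rho> z * D (\<lambda>y. f (y + z)))"
proof -
  obtain \<mu> where \<mu>: "locally_finite_measure UNIV \<mu>" "\<forall>f\<in>test_functions UNIV. R f = (\<integral>x. f x \<partial>\<mu>)"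
    using positive_distribution_is_measure[OF open_UNIV R] by blast
  obtain \<nu> where \<nu>: "locally_finite_measure UNIV \<nu>" "\<forall>f\<in>test_functions UNIV. Q f = (\<integral>x. f x \<partial>\<nu>)"
    using positive_distribution_is_measure[OF open_UNIV Q] by blast
  have rep: "D g = (\<integral>x. g x \<partial>\<mu>) - (\<integral>x. g x \<partial>\<nu>)" if "g \<in> test_functions UNIV" for g
    using D \<mu>(2) \<nu>(2) that by simp
  note rep_\<rho> = rep[OF test_functions_reflect[OF mollifier_test_function[OF \<rho>]]]
    and rep_f = rep[OF test_functions_translate[OF f]]
    and M = mollifier_measure_convolution[OF \<mu>(1) \<rho> f] and N = mollifier_measure_convolution[OF \<nu>(1) \<rho> f]
  show "distr_of_fun (distr_conv D \<rho>) f = (\<integral>z. \<rho> z * D (\<lambda>y. f (y + z)) \<partial>lborel)"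
    unfolding distr_of_fun_def distr_conv_def rep_\<rho> rep_f left_diff_distrib right_diff_distrib
    using M N by simp
  show "integrable lborel (\<lambda>z. \<rho> z * D (\<lambda>y. f (y + z)))"
    unfolding rep_f right_diff_distrib by (intro Bochner_Integration.integrable_diff M N)
qed

lemma distr_conv_tendsto:
  assumes R: "positive_linear_on (test_functions UNIV) R" and Q: "positive_linear_on (test_functions UNIV) Q"
    and D: "\<And>f. f \<in> test_functions UNIV \<Longrightarrow> D f = R f - Q f"
    and lin: "linear_on_tests UNIV D"
    and \<rho>: "\<And>j. mollifier (1 / real (Suc j)) (\<rho> j)" and f: "f \<in> test_functions UNIV"
  shows "(\<lambda>j. distr_of_fun (distr_conv D (\<rho> j)) f) \<longlonglongrightarrow> D f"
proof -
  obtain K where K: "compact K" "\<And>x. x \<notin> K \<Longrightarrow> f x = 0"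
    using test_functions_compactly_supported[OF f] by (rule compactly_supportedE) blast
  \<comment> \<open>All radii are at most 1, so every translate of f that occurs vanishes off this
    one compact set.\<close>
  define L where "L = {x + y | x y. x \<in> K \<and> y \<in> cball 0 1}"
  have L: "compact L" unfolding L_def by (intro compact_sums K) simp
  have in_L: "x + z \<in> L" if "x \<in> K" "norm z \<le> 1" for x z
    unfolding L_def using that by auto
  obtain \<phi> V where \<phi>: "\<phi> \<in> test_functions UNIV" "L \<subseteq> V" "\<And>x. x \<in> V \<Longrightarrow> \<phi> x = 1" "\<And>x. 0 \<le> \<phi> x"
    using smooth_cutoff[OF L open_UNIV subset_UNIV] by metis
  define C where "C = R \<phi> + Q \<phi> + 1"
  have C: "C \<ge> 1" "R \<phi> + Q \<phi> \<le> C"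
    using positive_linear_on_nonneg[OF R \<phi>(1,4)] positive_linear_on_nonneg[OF Q \<phi>(1,4)] by (auto simp: C_def)
  show ?thesis
  proof (rule tendstoI)
    fix \<epsilon> :: real assume "\<epsilon> > 0"
    define e where "e = \<epsilon> / (2 * C)"
    have e: "e > 0" "e * C = \<epsilon> / 2" using \<open>\<epsilon> > 0\<close> C(1) by (auto simp: e_def)
    obtain d where d: "d > 0" "\<And>x y. dist y x < d \<Longrightarrow> dist (f y) (f x) < e"
      using compactly_supported_uniformly_continuous[OF test_functions_compactly_supported[OF f]] e(1)
      unfolding uniformly_continuous_on_def by (metis UNIV_I)
    have near: "\<bar>D (\<lambda>y. f (y + z)) - D f\<bar> \<le> \<epsilon> / 2" if z: "norm z < d" "norm z \<le> 1" for z
    proof -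
      let ?g = "\<lambda>y. f (y + z) - f y"
      have tf: "?g \<in> test_functions UNIV" by (intro test_functions_diff test_functions_translate f)
      have "\<bar>?g y\<bar> \<le> e * \<phi> y" for y
      proof (cases "y \<in> L")
        case True
        then have "\<phi> y = 1" using \<phi>(2,3) by blast
        moreover have "dist (f (y + z)) (f y) < e" using z by (intro d(2)) (simp add: dist_norm)
        ultimately show ?thesis by (simp add: dist_real_def)
      next
        case False
        then have "y \<notin> K" "y + z \<notin> K"
          using in_L[of y 0] in_L[of "y + z" "- z"] z(2) by auto
        then show ?thesis using K(2) e(1) \<phi>(4) by simp
      qed
      then have "\<bar>R ?g\<bar> \<le> e * R \<phi>" "\<bar>Q ?g\<bar> \<le> e * Q \<phi>"
        by (auto intro: positive_linear_on_bound[OF R tf \<phi>(1)] positive_linear_on_bound[OF Q tf \<phi>(1)])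
      then have "\<bar>D ?g\<bar> \<le> e * (R \<phi> + Q \<phi>)" by (simp add: D[OF tf] distrib_left)
      also have "\<dots> \<le> e * C" using e(1) C(2) by (intro mult_left_mono) auto
      finally show ?thesis
        using linear_on_tests_diff[OF lin test_functions_translate[OF f] f] e(2) by simp
    qed
    have "(\<lambda>j. 1 / real (Suc j)) \<longlonglongrightarrow> 0"
      using LIMSEQ_inverse_real_of_nat by (simp add: inverse_eq_divide)
    then have "\<forall>\<^sub>F j in sequentially. 1 / real (Suc j) < d" using d(1) by (simp only: order_tendstoD)
    then show "\<forall>\<^sub>F j in sequentially. dist (distr_of_fun (distr_conv D (\<rho> j)) f) (D f) < \<epsilon>"
    proof eventually_elim
      case (elim j)
      note F = distr_conv_formula[OF R Q D \<rho>[of j] f]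
      have int\<rho>: "integrable lborel (\<rho> j)" by (rule mollifier_integrable[OF \<rho>])
      have "distr_of_fun (distr_conv D (\<rho> j)) f - D f = (\<integral>z. \<rho> j z * D (\<lambda>y. f (y + z)) - \<rho> j z * D f \<partial>lborel)"
        using F int\<rho> \<rho>[of j] by (simp add: mollifier_def)
      also have "\<bar>\<dots>\<bar> \<le> (\<integral>z. \<rho> j z * (\<epsilon> / 2) \<partial>lborel)"
      proof (rule integral_abs_bound_integral)
        fix z
        show "\<bar>\<rho> j z * D (\<lambda>y. f (y + z)) - \<rho> j z * D f\<bar> \<le> \<rho> j z * (\<epsilon> / 2)"
        proof (cases "norm z > 1 / real (Suc j)")
          case True
          then show ?thesis using \<rho>[of j] by (simp add: mollifier_def)
        next
          case False
          moreover have "1 / real (Suc j) \<le> 1" by simp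
          ultimately have "\<bar>D (\<lambda>y. f (y + z)) - D f\<bar> \<le> \<epsilon> / 2" using elim by (intro near) linarith+
          then have "\<rho> j z * \<bar>D (\<lambda>y. f (y + z)) - D f\<bar> \<le> \<rho> j z * (\<epsilon> / 2)"
            using \<rho>[of j] by (intro mult_left_mono) (auto simp: mollifier_def)
          moreover have "\<bar>\<rho> j z * D (\<lambda>y. f (y + z)) - \<rho> j z * D f\<bar> = \<rho> j z * \<bar>D (\<lambda>y. f (y + z)) - D f\<bar>"
            using \<rho>[of j] by (simp add: mollifier_def abs_mult flip: right_diff_distrib)
          ultimately show ?thesis by simp
        qed
      qed (use F int\<rho> in auto)
      also have "\<dots> = \<epsilon> / 2" using \<rho>[of j] by (simp add: mollifier_def)
      finally show ?case using \<open>\<epsilon> > 0\<close> by (simp add: dist_real_def)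
    qed
  qed
qed

text \<open>By \<open>distr_conv_formula\<close> each defining property is an integral over z, with
  weight \<open>\<rho> z \<ge> 0\<close>, of the same property of T tested on translated
  functions.\<close>

lemma positive_closed_regularized:
  fixes T :: "'n::{finite,linorder} current"
  assumes T: "positive_closed UNIV m T" and \<rho>: "mollifier r \<rho>"
  shows "positive_closed UNIV m (\<lambda>K L. distr_of_fun (distr_conv (T K L) \<rho>))"
proof -
  define G where "G K L f = (\<lambda>z. \<rho> z * T K L (\<lambda>y. f (y + z)))" for K L f
  note pn = pos_part_positive[OF open_UNIV T] neg_part_positive[OF open_UNIV T]
    coefficient_decomposition[OF open_UNIV T]
  have eq: "distr_of_fun (distr_conv (T K L) \<rho>) f = (\<integral>z. G K L f z \<partial>lborel)"
    and int: "integrable lborel (G K L f)" if "f \<in> test_functions UNIV" for K L f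
    using distr_conv_formula[OF pn \<rho> that] by (auto simp: G_def)
  note tr = test_functions_translate
  note lin = coefficient_linear[OF open_UNIV T]
  show ?thesis
    unfolding positive_closed_def
  proof (intro conjI allI impI)
    show "linear_on_tests UNIV (distr_of_fun (distr_conv (T K L) \<rho>))" for K L
      unfolding linear_on_tests_def
    proof (intro conjI ballI allI)
      fix f g :: "real^'n::{finite,linorder} \<Rightarrow> real"
      assume f: "f \<in> test_functions UNIV" and g: "g \<in> test_functions UNIV"
      have "G K L (\<lambda>x. f x + g x) = (\<lambda>z. G K L f z + G K L g z)"
        using linear_on_tests_add[OF lin tr[OF f] tr[OF g], of K L] by (simp add: G_def distrib_left)
      then show "distr_of_fun (distr_conv (T K L) \<rho>) (\<lambda>x. f x + g x) =
         distr_of_fun (distr_conv (T K L) \<rho>) f + distr_of_fun (distr_conv (T K L) \<rho>) g"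
        using int[OF f] int[OF g] by (simp add: eq f g test_functions_add)
    next
      fix f :: "real^'n::{finite,linorder} \<Rightarrow> real" and c
      assume f: "f \<in> test_functions UNIV"
      have "G K L (\<lambda>x. c * f x) = (\<lambda>z. c * G K L f z)"
        using linear_on_tests_cmult[OF lin tr[OF f], of K L] by (simp add: G_def mult.left_commute)
      then show "distr_of_fun (distr_conv (T K L) \<rho>) (\<lambda>x. c * f x) = c * distr_of_fun (distr_conv (T K L) \<rho>) f"
        by (simp add: eq f test_functions_cmult)
    qed
    show "\<forall>f\<in>test_functions UNIV. distr_of_fun (distr_conv (T K L) \<rho>) f = 0"
      if "card K \<noteq> m \<or> card L \<noteq> m" for K L
      using coefficient_zero[OF open_UNIV T that tr] by (simp add: eq G_def)
    show "symmetric_current UNIV (\<lambda>K L. distr_of_fun (distr_conv (T K L) \<rho>))"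
      unfolding symmetric_current_def
      using coefficient_symmetric[OF open_UNIV T tr] by (simp add: eq G_def)
    show "closed_current UNIV (\<lambda>K L. distr_of_fun (distr_conv (T K L) \<rho>))"
      unfolding closed_current_def
    proof (intro allI ballI)
      fix K L f assume f: "f \<in> test_functions (UNIV :: (real^'n::{finite,linorder}) set)"
      have "d_current (\<lambda>K L. distr_of_fun (distr_conv (T K L) \<rho>)) K L f =
         - (\<integral>z. (\<Sum>i\<in>K. insert_sign i K * G (K - {i}) L (partial_x i f) z) \<partial>lborel)"
        using int[OF test_functions_partial[OF f]]
        by (simp add: d_current_eq eq test_functions_partial[OF f])
      moreover have "(\<Sum>i\<in>K. insert_sign i K * G (K - {i}) L (partial_x i f) z) = 0" for z
      proof -
        have "(\<Sum>i\<in>K. insert_sign i K * G (K - {i}) L (partial_x i f) z) =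
           \<rho> z * (\<Sum>i\<in>K. insert_sign i K * T (K - {i}) L (partial_x i (\<lambda>y. f (y + z))))"
          by (simp add: G_def partial_x_translate[OF test_functions_smooth[OF f]] sum_distrib_left mult_ac)
        then show ?thesis using closed_x[OF open_UNIV T tr[OF f]] by simp
      qed
      ultimately show "d_current (\<lambda>K L. distr_of_fun (distr_conv (T K L) \<rho>)) K L f = 0" by simp
    qed
    fix a :: "'n set \<Rightarrow> real^'n::{finite,linorder} \<Rightarrow> real" assume a: "\<forall>K. a K \<in> test_functions UNIV"
    have aa: "(\<lambda>x. a K x * a L x) \<in> test_functions UNIV" for K L
      using a by (intro test_functions_mult) (auto intro: test_functions_smooth)
    have "quadratic_form m (\<lambda>K L. distr_of_fun (distr_conv (T K L) \<rho>)) a =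
       (\<integral>z. (\<Sum>K\<in>index_sets m. \<Sum>L\<in>index_sets m. total_sign TYPE('n) m * compl_sign K * compl_sign L *
          G K L (\<lambda>x. a K x * a L x) z) \<partial>lborel)"
      using int[OF aa] by (simp add: quadratic_form_def eq[OF aa])
    also have "\<dots> = (\<integral>z. \<rho> z * quadratic_form m T (\<lambda>K y. a K (y + z)) \<partial>lborel)"
      by (simp add: quadratic_form_def G_def sum_distrib_left mult_ac)
    also have "\<dots> \<ge> 0"
    proof (rule integral_nonneg_AE, rule AE_I2)
      show "0 \<le> \<rho> z * quadratic_form m T (\<lambda>K y. a K (y + z))" for z
        using \<rho> a by (intro mult_nonneg_nonneg quadratic_form_nonneg[OF open_UNIV T] tr) (auto simp: mollifier_def)
    qed
    finally show "0 \<le> quadratic_form m (\<lambda>K L. distr_of_fun (distr_conv (T K L) \<rho>)) a" .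
  qed
qed

lemma scaled_mollifier_mollifier:
  fixes \<eta> :: "real^'n::finite \<Rightarrow> real"
  assumes \<eta>: "radial_mollifier \<eta>" and "j > 0"
  shows "mollifier (1 / real j) (scaled_mollifier \<eta> j)"
  unfolding mollifier_def
proof (intro conjI allI impI)
  have sm: "smooth \<eta>" and supp: "\<And>x. \<eta> x \<noteq> 0 \<Longrightarrow> x \<in> cball 0 1"
    using \<eta> unfolding radial_mollifier_def by blast+
  show "smooth (scaled_mollifier \<eta> j)"
    unfolding scaled_mollifier_def[abs_def]
    using smooth_cmult[OF smooth_affine[OF sm, of 0 "real j"]] by simp
  show "0 \<le> scaled_mollifier \<eta> j x" for x
    using \<eta> by (simp add: scaled_mollifier_def radial_mollifier_def)
  show "scaled_mollifier \<eta> j x = 0" if "1 / real j < norm x" for x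
  proof -
    have "1 < norm (real j *\<^sub>R x)" using that assms(2) by (simp add: divide_less_eq mult.commute)
    then have "\<eta> (real j *\<^sub>R x) = 0" using supp[of "real j *\<^sub>R x"] by auto
    then show ?thesis by (simp add: scaled_mollifier_def)
  qed
  have [measurable]: "\<eta> \<in> borel_measurable borel"
    by (rule smooth_measurable[OF sm])
  have "(\<integral>x. \<eta> x \<partial>lborel) = (\<integral>x. \<eta> x \<partial>density (distr lborel borel (\<lambda>x::real^'n. 0 + real j *\<^sub>R x)) (\<lambda>_. \<bar>real j\<bar> ^ DIM(real^'n)))"
    using lborel_affine[of "real j" "0 :: real^'n"] assms(2) by simp
  also have "\<dots> = (\<integral>x. real j ^ CARD('n) * \<eta> (real j *\<^sub>R x) \<partial>lborel)"
    by (subst integral_real_density) (auto simp: integral_distr)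
  finally show "(\<integral>x. scaled_mollifier \<eta> j x \<partial>lborel) = 1"
    using \<eta> unfolding scaled_mollifier_def radial_mollifier_def by metis
qed


section \<open>Weak convergence\<close>

lemma positive_closed_mono:
  assumes "positive_closed V m S" "U \<subseteq> V"
  shows "positive_closed U m S"
  using assms(1) test_functions_mono[OF assms(2)]
  by (auto simp: positive_closed_def linear_on_tests_def symmetric_current_def closed_current_def subset_iff)

text \<open>\<alpha> has no d\<xi>-factor and J \<alpha> no dx-factor, so a single term of the wedge
  product survives, and its sign is 1.\<close>

lemma wedge_J_form:
  fixes \<alpha> :: "'n::{finite,linorder} form"
  assumes "\<alpha> \<in> test_forms U p 0"
  shows "wedge \<alpha> (J_form \<alpha>) K L x = \<alpha> K {} x * \<alpha> L {} x"
proof -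
  have zero: "\<alpha> M N = (\<lambda>x. 0)" if "N \<noteq> {}" for M N
    using assms that by (auto simp: test_forms_def)
  have J0: "J_form \<alpha> (K - M) N = (\<lambda>x. 0)" if "M \<in> Pow K - {K}" for M N
  proof -
    have "K - M \<noteq> {}" using that by auto
    then show ?thesis by (simp add: J_form_def)
  qed
  have "wedge \<alpha> (J_form \<alpha>) K L x = (\<Sum>M\<in>{K}. \<Sum>N\<in>Pow L.
     wedge_sign M N (K - M) (L - N) * \<alpha> M N x * J_form \<alpha> (K - M) (L - N) x)"
    unfolding wedge_def by (rule sum.mono_neutral_right) (simp_all add: J0)
  also have "\<dots> = (\<Sum>M\<in>{K}. \<Sum>N\<in>{{}}.
     wedge_sign M N (K - M) (L - N) * \<alpha> M N x * J_form \<alpha> (K - M) (L - N) x)"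
    by (intro sum.cong refl sum.mono_neutral_right) (auto simp: zero)
  also have "\<dots> = \<alpha> K {} x * \<alpha> L {} x"
    by (simp add: wedge_sign_def shuffle_sign_def J_form_def)
  finally show ?thesis .
qed

lemma positive_closed_if_positive_current:
  fixes T :: "'n::{finite,linorder} current"
  assumes T: "current U p T" "positive_current U p T" "closed_current U T"
  shows "positive_closed U (CARD('n) - p) T"
proof -
  define m where "m = CARD('n) - p"
  have p: "p \<le> CARD('n)" "CARD('n) - m = p" using T(1) by (auto simp: current_def m_def)
  have lin: "linear_on_tests U (T K L)" for K L
    using T(1) by (auto simp: current_def distribution_def linear_on_tests_def)
  have deg: "T K L f = 0" if "card K \<noteq> m \<or> card L \<noteq> m" "f \<in> test_functions U" for K L f
    using T(1) that by (auto simp: current_def m_def)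
  have card_compl: "card (- K) = p \<longleftrightarrow> card K = m" for K :: "'n set"
    using p card_mono[of UNIV K] by (auto simp: Compl_eq_Diff_UNIV card_Diff_subset m_def)
  have "0 \<le> quadratic_form m T a" if a: "\<forall>K. a K \<in> test_functions U" for a
  proof -
    \<comment> \<open>The pairing matches an index set of T with its complement in the test form,
      hence the argument \<open>- K\<close>.\<close>
    define \<alpha> :: "'n form" where "\<alpha> K L = (if card K = p \<and> L = {} then a (- K) else (\<lambda>x. 0))" for K L
    have \<alpha>: "\<alpha> \<in> test_forms U p 0"
      using a by (auto simp: test_forms_def \<alpha>_def)
    have aa: "(\<lambda>x. a K x * a L x) \<in> test_functions U" for K L
      using a by (intro test_functions_mult) (auto intro: test_functions_smooth)
    have "0 \<le> pairing T (\<lambda>K L x. sigma_sign p * wedge \<alpha> (J_form \<alpha>) K L x)"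
      using T(2) \<alpha> by (simp add: positive_current_def)
    also have "\<dots> = sigma_sign CARD('n) * (\<Sum>K\<in>UNIV. \<Sum>L\<in>UNIV. wedge_sign K L (- K) (- L) *
       T K L (\<lambda>x. sigma_sign p * (\<alpha> (- K) {} x * \<alpha> (- L) {} x)))"
      by (simp add: pairing_def wedge_J_form[OF \<alpha>])
    also have "\<dots> = sigma_sign CARD('n) * (\<Sum>K\<in>index_sets m. \<Sum>L\<in>index_sets m. wedge_sign K L (- K) (- L) *
       T K L (\<lambda>x. sigma_sign p * (a K x * a L x)))"
    proof -
      define F where "F K L = wedge_sign K L (- K) (- L) *
         T K L (\<lambda>x. sigma_sign p * (\<alpha> (- K) {} x * \<alpha> (- L) {} x))" for K L
      have F0: "F K L = 0" if "card K \<noteq> m \<or> card L \<noteq> m" for K L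
        using that linear_on_tests_0[OF lin] by (auto simp: F_def \<alpha>_def card_compl)
      have "(\<Sum>K\<in>UNIV. \<Sum>L\<in>UNIV. F K L) = (\<Sum>K\<in>index_sets m. \<Sum>L\<in>UNIV. F K L)"
        using F0 by (intro sum.mono_neutral_right) (auto intro!: sum.neutral)
      also have "\<dots> = (\<Sum>K\<in>index_sets m. \<Sum>L\<in>index_sets m. F K L)"
        using F0 by (intro sum.cong refl sum.mono_neutral_right) auto
      also have "\<dots> = (\<Sum>K\<in>index_sets m. \<Sum>L\<in>index_sets m. wedge_sign K L (- K) (- L) *
         T K L (\<lambda>x. sigma_sign p * (a K x * a L x)))"
        by (intro sum.cong refl) (auto simp: F_def \<alpha>_def card_compl)
      finally show ?thesis by (simp add: F_def)
    qed
    also have "\<dots> = quadratic_form m T a"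
    proof -
      \<comment> \<open>The three factors of the total sign: \<sigma>_n from the pairing, \<sigma>_p
        from the definition of positivity, and the sign of moving d\<xi>_L past the dx-factors of
        the complement of K.\<close>
      have "sigma_sign CARD('n) * (wedge_sign K L (- K) (- L) * T K L (\<lambda>x. sigma_sign p * (a K x * a L x))) =
         total_sign TYPE('n) m * compl_sign K * compl_sign L * T K L (\<lambda>x. a K x * a L x)"
        if "card K = m" "card L = m" for K L
        using that card_compl[of K] p
        by (simp add: linear_on_tests_cmult[OF lin aa] wedge_sign_def total_sign_def compl_sign_def mult_ac)
      then show ?thesis
        unfolding quadratic_form_def sum_distrib_left by (intro sum.cong refl) auto
    qed
    finally show ?thesis .
  qed
  then show ?thesis
    using T lin deg by (auto simp: positive_closed_def positive_current_def m_def)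
qed

text \<open>Test functions take the place of test forms because products with functions act on
  single coefficients; no degree has to be tracked.\<close>

definition coefficients_converge ::
    "(real^'n::{finite,linorder}) set \<Rightarrow> (nat \<Rightarrow> 'n current) \<Rightarrow> 'n current \<Rightarrow> bool" where
  "coefficients_converge U Sj S \<longleftrightarrow> (\<forall>K L. \<forall>f\<in>test_functions U. (\<lambda>j. Sj j K L f) \<longlonglongrightarrow> S K L f)"

lemma weakly_converges_if_coefficients_converge:
  "coefficients_converge U Sj S \<Longrightarrow> weakly_converges U p Sj S"
  unfolding weakly_converges_def pairing_def
  by (auto simp: coefficients_converge_def test_forms_def intro!: tendsto_mult tendsto_const tendsto_sum)

text \<open>The positive and negative parts are fixed linear combinations of coefficients, so they
  converge as well; this supplies the mass bounds behind \<open>distr_mult_tendsto\<close>.\<close>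

lemma mult_current_converges:
  assumes U: "open U" and Sj: "\<And>j. positive_closed U m (Sj j)" and S: "positive_closed U m S"
    and lim: "coefficients_converge U Sj S"
    and u: "\<And>j. convex_function_on U (uj j)" "convex_function_on U u" "locally_uniform_limit U uj u"
  shows "coefficients_converge U (\<lambda>j. mult_current U (uj j) (Sj j)) (mult_current U u S)"
  unfolding coefficients_converge_def mult_current_def
proof (intro allI ballI)
  fix K L f assume f: "f \<in> test_functions U"
  have lim': "(\<lambda>j. Sj j K L g) \<longlonglongrightarrow> S K L g" if "g \<in> test_functions U" for K L g
    using lim that by (simp add: coefficients_converge_def)
  show "(\<lambda>j. distr_mult U (uj j) (Sj j K L) f) \<longlonglongrightarrow> distr_mult U u (S K L) f"
  proof (rule distr_mult_tendsto[OF U pos_part_positive[OF U Sj] pos_part_positive[OF U S]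
        neg_part_positive[OF U Sj] neg_part_positive[OF U S]
        coefficient_decomposition[OF U Sj] coefficient_decomposition[OF U S]])
    show "continuous_on U (uj j)" "continuous_on U u" for j
      using convex_function_on_continuous[OF U] u by auto
  qed (use u(3) f in \<open>auto simp: pos_part_def neg_part_def diagonal_part_def
         intro!: tendsto_add tendsto_mult tendsto_const lim'\<close>)
qed

lemma ddsharp_converges:
  assumes "coefficients_converge U Sj S"
  shows "coefficients_converge U (\<lambda>j. d_current (dsharp_current (Sj j))) (d_current (dsharp_current S))"
  using assms unfolding coefficients_converge_def ddsharp_current_eq
  by (auto intro!: tendsto_mult tendsto_const tendsto_sum test_functions_partial)

text \<open>Convergence is carried through the induction together with positivity of all currents,
  the limit included, because positivity controls the masses in the next product. The list holds
  indices instead of functions so that one list serves every j.\<close>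

lemma wedge_ddsharp_converges:
  fixes S :: "'n::{finite,linorder} current"
  assumes U: "open U" and Sj: "\<And>j. positive_closed U m (Sj j)" and S: "positive_closed U m S"
    and lim: "coefficients_converge U Sj S"
    and u: "\<And>i j. i \<in> set is \<Longrightarrow> convex_function_on U (uj i j)"
      "\<And>i. i \<in> set is \<Longrightarrow> convex_function_on U (u i)"
      "\<And>i. i \<in> set is \<Longrightarrow> locally_uniform_limit U (uj i) (u i)"
    and "m + length is \<le> CARD('n)"
  shows "(\<forall>j. positive_closed U (m + length is) (wedge_ddsharp U (Sj j) (map (\<lambda>i. uj i j) is))) \<and>
    positive_closed U (m + length is) (wedge_ddsharp U S (map u is)) \<and>
    coefficients_converge U (\<lambda>j. wedge_ddsharp U (Sj j) (map (\<lambda>i. uj i j) is)) (wedge_ddsharp U S (map u is))"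
  using u assms(8)
proof (induction "is")
  case (Cons i "is")
  then have IH: "\<And>j. positive_closed U (m + length is) (wedge_ddsharp U (Sj j) (map (\<lambda>i. uj i j) is))"
    "positive_closed U (m + length is) (wedge_ddsharp U S (map u is))"
    "coefficients_converge U (\<lambda>j. wedge_ddsharp U (Sj j) (map (\<lambda>i. uj i j) is)) (wedge_ddsharp U S (map u is))"
    by auto
  have i: "\<And>j. convex_function_on U (uj i j)" "convex_function_on U (u i)" "locally_uniform_limit U (uj i) (u i)"
    using Cons.prems by auto
  have card: "Suc (m + length is) \<le> CARD('n)" using Cons.prems by simp
  show ?case
    using positive_closed_ddsharp[OF U IH(1) i(1) card] positive_closed_ddsharp[OF U IH(2) i(2) card]
      ddsharp_converges[OF mult_current_converges[OF U IH i]]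
    by simp
qed (use Sj S lim in auto)

lemma regularized_current_converges:
  fixes T :: "'n::{finite,linorder} current"
  assumes "positive_closed UNIV m T" "radial_mollifier \<eta>"
  shows "coefficients_converge UNIV (\<lambda>j. regularized_current T \<eta> (Suc j)) T"
  unfolding coefficients_converge_def regularized_current_def
proof (intro allI ballI)
  fix K L f assume f: "f \<in> test_functions (UNIV :: (real^'n::{finite,linorder}) set)"
  note T = open_UNIV assms(1)
  show "(\<lambda>j. distr_of_fun (distr_conv (T K L) (scaled_mollifier \<eta> (Suc j))) f) \<longlonglongrightarrow> T K L f"
    by (rule distr_conv_tendsto[OF pos_part_positive[OF T] neg_part_positive[OF T]
          coefficient_decomposition[OF T] coefficient_linear[OF T] _ f])
       (rule scaled_mollifier_mollifier[OF assms(2) zero_less_Suc])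
qed

theorem corollary1:
  fixes \<Omega> :: "(real^'n::{finite,linorder}) set"
    and T :: "'n current"
    and \<eta> :: "real^'n::{finite,linorder} \<Rightarrow> real"
    and v :: "nat \<Rightarrow> real^'n::{finite,linorder} \<Rightarrow> real"
    and vj :: "nat \<Rightarrow> nat \<Rightarrow> real^'n::{finite,linorder} \<Rightarrow> real"
    and p q :: nat
  assumes "open \<Omega>" and "compact (closure \<Omega>)"
    and "current UNIV p T" and "positive_current UNIV p T" and "closed_current UNIV T"
    and "radial_mollifier \<eta>"
    and "1 \<le> q" and "q \<le> p"
    and "\<And>i. i \<le> q \<Longrightarrow> convex_function_on \<Omega> (v i)"
    and "\<And>i j. i \<le> q \<Longrightarrow> convex_function_on \<Omega> (vj i j)"
    and "\<And>i. i \<le> q \<Longrightarrow> locally_uniform_limit \<Omega> (vj i) (v i)"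
    and "\<And>i j x. 1 \<le> i \<Longrightarrow> i \<le> q \<Longrightarrow> x \<in> \<Omega> \<Longrightarrow> vj i j x \<ge> v i x"
  shows "weakly_converges \<Omega> (p - q)
           (\<lambda>j. wedge_ddsharp \<Omega> (regularized_current T \<eta> j) (map (\<lambda>i. vj i j) [1..<Suc q]))
           (wedge_ddsharp \<Omega> T (map v [1..<Suc q]))
       \<and> weakly_converges \<Omega> (p - q)
           (\<lambda>j. mult_current \<Omega> (vj 0 j)
              (wedge_ddsharp \<Omega> (regularized_current T \<eta> j) (map (\<lambda>i. vj i j) [1..<Suc q])))
           (mult_current \<Omega> (v 0) (wedge_ddsharp \<Omega> T (map v [1..<Suc q])))"
proof -
  let ?m = "CARD('n) - p" and ?is = "[1..<Suc q]"
  let ?A = "\<lambda>j. wedge_ddsharp \<Omega> (regularized_current T \<eta> j) (map (\<lambda>i. vj i j) ?is)"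
  have T: "positive_closed UNIV ?m T"
    by (rule positive_closed_if_positive_current[OF assms(3-5)])
  \<comment> \<open>\<open>scaled_mollifier \<eta> 0\<close> is not a mollifier, whence the shift of all sequences by one.\<close>
  have Tj: "positive_closed \<Omega> ?m (regularized_current T \<eta> (Suc j))" for j
  proof (rule positive_closed_mono)
    show "positive_closed UNIV ?m (regularized_current T \<eta> (Suc j))"
      using positive_closed_regularized[OF T scaled_mollifier_mollifier[OF assms(6), of "Suc j"]]
      by (simp add: regularized_current_def[abs_def])
  qed simp
  have lim: "coefficients_converge \<Omega> (\<lambda>j. regularized_current T \<eta> (Suc j)) T"
    using regularized_current_converges[OF T assms(6)] test_functions_mono[of \<Omega> UNIV]
    by (auto simp: coefficients_converge_def)
  have shift: "locally_uniform_limit \<Omega> (\<lambda>j. vj i (Suc j)) (v i)" if "i \<le> q" for i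
    using assms(11)[OF that] unfolding locally_uniform_limit_def
    by (metis filterlim_compose filterlim_Suc)
  have "p \<le> CARD('n)" using assms(3) by (simp add: current_def)
  moreover have "length ?is = q" by (simp del: upt_Suc)
  ultimately have card: "?m + length ?is \<le> CARD('n)" using assms(8) by linarith
  have "(\<forall>j. positive_closed \<Omega> (?m + length ?is) (?A (Suc j))) \<and>
     positive_closed \<Omega> (?m + length ?is) (wedge_ddsharp \<Omega> T (map v ?is)) \<and>
     coefficients_converge \<Omega> (\<lambda>j. ?A (Suc j)) (wedge_ddsharp \<Omega> T (map v ?is))"
    by (rule wedge_ddsharp_converges[OF assms(1) Tj positive_closed_mono[OF T subset_UNIV] lim _ _ _ card])
       (use assms(9,10) shift in auto)
  then have W: "\<And>j. positive_closed \<Omega> (?m + length ?is) (?A (Suc j))"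
    "positive_closed \<Omega> (?m + length ?is) (wedge_ddsharp \<Omega> T (map v ?is))"
    "coefficients_converge \<Omega> (\<lambda>j. ?A (Suc j)) (wedge_ddsharp \<Omega> T (map v ?is))"
    by blast+
  have tail: "weakly_converges \<Omega> (p - q) X Y" if "coefficients_converge \<Omega> (\<lambda>j. X (Suc j)) Y" for X Y
    using weakly_converges_if_coefficients_converge[OF that, of "p - q"]
    unfolding weakly_converges_def by (auto intro: LIMSEQ_imp_Suc)
  \<comment> \<open>One further product, by the functions of index 0 and without dd#, gives the
    second claim.\<close>
  have "coefficients_converge \<Omega> (\<lambda>j. mult_current \<Omega> (vj 0 (Suc j)) (?A (Suc j)))
     (mult_current \<Omega> (v 0) (wedge_ddsharp \<Omega> T (map v ?is)))"
    by (rule mult_current_converges[OF assms(1) W assms(10)[OF le0] assms(9)[OF le0] shift[OF le0]])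
  from tail[OF W(3)] tail[OF this] show ?thesis ..
qed

end
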